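(* Let $\mathscr{C}$ be a $2d$-Calabi-Yau $(d+2)$-angulated category that is $K$-linear, Hom-finite and Krull-Schmidt. Let $T$ and $U$ be two basic Oppermann-Thomas cluster tilting objects of $\mathscr{C}$, with $\mathscr{T}=\mathrm{add}(T)$ and $\mathscr{U}=\mathrm{add}(U)$. Suppose that $d$ is odd, and that $U$ is mutable at the indecomposable summand $u$ with mutation $u^*$ such that $u$ and $u^*$ form an exchange pair, with exchange $(d+2)$-angles $$u^*\to e_d\to\cdots\to e_1\to u\xrightarrow{\delta}\Sigma^du^*,\qquad u\to f_d\to\cdots\to f_1\to u^*\xrightarrow{\epsilon}\Sigma^du.$$ (i) If $c_{\mathscr{T}}(u,\mathscr{U})([t])\ge0$ for all $t\in\mathscr{T}$, then for any $t\in\mathscr{T}$ $$c_{\mathscr{T}}(u,\mathscr{U})([t])=\dim_K\mathrm{Im}\big(\mathrm{Hom}_{\mathscr{C}}(t,u)\xrightarrow{\delta_*}\mathrm{Hom}_{\mathscr{C}}(t,\Sigma^du^* )\big),$$ where $\delta_*$ is composition with $\delta$. (ii) If $c_{\mathscr{T}}(u,\mathscr{U})([t])\le0$ for all $t\in\mathscr{T}$, then for any $t\in\mathscr{T}$ $$c_{\mathscr{T}}(u,\mathscr{U})([t])=-\dim_K\mathrm{Im}\big(\mathrm{Hom}_{\mathscr{C}}(t,u^* )\xrightarrow{\epsilon_*}\mathrm{Hom}_{\mathscr{C}}(t,\Sigma^du)\big),$$ where $\epsilon_*$ is composition with $\epsilon$.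
   Context: Throughout, $K$ is an algebraically closed field and $d$ is a positive integer. **$(d+2)$-angulated categories (Geiss-Keller-Oppermann).** Let $\mathscr{C}$ be an additive category with an automorphism $\Sigma^d$ (not assumed to be the $d$-th power of another functor). A $\Sigma^d$-sequence is a diagram $c^0\xrightarrow{\gamma^0}c^1\xrightarrow{\gamma^1}\cdots\to c^{d+1}\xrightarrow{\gamma^{d+1}}\Sigma^d(c^0)$. A $(d+2)$-angulated category is such a $\mathscr{C}$ together with a class of $\Sigma^d$-sequences, called $(d+2)$-angles, such that: (N1) the class is closed under sums and summands, contains $c\xrightarrow{\mathrm{id}}c\to0\to\cdots\to0\to\Sigma^d(c)$ for each $c$, and each morphism $c^0\to c^1$ is the first morphism of some $(d+2)$-angle; (N2) a $\Sigma^d$-sequence $c^0\xrightarrow{\gamma^0}c^1\xrightarrow{\gamma^1}\cdots\to c^{d+1}\xrightarrow{\gamma^{d+1}}\Sigma^d(c^0)$ is a $(d+2)$-angle if and only if its left rotation $c^1\xrightarrow{\gamma^1}c^2\to\cdots\to c^{d+1}\xrightarrow{\gamma^{d+1}}\Sigma^d(c^0)\xrightarrow{(-1)^d\Sigma^d(\gamma^0)}\Sigma^d(c^1)$ is; (N3) given $(d+2)$-angles $b^\bullet$ and $c^\bullet$ with morphisms $\beta^i,\gamma^i$, and $\varphi^0:b^0\to c^0$, $\varphi^1:b^1\to c^1$ with $\varphi^1\beta^0=\gamma^0\varphi^0$, there are $\varphi^i:b^i\to c^i$ ($2\le i\le d+1$) completing $\varphi^0,\varphi^1,\Sigma^d(\varphi^0)$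 to a morphism of $\Sigma^d$-sequences; (N4) (octahedral axiom) in (N3) the $\varphi^i$ can be chosen so that the mapping cone $b^1\oplus c^0\to b^2\oplus c^1\to\cdots\to\Sigma^d b^0\oplus c^{d+1}\to\Sigma^d b^1\oplus\Sigma^d c^0$, with morphisms $\begin{pmatrix}-\beta^{i+1}&0\\ \varphi^{i+1}&\gamma^i\end{pmatrix}$ for $0\le i\le d$ and last morphism $\begin{pmatrix}-\Sigma^d\beta^0&0\\ \Sigma^d\varphi^0&\gamma^{d+1}\end{pmatrix}$, is a $(d+2)$-angle. $\mathscr{C}$ is $2d$-Calabi-Yau if it has a Serre functor (an auto-equivalence $S$ with isomorphisms $\mathrm{Hom}_{\mathscr{C}}(Y,SX)\cong D\,\mathrm{Hom}_{\mathscr{C}}(X,Y)$ natural in $X,Y$, where $D=\mathrm{Hom}_K(-,K)$) isomorphic to $\Sigma^{2d}:=(\Sigma^d)^2$. **Oppermann-Thomas cluster tilting.** An object $T$ is an Oppermann-Thomas cluster tilting object if, with $\mathscr{T}=\mathrm{add}(T)$: (i) $\mathrm{Hom}_{\mathscr{C}}(\mathscr{T},\Sigma^d\mathscr{T})=0$; (ii) for every $c\in\mathscr{C}$ there is a $(d+2)$-angle $t_d\to t_{d-1}\to\cdots\to t_0\to c\to\Sigma^d(t_d)$ with all $t_i\in\mathscr{T}$. It is basic if its indecomposable summands are pairwise non-isomorphic. $\mathrm{Indec}(\mathscr{T})$ is the set of indecomposables of $\mathscr{T}$ up to isomorphism. **Mutation and exchange pairs.** Let $U$ be a basic Oppermann-Thomas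 cluster tilting object with indecomposable summands $u_1,\dots,u_m$. $U$ is mutable at $u\in\{u_1,\dots,u_m\}$ with mutation $u^*$ if $u^*$ is an indecomposable object of $\mathscr{C}$ such that the object with indecomposable summands $(\{u_1,\dots,u_m\}\setminus\{u\})\cup\{u^*\}$ is also an Oppermann-Thomas cluster tilting object. In that case $u,u^*$ form an exchange pair if $\mathrm{Ext}^d(u,u^* )=\mathrm{Hom}_{\mathscr{C}}(u,\Sigma^du^* )$ and $\mathrm{Ext}^d(u^*,u)=\mathrm{Hom}_{\mathscr{C}}(u^*,\Sigma^du)$ both have dimension $1$ over $K$ and there exist two $(d+2)$-angles $u^*\to e_d\to\cdots\to e_1\to u\xrightarrow{\delta}\Sigma^du^*$ and $u\to f_d\to\cdots\to f_1\to u^*\xrightarrow{\epsilon}\Sigma^du$ in which each $e_i$ and $f_i$ is a direct sum of indecomposables from $\mathrm{Indec}(\mathscr{U})\setminus\{u\}$. **Index and $c$-vector.** $K_0^{\mathrm{split}}(\mathscr{T})$ is the abelian group generated by objects of $\mathscr{T}$ modulo $[t]=[t_0]+[t_1]$ for $t\cong t_0\oplus t_1$; it is free on $[t]$, $t\in\mathrm{Indec}(\mathscr{T})$. The index of $c\in\mathscr{C}$ is $\mathrm{Ind}_{\mathscr{T}}(c)=\sum_{i=0}^d(-1)^i[t_i]\in K_0^{\mathrm{split}}(\mathscr{T})$ for any $(d+2)$-angle as in (ii) of the definition of cluster tilting; it is well defined. For an abelian group $A$, $A^*=\mathrm{Hom}(A,\mathbb{Z})$. For $u\in\mathrm{Indec}(\mathscr{U})$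 the homological $c$-vector of $(u,\mathscr{U})$ with respect to $\mathscr{T}$ is the element $c_{\mathscr{T}}(u,\mathscr{U})\in K_0^{\mathrm{split}}(\mathscr{T})^*$ determined by $c_{\mathscr{T}}(u,\mathscr{U})(\mathrm{Ind}_{\mathscr{T}}(v))=\delta_{uv}$ (Kronecker delta) for all $v\in\mathrm{Indec}(\mathscr{U})$; it exists and is unique because the $\mathrm{Ind}_{\mathscr{T}}(v)$, $v\in\mathrm{Indec}(\mathscr{U})$, form a basis of $K_0^{\mathrm{split}}(\mathscr{T})$. *)

theory Defs
  imports
    "HOL-Computational_Algebra.Polynomial"
    "HOL-Algebra.Free_Abelian_Groups"
begin

section \<open>Linear categories\<close>

text \<open>
  The objects of a category are the elements of a type \<open>'o\<close>. All morphisms live in one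
  ambient vector space, the type \<open>'m\<close>: each set \<open>Hom X Y\<close> is a subspace of it, and distinct Hom
  spaces meet only in the common zero vector. Every linear category is of this form (take the
  direct sum of all its Hom spaces as the ambient space). Composition is written in the usual
  order: \<open>g \<cdot> f\<close> is \<open>g\<close> after \<open>f\<close>. Values of the operations outside the relevant Hom spaces
  carry no meaning.
\<close>

record ('o, 'm, 'k) lincat =
  Hom :: "'o \<Rightarrow> 'o \<Rightarrow> 'm set"
  Comp :: "'m \<Rightarrow> 'm \<Rightarrow> 'm"  (infixl "\<cdot>\<index>" 70)
  idm :: "'o \<Rightarrow> 'm"
  scl :: "'k \<Rightarrow> 'm \<Rightarrow> 'm"

locale linear_category =
  fixes C :: "('o, 'm::ab_group_add, 'k::field, 'z) lincat_scheme" (structure)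
  assumes vector_space_scl: "vector_space (scl C)"
    and subspace_Hom: "module.subspace (scl C) (Hom C X Y)"
    and Hom_disjoint: "(X, Y) \<noteq> (X', Y') \<Longrightarrow> Hom C X Y \<inter> Hom C X' Y' \<subseteq> {0}"
    and Comp_closed: "\<lbrakk>f \<in> Hom C X Y; g \<in> Hom C Y Z\<rbrakk> \<Longrightarrow> g \<cdot> f \<in> Hom C X Z"
    and Comp_assoc:
      "\<lbrakk>f \<in> Hom C W X; g \<in> Hom C X Y; h \<in> Hom C Y Z\<rbrakk> \<Longrightarrow> h \<cdot> (g \<cdot> f) = (h \<cdot> g) \<cdot> f"
    and idm_closed: "idm C X \<in> Hom C X X"
    and idm_right: "f \<in> Hom C X Y \<Longrightarrow> f \<cdot> idm C X = f"
    and idm_left: "f \<in> Hom C X Y \<Longrightarrow> idm C Y \<cdot> f = f"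
    and Comp_add_left:
      "\<lbrakk>f \<in> Hom C X Y; g \<in> Hom C Y Z; h \<in> Hom C Y Z\<rbrakk> \<Longrightarrow> (g + h) \<cdot> f = g \<cdot> f + h \<cdot> f"
    and Comp_add_right:
      "\<lbrakk>f \<in> Hom C X Y; g \<in> Hom C X Y; h \<in> Hom C Y Z\<rbrakk> \<Longrightarrow> h \<cdot> (f + g) = h \<cdot> f + h \<cdot> g"
    and Comp_scl_left:
      "\<lbrakk>f \<in> Hom C X Y; g \<in> Hom C Y Z\<rbrakk> \<Longrightarrow> scl C a g \<cdot> f = scl C a (g \<cdot> f)"
    and Comp_scl_right:
      "\<lbrakk>f \<in> Hom C X Y; g \<in> Hom C Y Z\<rbrakk> \<Longrightarrow> g \<cdot> scl C a f = scl C a (g \<cdot> f)"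

definition is_iso where
  "is_iso C X Y f \<longleftrightarrow> f \<in> Hom C X Y \<and>
     (\<exists>g\<in>Hom C Y X. g \<cdot>\<^bsub>C\<^esub> f = idm C X \<and> f \<cdot>\<^bsub>C\<^esub> g = idm C Y)"

definition isomorphic where
  "isomorphic C X Y \<longleftrightarrow> (\<exists>f. is_iso C X Y f)"

definition zero_object :: "('o, 'm::ab_group_add, 'k, 'z) lincat_scheme \<Rightarrow> 'o \<Rightarrow> bool" where
  "zero_object C X \<longleftrightarrow> idm C X = 0"

text \<open>\<open>\<iota> j\<close> and \<open>\<pi> j\<close> are the inclusions and projections of a direct sum of the objects \<open>As ! j\<close>.\<close>

definition dsum_data ::
  "('o, 'm::ab_group_add, 'k, 'z) lincat_scheme \<Rightarrow> 'o \<Rightarrow> 'o list \<Rightarrow> (nat \<Rightarrow> 'm) \<Rightarrow> (nat \<Rightarrow> 'm) \<Rightarrow> bool"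
where
  "dsum_data C X As \<iota> \<pi> \<longleftrightarrow>
     (\<forall>j<length As. \<iota> j \<in> Hom C (As ! j) X \<and> \<pi> j \<in> Hom C X (As ! j)) \<and>
     (\<forall>j<length As. \<forall>k<length As. \<pi> j \<cdot>\<^bsub>C\<^esub> \<iota> k = (if j = k then idm C (As ! j) else 0)) \<and>
     (\<Sum>j<length As. \<iota> j \<cdot>\<^bsub>C\<^esub> \<pi> j) = idm C X"

text \<open>\<open>X\<close> is isomorphic to the direct sum of the list \<open>As\<close>; the empty sum is a zero object.\<close>

definition is_dsum ::
  "('o, 'm::ab_group_add, 'k, 'z) lincat_scheme \<Rightarrow> 'o \<Rightarrow> 'o list \<Rightarrow> bool" where
  "is_dsum C X As \<longleftrightarrow> (\<exists>\<iota> \<pi>. dsum_data C X As \<iota> \<pi>)"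

locale additive_category = linear_category +
  assumes zero_object_exists: "\<exists>Z. zero_object C Z"
    and dsum_exists: "\<exists>X. is_dsum C X [A, B]"

definition indecomposable ::
  "('o, 'm::ab_group_add, 'k, 'z) lincat_scheme \<Rightarrow> 'o \<Rightarrow> bool" where
  "indecomposable C X \<longleftrightarrow> \<not> zero_object C X \<and>
     (\<forall>A B. is_dsum C X [A, B] \<longrightarrow> zero_object C A \<or> zero_object C B)"

text \<open>The endomorphism ring of \<open>X\<close> is local: nonzero, and a sum of two non-units is a non-unit.\<close>

definition local_End ::
  "('o, 'm::ab_group_add, 'k, 'z) lincat_scheme \<Rightarrow> 'o \<Rightarrow> bool" where
  "local_End C X \<longleftrightarrow> idm C X \<noteq> 0 \<and>
     (\<forall>f\<in>Hom C X X. \<forall>g\<in>Hom C X X. is_iso C X X (f + g) \<longrightarrow> is_iso C X X f \<or> is_iso C X X g)"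

definition Krull_Schmidt ::
  "('o, 'm::ab_group_add, 'k, 'z) lincat_scheme \<Rightarrow> bool" where
  "Krull_Schmidt C \<longleftrightarrow> (\<forall>X. \<exists>As. is_dsum C X As \<and> (\<forall>A\<in>set As. local_End C A))"

definition Hom_finite ::
  "('o, 'm::ab_group_add, 'k::field, 'z) lincat_scheme \<Rightarrow> bool" where
  "Hom_finite C \<longleftrightarrow> (\<forall>X Y. \<exists>B. finite B \<and> Hom C X Y = module.span (scl C) B)"

abbreviation kdim :: "('o, 'm::ab_group_add, 'k::field, 'z) lincat_scheme \<Rightarrow> 'm set \<Rightarrow> nat" where
  "kdim C V \<equiv> vector_space.dim (scl C) V"

text \<open>\<open>add(T)\<close>: all direct summands of finite direct sums of copies of \<open>T\<close>.\<close>

definition add_closure ::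
  "('o, 'm::ab_group_add, 'k, 'z) lincat_scheme \<Rightarrow> 'o \<Rightarrow> 'o set" where
  "add_closure C T = {X. \<exists>n Y Z. is_dsum C Z (replicate n T) \<and> is_dsum C Z [X, Y]}"

text \<open>Indecomposables of \<open>add(T)\<close>. This set is closed under isomorphism, so statements about the
  set of isomorphism classes compare its elements by \<open>isomorphic\<close> in place of equality.\<close>

definition Indec ::
  "('o, 'm::ab_group_add, 'k, 'z) lincat_scheme \<Rightarrow> 'o \<Rightarrow> 'o set" where
  "Indec C T = {X \<in> add_closure C T. indecomposable C X}"

definition indec_decomposition ::
  "('o, 'm::ab_group_add, 'k, 'z) lincat_scheme \<Rightarrow> 'o \<Rightarrow> 'o list \<Rightarrow> bool" where
  "indec_decomposition C U us \<longleftrightarrow> is_dsum C U us \<and> (\<forall>v\<in>set us. indecomposable C v)"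

definition basic ::
  "('o, 'm::ab_group_add, 'k, 'z) lincat_scheme \<Rightarrow> 'o \<Rightarrow> bool" where
  "basic C U \<longleftrightarrow> (\<exists>us. indec_decomposition C U us \<and>
     (\<forall>i<length us. \<forall>j<length us. i \<noteq> j \<longrightarrow> \<not> isomorphic C (us ! i) (us ! j)))"


section \<open>Functors and Serre functors\<close>

definition is_functor where
  "is_functor C FO FM \<longleftrightarrow>
     (\<forall>X Y. \<forall>f\<in>Hom C X Y. FM f \<in> Hom C (FO X) (FO Y)) \<and>
     (\<forall>X. FM (idm C X) = idm C (FO X)) \<and>
     (\<forall>X Y Z. \<forall>f\<in>Hom C X Y. \<forall>g\<in>Hom C Y Z. FM (g \<cdot>\<^bsub>C\<^esub> f) = FM g \<cdot>\<^bsub>C\<^esub> FM f)"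

definition naturally_isomorphic where
  "naturally_isomorphic C FO FM GO GM \<longleftrightarrow>
     (\<exists>\<eta>. (\<forall>X. is_iso C (FO X) (GO X) (\<eta> X)) \<and>
          (\<forall>X Y. \<forall>f\<in>Hom C X Y. \<eta> Y \<cdot>\<^bsub>C\<^esub> FM f = GM f \<cdot>\<^bsub>C\<^esub> \<eta> X))"

definition auto_equivalence where
  "auto_equivalence C FO FM \<longleftrightarrow> is_functor C FO FM \<and>
     (\<exists>GO GM. is_functor C GO GM \<and>
        naturally_isomorphic C (GO \<circ> FO) (GM \<circ> FM) id id \<and>
        naturally_isomorphic C (FO \<circ> GO) (FM \<circ> GM) id id)"

text \<open>The dual space of a subspace \<open>V\<close>; its elements are functions on \<open>V\<close>, hence the extensionality.\<close>

definition dual_space :: "('k::field \<Rightarrow> 'm::ab_group_add \<Rightarrow> 'm) \<Rightarrow> 'm set \<Rightarrow> ('m \<Rightarrow> 'k) set" where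
  "dual_space s V = {\<xi> \<in> extensional V.
     (\<forall>x\<in>V. \<forall>y\<in>V. \<xi> (x + y) = \<xi> x + \<xi> y) \<and> (\<forall>a. \<forall>x\<in>V. \<xi> (s a x) = a * \<xi> x)}"

text \<open>\<open>\<eta> X Y\<close> is a linear isomorphism from \<open>Hom(Y, S X)\<close> to the dual of \<open>Hom(X, Y)\<close>. The last two
  clauses are naturality in \<open>Y\<close> and in \<open>X\<close>.\<close>

definition Serre_functor ::
  "('o, 'm::ab_group_add, 'k::field, 'z) lincat_scheme \<Rightarrow> ('o \<Rightarrow> 'o) \<Rightarrow> ('m \<Rightarrow> 'm) \<Rightarrow> bool" where
  "Serre_functor C SvO SvM \<longleftrightarrow> auto_equivalence C SvO SvM \<and>
     (\<exists>\<eta> :: 'o \<Rightarrow> 'o \<Rightarrow> 'm \<Rightarrow> 'm \<Rightarrow> 'k.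
        (\<forall>X Y. bij_betw (\<eta> X Y) (Hom C Y (SvO X)) (dual_space (scl C) (Hom C X Y))) \<and>
        (\<forall>X Y. \<forall>f\<in>Hom C Y (SvO X). \<forall>g\<in>Hom C Y (SvO X). \<forall>h\<in>Hom C X Y.
            \<eta> X Y (f + g) h = \<eta> X Y f h + \<eta> X Y g h) \<and>
        (\<forall>X Y a. \<forall>f\<in>Hom C Y (SvO X). \<forall>h\<in>Hom C X Y.
            \<eta> X Y (scl C a f) h = a * \<eta> X Y f h) \<and>
        (\<forall>X Y Y'. \<forall>g\<in>Hom C Y Y'. \<forall>f\<in>Hom C Y' (SvO X). \<forall>h\<in>Hom C X Y.
            \<eta> X Y (f \<cdot>\<^bsub>C\<^esub> g) h = \<eta> X Y' f (g \<cdot>\<^bsub>C\<^esub> h)) \<and>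
        (\<forall>X X' Y. \<forall>a\<in>Hom C X X'. \<forall>f\<in>Hom C Y (SvO X). \<forall>h\<in>Hom C X' Y.
            \<eta> X' Y (SvM a \<cdot>\<^bsub>C\<^esub> f) h = \<eta> X Y f (h \<cdot>\<^bsub>C\<^esub> a)))"


section \<open>\<open>(d+2)\<close>-angulated categories\<close>

text \<open>
  \<open>\<Sigma>O\<close> and \<open>\<Sigma>M\<close> are the action of the automorphism (written \<open>\<Sigma>\<^sup>d\<close> in the literature, but a primitive
  datum) on objects and morphisms. A sequence is a pair of lists of length \<open>d + 2\<close>, the objects
  \<open>c\<^sup>0, ..., c\<^sup>d\<^sup>+\<^sup>1\<close> and the morphisms \<open>\<gamma>\<^sup>0, ..., \<gamma>\<^sup>d\<^sup>+\<^sup>1\<close>; the final object \<open>\<Sigma>O c\<^sup>0\<close> is left implicit.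
\<close>

record ('o, 'm, 'k) angcat = "('o, 'm, 'k) lincat" +
  \<Sigma>O :: "'o \<Rightarrow> 'o"
  \<Sigma>M :: "'m \<Rightarrow> 'm"
  angles :: "('o list \<times> 'm list) set"

definition sigma_sequence where
  "sigma_sequence C d cs \<gamma> \<longleftrightarrow> length cs = d + 2 \<and> length \<gamma> = d + 2 \<and>
     (\<forall>i\<le>d. \<gamma> ! i \<in> Hom C (cs ! i) (cs ! Suc i)) \<and>
     \<gamma> ! (d + 1) \<in> Hom C (cs ! (d + 1)) (\<Sigma>O C (cs ! 0))"

definition sequence_morphism where
  "sequence_morphism C d bs \<beta> cs \<gamma> \<phi> \<longleftrightarrow>
     (\<forall>i\<le>d + 1. \<phi> i \<in> Hom C (bs ! i) (cs ! i)) \<and>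
     (\<forall>i\<le>d. \<phi> (Suc i) \<cdot>\<^bsub>C\<^esub> (\<beta> ! i) = (\<gamma> ! i) \<cdot>\<^bsub>C\<^esub> \<phi> i) \<and>
     \<Sigma>M C (\<phi> 0) \<cdot>\<^bsub>C\<^esub> (\<beta> ! (d + 1)) = (\<gamma> ! (d + 1)) \<cdot>\<^bsub>C\<^esub> \<phi> (d + 1)"

text \<open>The sequence \<open>(cs, \<gamma>)\<close> is isomorphic to the direct sum of \<open>(as, \<alpha>)\<close> and \<open>(bs, \<beta>)\<close>.\<close>

definition sequence_dsum where
  "sequence_dsum C d cs \<gamma> as \<alpha> bs \<beta> \<longleftrightarrow>
     (\<exists>\<iota> \<pi>. (\<forall>i\<le>d + 1. dsum_data C (cs ! i) [as ! i, bs ! i] (\<iota> i) (\<pi> i)) \<and>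
        sequence_morphism C d as \<alpha> cs \<gamma> (\<lambda>i. \<iota> i 0) \<and>
        sequence_morphism C d bs \<beta> cs \<gamma> (\<lambda>i. \<iota> i 1) \<and>
        sequence_morphism C d cs \<gamma> as \<alpha> (\<lambda>i. \<pi> i 0) \<and>
        sequence_morphism C d cs \<gamma> bs \<beta> (\<lambda>i. \<pi> i 1))"

definition left_rotation_objects where
  "left_rotation_objects C cs = tl cs @ [\<Sigma>O C (hd cs)]"

definition left_rotation_morphisms ::
  "('o, 'm, 'k::field, 'z) angcat_scheme \<Rightarrow> nat \<Rightarrow> 'm list \<Rightarrow> 'm list" where
  "left_rotation_morphisms C d \<gamma> = tl \<gamma> @ [scl C ((- 1) ^ d) (\<Sigma>M C (hd \<gamma>))]"

text \<open>\<open>(es, \<epsilon>)\<close> is a mapping cone of \<open>\<phi>\<close>: \<open>es ! i\<close> is a direct sum of \<open>b\<^sup>i\<^sup>+\<^sup>1\<close> (where \<open>b\<^sup>d\<^sup>+\<^sup>2\<close> is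
  \<open>\<Sigma>O b\<^sup>0\<close>) and \<open>c\<^sup>i\<close>. The morphisms are the block matrices
  \<open>(-\<beta>\<^sup>i\<^sup>+\<^sup>1, 0; \<phi>\<^sup>i\<^sup>+\<^sup>1, \<gamma>\<^sup>i)\<close>, written out with the inclusions \<open>\<iota>\<close> and projections \<open>\<pi>\<close>.\<close>

definition mapping_cone where
  "mapping_cone C d bs \<beta> cs \<gamma> \<phi> es \<epsilon> \<longleftrightarrow> sigma_sequence C d es \<epsilon> \<and>
     (\<exists>\<iota> \<pi>.
        (\<forall>i\<le>d. dsum_data C (es ! i) [bs ! Suc i, cs ! i] (\<iota> i) (\<pi> i)) \<and>
        dsum_data C (es ! (d + 1)) [\<Sigma>O C (bs ! 0), cs ! (d + 1)] (\<iota> (d + 1)) (\<pi> (d + 1)) \<and>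
        (\<forall>i\<le>d. \<epsilon> ! i =
            \<iota> (Suc i) 0 \<cdot>\<^bsub>C\<^esub> (- (\<beta> ! Suc i)) \<cdot>\<^bsub>C\<^esub> \<pi> i 0
          + \<iota> (Suc i) 1 \<cdot>\<^bsub>C\<^esub> \<phi> (Suc i) \<cdot>\<^bsub>C\<^esub> \<pi> i 0
          + \<iota> (Suc i) 1 \<cdot>\<^bsub>C\<^esub> (\<gamma> ! i) \<cdot>\<^bsub>C\<^esub> \<pi> i 1) \<and>
        \<epsilon> ! (d + 1) =
            \<Sigma>M C (\<iota> 0 0) \<cdot>\<^bsub>C\<^esub> (- \<Sigma>M C (\<beta> ! 0)) \<cdot>\<^bsub>C\<^esub> \<pi> (d + 1) 0
          + \<Sigma>M C (\<iota> 0 1) \<cdot>\<^bsub>C\<^esub> \<Sigma>M C (\<phi> 0) \<cdot>\<^bsub>C\<^esub> \<pi> (d + 1) 0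
          + \<Sigma>M C (\<iota> 0 1) \<cdot>\<^bsub>C\<^esub> (\<gamma> ! (d + 1)) \<cdot>\<^bsub>C\<^esub> \<pi> (d + 1) 1)"

text \<open>
  Closure under summands includes closure under isomorphism, so in \<open>N4\<close> it is immaterial which
  direct sums are used to form the cone.
\<close>

locale angulated_category =
  additive_category C for C :: "('o, 'm::ab_group_add, 'k::field, 'z) angcat_scheme" (structure) +
  fixes d :: nat
  assumes d_pos: "0 < d"
    and \<Sigma>_functor: "is_functor C (\<Sigma>O C) (\<Sigma>M C)"
    and \<Sigma>_add: "\<lbrakk>f \<in> Hom C X Y; g \<in> Hom C X Y\<rbrakk> \<Longrightarrow> \<Sigma>M C (f + g) = \<Sigma>M C f + \<Sigma>M C g"
    and \<Sigma>_scl: "f \<in> Hom C X Y \<Longrightarrow> \<Sigma>M C (scl C a f) = scl C a (\<Sigma>M C f)"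
    and \<Sigma>O_bij: "bij (\<Sigma>O C)"
    and \<Sigma>M_bij: "bij_betw (\<Sigma>M C) (Hom C X Y) (Hom C (\<Sigma>O C X) (\<Sigma>O C Y))"
    and angles_sequence: "(cs, \<gamma>) \<in> angles C \<Longrightarrow> sigma_sequence C d cs \<gamma>"
    and N1_sums_summands:
      "\<lbrakk>sigma_sequence C d as \<alpha>; sigma_sequence C d bs \<beta>; sigma_sequence C d cs \<gamma>;
        sequence_dsum C d cs \<gamma> as \<alpha> bs \<beta>\<rbrakk>
       \<Longrightarrow> (cs, \<gamma>) \<in> angles C \<longleftrightarrow> (as, \<alpha>) \<in> angles C \<and> (bs, \<beta>) \<in> angles C"
    and N1_trivial:
      "zero_object C Z \<Longrightarrow> (c # c # replicate d Z, idm C c # replicate (d + 1) 0) \<in> angles C"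
    and N1_extend:
      "f \<in> Hom C c0 c1 \<Longrightarrow> \<exists>cs \<gamma>. (cs, \<gamma>) \<in> angles C \<and> cs ! 0 = c0 \<and> cs ! 1 = c1 \<and> \<gamma> ! 0 = f"
    and N2:
      "sigma_sequence C d cs \<gamma> \<Longrightarrow>
       (cs, \<gamma>) \<in> angles C \<longleftrightarrow>
       (left_rotation_objects C cs, left_rotation_morphisms C d \<gamma>) \<in> angles C"
    and N3:
      "\<lbrakk>(bs, \<beta>) \<in> angles C; (cs, \<gamma>) \<in> angles C;
        \<phi>0 \<in> Hom C (bs ! 0) (cs ! 0); \<phi>1 \<in> Hom C (bs ! 1) (cs ! 1);
        \<phi>1 \<cdot> (\<beta> ! 0) = (\<gamma> ! 0) \<cdot> \<phi>0\<rbrakk>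
       \<Longrightarrow> \<exists>\<phi>. \<phi> 0 = \<phi>0 \<and> \<phi> 1 = \<phi>1 \<and> sequence_morphism C d bs \<beta> cs \<gamma> \<phi>"
    and N4:
      "\<lbrakk>(bs, \<beta>) \<in> angles C; (cs, \<gamma>) \<in> angles C;
        \<phi>0 \<in> Hom C (bs ! 0) (cs ! 0); \<phi>1 \<in> Hom C (bs ! 1) (cs ! 1);
        \<phi>1 \<cdot> (\<beta> ! 0) = (\<gamma> ! 0) \<cdot> \<phi>0\<rbrakk>
       \<Longrightarrow> \<exists>\<phi> es \<epsilon>. \<phi> 0 = \<phi>0 \<and> \<phi> 1 = \<phi>1 \<and> sequence_morphism C d bs \<beta> cs \<gamma> \<phi> \<and>
             mapping_cone C d bs \<beta> cs \<gamma> \<phi> es \<epsilon> \<and> (es, \<epsilon>) \<in> angles C"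

definition Calabi_Yau_2d ::
  "('o, 'm::ab_group_add, 'k::field, 'z) angcat_scheme \<Rightarrow> bool" where
  "Calabi_Yau_2d C \<longleftrightarrow> (\<exists>SvO SvM. Serre_functor C SvO SvM \<and>
     naturally_isomorphic C SvO SvM (\<Sigma>O C \<circ> \<Sigma>O C) (\<Sigma>M C \<circ> \<Sigma>M C))"


section \<open>Cluster tilting, mutation and exchange pairs\<close>

text \<open>The list \<open>ts\<close> is \<open>[t\<^sub>0, ..., t\<^sub>d]\<close>, whereas the angle runs \<open>t\<^sub>d \<rightarrow> ... \<rightarrow> t\<^sub>0 \<rightarrow> c\<close>.\<close>

definition T_resolution ::
  "('o, 'm::ab_group_add, 'k, 'z) angcat_scheme \<Rightarrow> nat \<Rightarrow> 'o \<Rightarrow> 'o \<Rightarrow> 'o list \<Rightarrow> bool" where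
  "T_resolution C d T c ts \<longleftrightarrow> length ts = d + 1 \<and> set ts \<subseteq> add_closure C T \<and>
     (\<exists>\<gamma>. (rev ts @ [c], \<gamma>) \<in> angles C)"

definition cluster_tilting ::
  "('o, 'm::ab_group_add, 'k, 'z) angcat_scheme \<Rightarrow> nat \<Rightarrow> 'o \<Rightarrow> bool" where
  "cluster_tilting C d T \<longleftrightarrow>
     (\<forall>X\<in>add_closure C T. \<forall>Y\<in>add_closure C T. Hom C X (\<Sigma>O C Y) = {0}) \<and>
     (\<forall>c. \<exists>ts. T_resolution C d T c ts)"

text \<open>\<open>U\<close> is the direct sum of \<open>u\<close> and the objects \<open>vs\<close>; \<open>U'\<close> is obtained by replacing \<open>u\<close> by
  \<open>u'\<close>.\<close>

definition mutable_at ::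
  "('o, 'm::ab_group_add, 'k, 'z) angcat_scheme \<Rightarrow> nat \<Rightarrow> 'o \<Rightarrow> 'o \<Rightarrow> 'o \<Rightarrow> bool" where
  "mutable_at C d U u u' \<longleftrightarrow> indecomposable C u' \<and>
     (\<exists>vs U'. indec_decomposition C U (u # vs) \<and> is_dsum C U' (u' # vs) \<and> cluster_tilting C d U')"

text \<open>There is an angle \<open>a \<rightarrow> e\<^sub>d \<rightarrow> ... \<rightarrow> e\<^sub>1 \<rightarrow> b \<rightarrow> \<Sigma>O a\<close> with last morphism \<open>\<delta>\<close> whose middle
  terms are direct sums of indecomposables of \<open>add(U)\<close> other than \<open>u\<close>.\<close>

definition exchange_angle ::
  "('o, 'm::ab_group_add, 'k, 'z) angcat_scheme \<Rightarrow> nat \<Rightarrow> 'o \<Rightarrow> 'o \<Rightarrow> 'o \<Rightarrow> 'o \<Rightarrow> 'm \<Rightarrow> bool" where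
  "exchange_angle C d U u a b \<delta> \<longleftrightarrow>
     (\<exists>es \<gamma>. length es = d \<and> (a # es @ [b], \<gamma> @ [\<delta>]) \<in> angles C \<and>
        (\<forall>e\<in>set es. \<exists>vs. is_dsum C e vs \<and> (\<forall>v\<in>set vs. v \<in> Indec C U \<and> \<not> isomorphic C v u)))"

definition exchange_pair ::
  "('o, 'm::ab_group_add, 'k::field, 'z) angcat_scheme \<Rightarrow> nat \<Rightarrow> 'o \<Rightarrow> 'o \<Rightarrow> 'o \<Rightarrow> bool" where
  "exchange_pair C d U u u' \<longleftrightarrow>
     kdim C (Hom C u (\<Sigma>O C u')) = 1 \<and> kdim C (Hom C u' (\<Sigma>O C u)) = 1 \<and>
     (\<exists>\<delta>. exchange_angle C d U u u' u \<delta>) \<and> (\<exists>\<epsilon>. exchange_angle C d U u u u' \<epsilon>)"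


section \<open>Split Grothendieck group, index and \<open>c\<close>-vectors\<close>

definition K0_relations ::
  "('o, 'm::ab_group_add, 'k, 'z) lincat_scheme \<Rightarrow> 'o \<Rightarrow> ('o \<Rightarrow>\<^sub>0 int) set" where
  "K0_relations C T = generate (free_Abelian_group (add_closure C T))
     {frag_of t - (frag_of t0 + frag_of t1) | t t0 t1.
        t \<in> add_closure C T \<and> t0 \<in> add_closure C T \<and> t1 \<in> add_closure C T \<and> is_dsum C t [t0, t1]}"

definition K0_split ::
  "('o, 'm::ab_group_add, 'k, 'z) lincat_scheme \<Rightarrow> 'o \<Rightarrow> ('o \<Rightarrow>\<^sub>0 int) set monoid" where
  "K0_split C T = free_Abelian_group (add_closure C T) Mod K0_relations C T"

text \<open>The class in \<open>K0_split C T\<close> of a formal integral combination of objects of \<open>add(T)\<close>.\<close>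

definition K0_class ::
  "('o, 'm::ab_group_add, 'k, 'z) lincat_scheme \<Rightarrow> 'o \<Rightarrow> ('o \<Rightarrow>\<^sub>0 int) \<Rightarrow> ('o \<Rightarrow>\<^sub>0 int) set" where
  "K0_class C T x = r_coset (free_Abelian_group (add_closure C T)) (K0_relations C T) x"

definition Ind ::
  "('o, 'm::ab_group_add, 'k, 'z) angcat_scheme \<Rightarrow> nat \<Rightarrow> 'o \<Rightarrow> 'o \<Rightarrow> ('o \<Rightarrow>\<^sub>0 int) set" where
  "Ind C d T c = (THE x. \<exists>ts. T_resolution C d T c ts \<and>
     x = K0_class C T (\<Sum>i\<le>d. frag_cmul ((- 1) ^ i) (frag_of (ts ! i))))"

text \<open>The dual \<open>A\<^sup>* = Hom(A, \<int>)\<close>; extensionality makes its elements functions on the carrier.\<close>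

definition dual_group :: "('a, 'b) monoid_scheme \<Rightarrow> ('a \<Rightarrow> int) set" where
  "dual_group A = hom A integer_group \<inter> extensional (carrier A)"

definition c_vector ::
  "('o, 'm::ab_group_add, 'k, 'z) angcat_scheme \<Rightarrow> nat \<Rightarrow> 'o \<Rightarrow> 'o \<Rightarrow> 'o \<Rightarrow> ('o \<Rightarrow>\<^sub>0 int) set \<Rightarrow> int"
where
  "c_vector C d T U u = (THE \<chi>. \<chi> \<in> dual_group (K0_split C T) \<and>
     (\<forall>v\<in>Indec C U. \<chi> (Ind C d T v) = (if isomorphic C u v then 1 else 0)))"

end

theory Submission
  imports Defs
begin

text \<open>
  Write \<open>\<Sigma>\<close> for \<open>\<Sigma>\<^sup>d\<close>. If two angles end in the same object \<open>c\<close>, the mapping cone of a lift of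
  \<open>id\<^sub>c\<close> contains \<open>id\<^sub>c\<close> as a summand; splitting it off gives a new angle in which the two angles are
  spliced together. Splicing two resolutions of \<open>c\<close> produces a split angle in \<open>add(T)\<close>, so the index
  is well defined, and repeatedly splicing an angle with resolutions of its last object shows that
  the index is additive along angles whose first object lies in \<open>add(T)\<close>.
  Applied to the resolution of \<open>\<Sigma> t\<close> by \<open>U\<close>, and to the resolutions of the summands of \<open>U\<close> by \<open>T\<close>,
  this shows that the \<open>c\<close>-vector at \<open>[t]\<close> is the multiplicity of \<open>u\<close> in the alternating sum of the
  objects of an angle \<open>t \<rightarrow> u\<^sup>0 \<rightarrow> ... \<rightarrow> u\<^sup>d \<rightarrow> \<Sigma> t\<close> over \<open>add(U)\<close>.
  The multiplicity of \<open>u\<close> in \<open>x\<close> is \<open>dim Hom(x, \<Sigma> u\<^sup>*)\<close>, and the long exact sequence of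
  \<open>Hom(-, \<Sigma> u\<^sup>*)\<close> evaluates the alternating sum to
  \<open>dim Im(\<delta>\<^sub>* on Hom(t, u)) - dim Im(\<epsilon>\<^sub>* on Hom(t, u\<^sup>*))\<close> because \<open>d\<close> is odd.
  Finally, if \<open>\<delta> a \<noteq> 0\<close> for some \<open>a : t \<rightarrow> u\<close>, then by Serre duality \<open>\<epsilon>\<close> is a multiple of
  \<open>\<Sigma>a w\<close> for some \<open>w : u\<^sup>* \<rightarrow> \<Sigma> t\<close>, so \<open>\<epsilon>\<close> vanishes on all maps from \<open>add(T)\<close> to \<open>u\<^sup>*\<close>. Hence one of
  the two terms is zero for all \<open>t\<close>, and the sign of the \<open>c\<close>-vector decides which one.
\<close>


section \<open>Dimensions of subspaces\<close>

text \<open>The index is not additive along arbitrary angles. Splicing an angle with a resolution of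
  its last object needs a lift of one angle to the other, and the obstruction is a map from an
  object of add(T) to the shift of the first object of the angle. It vanishes by rigidity once that
  first object lies in add(T). The angles that matter comply: the resolution of \<Sigma> t over U,
  rotated, starts at t, and the resolution over T of a summand v of U, rotated, starts at v, where
  the index is taken with respect to U.

  Identities in \<open>K0_split\<close> are proved numerically: an element is a relation if the
  functions dim Hom(s,-) - dim rad(s,-), with s local, vanish on it. An angle over add(T) has zero
  connecting morphism, so both dimensions have vanishing alternating sum along it.

  Serre duality only produces some nonzero map \<Sigma>a w from u' to \<Sigma> u. That \<epsilon> is
  a multiple of it is due to dim Hom(u', \<Sigma> u) = 1, and \<epsilon> a' then vanishes because w
  a' lies in Hom(t', \<Sigma> t) = 0.\<close>

context vector_space
begin

text \<open>Rank-nullity in the form that fits Hom spaces, where composition is linear only on the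
  subspace \<open>V\<close> of the ambient space. A basis \<open>BK\<close> of the kernel is
  extended to a basis \<open>B\<close> of \<open>V\<close>, and the complement \<open>D\<close> of
  \<open>BK\<close> in \<open>B\<close> maps to a basis of the image.\<close>

lemma dim_kernel_image:
  assumes V: "subspace V" and fin: "finite B0" "V \<subseteq> span B0"
    and add: "\<And>x y. x \<in> V \<Longrightarrow> y \<in> V \<Longrightarrow> f (x + y) = f x + f y"
    and scl: "\<And>a x. x \<in> V \<Longrightarrow> f (scale a x) = scale a (f x)"
  shows "dim V = dim {x\<in>V. f x = 0} + dim (f ` V)"
proof -
  interpret vp: vector_space_pair scale scale by unfold_locales
  let ?K = "{x\<in>V. f x = 0}"
  have f0: "f 0 = 0" using scl[of 0 0] subspace_0[OF V] by simp
  have K: "subspace ?K"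
    using V f0 by (auto simp: subspace_def add scl)
  obtain BK where BK: "BK \<subseteq> ?K" "independent BK" "?K \<subseteq> span BK" "card BK = dim ?K"
    using basis_exists by blast
  obtain B where B: "BK \<subseteq> B" "B \<subseteq> V" "independent B" "V \<subseteq> span B"
    using maximal_independent_subset_extend[of BK V] BK by blast
  have finB: "finite B" using independent_span_bound[OF fin(1) B(3)] B(2) fin(2) by blast
  have spanB: "span B = V" using B(2,4) V by (simp add: span_minimal subset_antisym)
  \<comment> \<open>\<open>g\<close> is linear on the whole ambient space and agrees with
    \<open>f\<close> on \<open>V\<close>, so the theory of linear maps applies to it.\<close>
  define g where "g = vp.construct B f"
  have lg: "Vector_Spaces.linear scale scale g" unfolding g_def by (rule vp.linear_construct[OF B(3)])
  interpret g: Vector_Spaces.linear scale scale g by (rule lg)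
  have gB: "g b = f b" if "b \<in> B" for b unfolding g_def by (rule vp.construct_basis[OF B(3) that])
  have gf: "x \<in> V \<and> g x = f x" if "x \<in> V" for x
  proof -
    have "x \<in> span B" using that spanB by simp
    then show ?thesis
    proof (induction rule: span_induct_alt)
      case base show ?case using f0 subspace_0[OF V] by (simp add: g.zero)
    next
      case (step c x y)
      then have "x \<in> V" using B(2) by blast
      then show ?case using step gB
        by (auto simp: g.add g.scale add scl subspace_scale[OF V] subspace_add[OF V])
    qed
  qed
  define D where "D = B - BK"
  have indD: "independent D" using B(3) D_def by (meson Diff_subset independent_mono)
  have inj: "inj_on g (span D)"
  proof (subst g.inj_on_iff_eq_0)
    show "subspace (span D)" by simp
    show "\<forall>x\<in>span D. g x = 0 \<longrightarrow> x = 0"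
    proof (intro ballI impI)
      fix x assume x: "x \<in> span D" "g x = 0"
      have "x \<in> V" using x(1) span_mono[of D B] spanB D_def by auto
      then have "x \<in> ?K" using gf x(2) by auto
      then have "x \<in> span BK" using BK by blast
      \<comment> \<open>A vector in both spans has \<open>B\<close>-coordinates supported in
        \<open>D\<close> and in \<open>BK\<close>, which are disjoint.\<close>
      then have "representation B x b = 0" for b
        using representation_extend[OF B(3), of x D] representation_extend[OF B(3), of x BK] x(1) B(1) D_def
          representation_ne_zero[of D x b] representation_ne_zero[of BK x b] by auto
      then show "x = 0"
        using sum_nonzero_representation_eq[OF B(3), of x] \<open>x \<in> V\<close> spanB by simp
    qed
  qed
  have "f ` V = g ` span B" using gf spanB by (simp cong: image_cong)
  also have "\<dots> = span (g ` B)" by (simp add: g.span_image)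
  also have "\<dots> = span (g ` D)"
  proof -
    have "g ` B \<subseteq> insert 0 (g ` D)" using gB BK(1) B(1) by (auto simp: D_def)
    then have "span (g ` B) \<subseteq> span (g ` D)" using span_mono[of "g ` B" "insert 0 (g ` D)"] by simp
    moreover have "span (g ` D) \<subseteq> span (g ` B)" by (rule span_mono) (auto simp: D_def)
    ultimately show ?thesis by simp
  qed
  finally have "dim (f ` V) = dim (span (g ` D))" by simp
  also have "\<dots> = card (g ` D)"
    using g.independent_injective_image[OF indD inj] by (simp add: dim_eq_card_independent)
  also have "\<dots> = card D"
    using inj span_superset inj_on_subset by (metis card_image)
  finally have "dim (f ` V) = card D" .
  moreover have "dim V = card B" using B by (metis basis_card_eq_dim)
  moreover have "card B = card BK + card D"
    using finB B(1) D_def by (simp add: card_Diff_subset finite_subset card_mono)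
  ultimately show ?thesis using BK(4) by simp
qed

lemma dim_psubset_subspace:
  assumes W: "subspace W" and "W \<subset> V" and fin: "finite B0" "V \<subseteq> span B0"
  shows "dim W < dim V"
proof -
  obtain BW where BW: "BW \<subseteq> W" "independent BW" "W \<subseteq> span BW" "card BW = dim W"
    using basis_exists by blast
  obtain B where B: "BW \<subseteq> B" "B \<subseteq> V" "independent B" "V \<subseteq> span B"
    using maximal_independent_subset_extend[of BW V] BW assms(2) by blast
  have "finite B" using independent_span_bound[OF fin(1) B(3)] B(2) fin(2) by blast
  moreover have "B \<noteq> BW" using B(4) BW(1) W assms(2) span_minimal by blast
  ultimately have "card BW < card B" using B(1) by (simp add: psubset_card_mono psubsetI)
  moreover have "card B = dim V" using B by (metis basis_card_eq_dim)
  ultimately show ?thesis using BW(4) by simp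
qed

end

section \<open>Linear categories and direct sums\<close>

context linear_category
begin

sublocale vs: vector_space "scl C"
  by (rule vector_space_scl)

lemma zero_Hom [simp]: "0 \<in> Hom C X Y"
  using vs.subspace_0[OF subspace_Hom] .

lemma add_Hom: "f \<in> Hom C X Y \<Longrightarrow> g \<in> Hom C X Y \<Longrightarrow> f + g \<in> Hom C X Y"
  using vs.subspace_add[OF subspace_Hom] .

lemma diff_Hom: "f \<in> Hom C X Y \<Longrightarrow> g \<in> Hom C X Y \<Longrightarrow> f - g \<in> Hom C X Y"
  using vs.subspace_diff[OF subspace_Hom] .

lemma minus_Hom: "f \<in> Hom C X Y \<Longrightarrow> - f \<in> Hom C X Y"
  using vs.subspace_neg[OF subspace_Hom] .

lemma scl_Hom: "f \<in> Hom C X Y \<Longrightarrow> scl C a f \<in> Hom C X Y"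
  using vs.subspace_scale[OF subspace_Hom] .

lemma sum_Hom: "(\<And>i. i \<in> I \<Longrightarrow> f i \<in> Hom C X Y) \<Longrightarrow> sum f I \<in> Hom C X Y"
  using vs.subspace_sum[OF subspace_Hom] by blast

lemma Comp_zero_left [simp]: "f \<in> Hom C X Y \<Longrightarrow> 0 \<cdot> f = 0"
  using Comp_add_left[of f X Y 0 Y 0] by simp

lemma Comp_zero_right [simp]: "f \<in> Hom C X Y \<Longrightarrow> f \<cdot> 0 = 0"
  using Comp_add_right[of 0 X X 0 f Y] by simp

lemma Comp_minus_left: "f \<in> Hom C X Y \<Longrightarrow> g \<in> Hom C Y Z \<Longrightarrow> (- g) \<cdot> f = - (g \<cdot> f)"
  using Comp_add_left[of f X Y g Z "- g"] by (simp add: minus_Hom eq_neg_iff_add_eq_0 add.commute)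

lemma Comp_minus_right: "f \<in> Hom C X Y \<Longrightarrow> g \<in> Hom C Y Z \<Longrightarrow> g \<cdot> (- f) = - (g \<cdot> f)"
  using Comp_add_right[of f X Y "- f" g Z] by (simp add: minus_Hom eq_neg_iff_add_eq_0 add.commute)

lemma Comp_diff_left:
  "f \<in> Hom C X Y \<Longrightarrow> g \<in> Hom C Y Z \<Longrightarrow> h \<in> Hom C Y Z \<Longrightarrow> (g - h) \<cdot> f = g \<cdot> f - h \<cdot> f"
  using Comp_add_left[of f X Y g Z "- h"] by (simp add: minus_Hom Comp_minus_left)

lemma Comp_diff_right:
  "f \<in> Hom C X Y \<Longrightarrow> g \<in> Hom C X Y \<Longrightarrow> h \<in> Hom C Y Z \<Longrightarrow> h \<cdot> (f - g) = h \<cdot> f - h \<cdot> g"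
  using Comp_add_right[of f X Y "- g" h Z] by (simp add: minus_Hom Comp_minus_right)

lemma Comp_sum_left:
  assumes "f \<in> Hom C X Y" "\<And>i. i \<in> I \<Longrightarrow> g i \<in> Hom C Y Z"
  shows "(\<Sum>i\<in>I. g i) \<cdot> f = (\<Sum>i\<in>I. g i \<cdot> f)"
  using assms(2)
proof (induction I rule: infinite_finite_induct)
  case (insert x F)
  then show ?case using Comp_add_left[OF assms(1), of "g x" Z "sum g F"] sum_Hom[of F g Y Z] by simp
qed (use assms(1) in simp_all)

lemma Comp_sum_right:
  assumes "h \<in> Hom C Y Z" "\<And>i. i \<in> I \<Longrightarrow> f i \<in> Hom C X Y"
  shows "h \<cdot> (\<Sum>i\<in>I. f i) = (\<Sum>i\<in>I. h \<cdot> f i)"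
  using assms(2)
proof (induction I rule: infinite_finite_induct)
  case (insert x F)
  then show ?case using Comp_add_right[OF _ _ assms(1), of "f x" X "sum f F"] sum_Hom[of F f X Y] by simp
qed (use assms(1) in simp_all)

lemma Comp4:
  assumes "f \<in> Hom C V W" "g \<in> Hom C W X" "h \<in> Hom C X Y" "k \<in> Hom C Y Z"
  shows "(k \<cdot> h) \<cdot> (g \<cdot> f) = k \<cdot> ((h \<cdot> g) \<cdot> f)"
  using Comp_assoc[OF Comp_closed[OF assms(1,2)] assms(3,4)] Comp_assoc[OF assms(1-3)] by simp

lemma dsum_dataD:
  assumes "dsum_data C X As \<iota> \<pi>"
  shows "j < length As \<Longrightarrow> \<iota> j \<in> Hom C (As ! j) X" "j < length As \<Longrightarrow> \<pi> j \<in> Hom C X (As ! j)"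
    "j < length As \<Longrightarrow> \<pi> j \<cdot> \<iota> j = idm C (As ! j)"
    "j < length As \<Longrightarrow> k < length As \<Longrightarrow> j \<noteq> k \<Longrightarrow> \<pi> j \<cdot> \<iota> k = 0"
    "(\<Sum>j<length As. \<iota> j \<cdot> \<pi> j) = idm C X"
  using assms unfolding dsum_data_def by simp_all

lemma dsum_data2D:
  assumes "dsum_data C X [A, B] \<iota> \<pi>"
  shows "\<iota> 0 \<in> Hom C A X" "\<iota> 1 \<in> Hom C B X" "\<pi> 0 \<in> Hom C X A" "\<pi> 1 \<in> Hom C X B"
    "\<pi> 0 \<cdot> \<iota> 0 = idm C A" "\<pi> 1 \<cdot> \<iota> 1 = idm C B" "\<pi> 0 \<cdot> \<iota> 1 = 0" "\<pi> 1 \<cdot> \<iota> 0 = 0"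
    "\<iota> 0 \<cdot> \<pi> 0 + \<iota> 1 \<cdot> \<pi> 1 = idm C X"
  using dsum_dataD(1-3)[OF assms, of 0] dsum_dataD(1-3)[OF assms, of 1] dsum_dataD(5)[OF assms]
    dsum_dataD(4)[OF assms, of 0 1] dsum_dataD(4)[OF assms, of 1 0]
  by (simp_all add: lessThan_Suc add.commute)

lemma dsum_data2I:
  assumes "\<iota> 0 \<in> Hom C A X" "\<iota> (Suc 0) \<in> Hom C B X" "\<pi> 0 \<in> Hom C X A" "\<pi> (Suc 0) \<in> Hom C X B"
    "\<pi> 0 \<cdot> \<iota> 0 = idm C A" "\<pi> (Suc 0) \<cdot> \<iota> (Suc 0) = idm C B"
    "\<pi> 0 \<cdot> \<iota> (Suc 0) = 0" "\<pi> (Suc 0) \<cdot> \<iota> 0 = 0"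
    "\<iota> 0 \<cdot> \<pi> 0 + \<iota> (Suc 0) \<cdot> \<pi> (Suc 0) = idm C X"
  shows "dsum_data C X [A, B] \<iota> \<pi>"
  unfolding dsum_data_def using assms
  by (auto simp: lessThan_Suc add.commute less_Suc_eq nth_Cons')

lemma dsum_data2_eq:
  assumes "dsum_data C X [A, B] \<iota> \<pi>" "f \<in> Hom C W X" "g \<in> Hom C W X"
    "\<pi> 0 \<cdot> f = \<pi> 0 \<cdot> g" "\<pi> 1 \<cdot> f = \<pi> 1 \<cdot> g"
  shows "f = g"
proof -
  note D = dsum_data2D[OF assms(1)]
  have "h = \<iota> 0 \<cdot> (\<pi> 0 \<cdot> h) + \<iota> 1 \<cdot> (\<pi> 1 \<cdot> h)" if "h \<in> Hom C W X" for h
    using D(9) idm_left[OF that] Comp_add_left[OF that Comp_closed[OF D(3,1)] Comp_closed[OF D(4,2)]]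
      Comp_assoc[OF that D(3,1)] Comp_assoc[OF that D(4,2)] by metis
  from this[OF assms(2)] this[OF assms(3)] show ?thesis using assms(4,5) by simp
qed

lemma sum_lessThan_append:
  "(\<Sum>j<m + n. F j) = (\<Sum>j<m. F j) + (\<Sum>k<n. F (m + k))" for F :: "nat \<Rightarrow> 'm"
  by (induction n) (auto simp: add.assoc)

lemma is_dsum_Cons_merge:
  assumes "is_dsum C X (Y # Bs)" "is_dsum C Y As"
  shows "is_dsum C X (As @ Bs)"
proof -
  obtain \<iota> \<pi> where D: "dsum_data C X (Y # Bs) \<iota> \<pi>" using assms(1) is_dsum_def by metis
  obtain i p where E: "dsum_data C Y As i p" using assms(2) is_dsum_def by metis
  let ?n = "length As" and ?m = "length Bs"
  define \<iota>' where "\<iota>' j = (if j < ?n then \<iota> 0 \<cdot> i j else \<iota> (Suc (j - ?n)))" for j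
  define \<pi>' where "\<pi>' j = (if j < ?n then p j \<cdot> \<pi> 0 else \<pi> (Suc (j - ?n)))" for j
  note E = dsum_dataD[OF E]
  note D0 = dsum_dataD(1)[OF D, of 0, simplified] dsum_dataD(2)[OF D, of 0, simplified]
    dsum_dataD(3)[OF D, of 0, simplified]
  have DS: "\<iota> (Suc j) \<in> Hom C (Bs ! j) X" "\<pi> (Suc j) \<in> Hom C X (Bs ! j)"
    "\<pi> (Suc j) \<cdot> \<iota> (Suc j) = idm C (Bs ! j)" "\<pi> (Suc j) \<cdot> \<iota> 0 = 0" "\<pi> 0 \<cdot> \<iota> (Suc j) = 0"
    if "j < ?m" for j
    using dsum_dataD(1-3)[OF D, of "Suc j"] dsum_dataD(4)[OF D, of "Suc j" 0]
      dsum_dataD(4)[OF D, of 0 "Suc j"] that by auto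
  have H: "\<iota>' j \<in> Hom C ((As @ Bs) ! j) X" "\<pi>' j \<in> Hom C X ((As @ Bs) ! j)"
    if "j < ?n + ?m" for j
    using that Comp_closed[OF E(1) D0(1)] Comp_closed[OF D0(2) E(2)] DS(1,2)
    by (auto simp: \<iota>'_def \<pi>'_def nth_append)
  have "\<pi>' j \<cdot> \<iota>' k = (if j = k then idm C ((As @ Bs) ! j) else 0)"
    if jk: "j < ?n + ?m" "k < ?n + ?m" for j k
  proof -
    consider "j < ?n" "k < ?n" | "j < ?n" "\<not> k < ?n" | "\<not> j < ?n" "k < ?n" | "\<not> j < ?n" "\<not> k < ?n"
      by blast
    then show ?thesis
    proof cases
      case 1
      then have "\<pi>' j \<cdot> \<iota>' k = p j \<cdot> i k"
        using Comp4[OF E(1)[of k] D0(1,2) E(2)[of j]] E(1)[of k] by (simp add: \<pi>'_def \<iota>'_def D0 idm_left)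
      then show ?thesis using 1 E(3,4) by (auto simp: nth_append)
    next
      case 2
      then have k: "k - ?n < ?m" using jk by auto
      have "\<pi>' j \<cdot> \<iota>' k = p j \<cdot> (\<pi> 0 \<cdot> \<iota> (Suc (k - ?n)))"
        using 2 Comp_assoc[OF DS(1)[OF k] D0(2) E(2)] by (simp add: \<pi>'_def \<iota>'_def)
      then show ?thesis using 2 DS(5)[OF k] E(2)[of j] by auto
    next
      case 3
      then have k: "j - ?n < ?m" using jk by auto
      have "\<pi>' j \<cdot> \<iota>' k = (\<pi> (Suc (j - ?n)) \<cdot> \<iota> 0) \<cdot> i k"
        using 3 Comp_assoc[OF E(1) D0(1) DS(2)[OF k]] by (simp add: \<pi>'_def \<iota>'_def)
      then show ?thesis using 3 DS(4)[OF k] E(1)[of k] by auto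
    next
      case 4
      then have "j - ?n < ?m" "k - ?n < ?m" "j = k \<longleftrightarrow> j - ?n = k - ?n" using jk by auto
      then show ?thesis using 4 DS(3) dsum_dataD(4)[OF D, of "Suc (j - ?n)" "Suc (k - ?n)"]
        by (auto simp: \<pi>'_def \<iota>'_def nth_append)
    qed
  qed
  moreover have "(\<Sum>j<?n + ?m. \<iota>' j \<cdot> \<pi>' j) = idm C X"
  proof -
    have "(\<Sum>j<?n. \<iota>' j \<cdot> \<pi>' j) = (\<Sum>j<?n. \<iota> 0 \<cdot> ((i j \<cdot> p j) \<cdot> \<pi> 0))"
      using Comp4[OF D0(2) E(2) E(1) D0(1)] by (intro sum.cong) (auto simp: \<iota>'_def \<pi>'_def)
    also have "\<dots> = \<iota> 0 \<cdot> ((\<Sum>j<?n. i j \<cdot> p j) \<cdot> \<pi> 0)"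
    proof -
      have "i j \<cdot> p j \<in> Hom C Y Y" if "j < ?n" for j using that Comp_closed[OF E(2) E(1)] by simp
      then show ?thesis
        using Comp_sum_left[OF D0(2), of "{..<?n}" "\<lambda>j. i j \<cdot> p j" Y] 
          Comp_sum_right[OF D0(1), of "{..<?n}" "\<lambda>j. (i j \<cdot> p j) \<cdot> \<pi> 0" X] Comp_closed[OF D0(2)]
        by simp
    qed
    also have "\<dots> = \<iota> 0 \<cdot> \<pi> 0" using E(5) D0 by (simp add: idm_left)
    finally show ?thesis
      using dsum_dataD(5)[OF D, unfolded list.size(4) add_Suc_right add_0_right sum.lessThan_Suc_shift]
      by (simp add: sum_lessThan_append \<iota>'_def \<pi>'_def)
  qed
  ultimately have "dsum_data C X (As @ Bs) \<iota>' \<pi>'"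
    unfolding dsum_data_def using H by simp
  then show ?thesis unfolding is_dsum_def by blast
qed

lemma dsum_data_comparison:
  assumes D: "dsum_data C X As \<iota> \<pi>" and E: "dsum_data C Y As i p"
  defines "f \<equiv> \<Sum>j<length As. i j \<cdot> \<pi> j" and "g \<equiv> \<Sum>j<length As. \<iota> j \<cdot> p j"
  shows "f \<in> Hom C X Y" "g \<in> Hom C Y X" "g \<cdot> f = idm C X"
proof -
  note D = dsum_dataD[OF D] and E = dsum_dataD[OF E]
  have f: "i j \<cdot> \<pi> j \<in> Hom C X Y" and g: "\<iota> j \<cdot> p j \<in> Hom C Y X" if "j < length As" for j
    using that Comp_closed[OF D(2) E(1)] Comp_closed[OF E(2) D(1)] by auto
  show "f \<in> Hom C X Y" unfolding f_def using f by (intro sum_Hom) simp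
  show gH: "g \<in> Hom C Y X" unfolding g_def using g by (intro sum_Hom) simp
  have gi: "g \<cdot> i j = \<iota> j" if j: "j < length As" for j
  proof -
    have "g \<cdot> i j = (\<Sum>k<length As. (\<iota> k \<cdot> p k) \<cdot> i j)"
      unfolding g_def using g by (intro Comp_sum_left[OF E(1)[OF j], where Z = X]) simp
    also have "\<dots> = (\<Sum>k<length As. \<iota> k \<cdot> (p k \<cdot> i j))"
      using Comp_assoc[OF E(1)[OF j] E(2) D(1)] by simp
    also have "\<dots> = (\<Sum>k<length As. if k = j then \<iota> j else 0)"
      using E(3,4) j D(1) by (intro sum.cong) (auto simp: idm_right[OF D(1)] Comp_zero_right[OF D(1)])
    finally show ?thesis using j by simp
  qed
  have "g \<cdot> f = (\<Sum>j<length As. g \<cdot> (i j \<cdot> \<pi> j))"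
    unfolding f_def using f by (intro Comp_sum_right[OF gH, where X = X]) simp
  also have "\<dots> = (\<Sum>j<length As. \<iota> j \<cdot> \<pi> j)"
    using gi Comp_assoc[OF D(2) E(1) gH] by simp
  finally show "g \<cdot> f = idm C X" using D(5) by simp
qed

lemma is_dsum_unique:
  assumes "is_dsum C X As" "is_dsum C Y As"
  shows "isomorphic C X Y"
proof -
  obtain \<iota> \<pi> i p where D: "dsum_data C X As \<iota> \<pi>" and E: "dsum_data C Y As i p"
    using assms unfolding is_dsum_def by blast
  show ?thesis
    unfolding isomorphic_def is_iso_def
    using dsum_data_comparison[OF D E] dsum_data_comparison(3)[OF E D] by blast
qed

lemma is_dsum_commute:
  assumes "is_dsum C X (As @ Bs)"
  shows "is_dsum C X (Bs @ As)"
proof -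
  obtain \<iota> \<pi> where D: "dsum_data C X (As @ Bs) \<iota> \<pi>" using assms is_dsum_def by metis
  let ?n = "length As" and ?m = "length Bs"
  define q where "q j = (if j < ?m then ?n + j else j - ?m)" for j
  have q: "q j < ?n + ?m" "(As @ Bs) ! q j = (Bs @ As) ! j" if "j < ?n + ?m" for j
    using that by (auto simp: q_def nth_append)
  have inj: "q j = q k \<longleftrightarrow> j = k" if "j < ?n + ?m" "k < ?n + ?m" for j k
    using that by (auto simp: q_def)
  have "(\<Sum>j<?n + ?m. \<iota> (q j) \<cdot> \<pi> (q j)) = (\<Sum>j<?n + ?m. \<iota> j \<cdot> \<pi> j)"
    unfolding add.commute[of ?n ?m] by (subst sum_lessThan_append)
      (simp add: q_def add.commute[of ?m ?n] sum_lessThan_append[where m = ?n and n = ?m] add.commute)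
  moreover have "\<iota> (q j) \<in> Hom C ((Bs @ As) ! j) X \<and> \<pi> (q j) \<in> Hom C X ((Bs @ As) ! j)"
    if "j < ?n + ?m" for j
    using dsum_dataD(1,2)[OF D, of "q j"] q[OF that] by simp
  ultimately have "dsum_data C X (Bs @ As) (\<iota> \<circ> q) (\<pi> \<circ> q)"
    using D q inj unfolding dsum_data_def by (simp add: add.commute)
  then show ?thesis unfolding is_dsum_def by blast
qed

lemma is_dsum_Nil_iff: "is_dsum C X [] \<longleftrightarrow> zero_object C X"
  by (auto simp: is_dsum_def dsum_data_def zero_object_def)

lemma is_dsum_singleton_iff: "is_dsum C X [Y] \<longleftrightarrow> isomorphic C Y X"
proof
  assume "is_dsum C X [Y]"
  then show "isomorphic C Y X"
    unfolding is_dsum_def dsum_data_def isomorphic_def is_iso_def by auto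
next
  assume "isomorphic C Y X"
  then obtain f g where "f \<in> Hom C Y X" "g \<in> Hom C X Y" "g \<cdot> f = idm C Y" "f \<cdot> g = idm C X"
    unfolding isomorphic_def is_iso_def by auto
  then have "dsum_data C X [Y] (\<lambda>_. f) (\<lambda>_. g)" by (auto simp: dsum_data_def)
  then show "is_dsum C X [Y]" unfolding is_dsum_def by blast
qed

lemma isomorphic_refl: "isomorphic C X X"
  unfolding isomorphic_def is_iso_def using idm_closed idm_left by fastforce

lemma isomorphic_sym: "isomorphic C X Y \<Longrightarrow> isomorphic C Y X"
  unfolding isomorphic_def is_iso_def by blast

lemma isomorphic_trans:
  assumes "isomorphic C X Y" "isomorphic C Y Z"
  shows "isomorphic C X Z"
  using is_dsum_Cons_merge[of Z Y "[]" "[X]"] assms by (simp add: is_dsum_singleton_iff)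

lemma is_dsum_iso_left:
  assumes "is_dsum C X As" "isomorphic C X Y"
  shows "is_dsum C Y As"
  using is_dsum_Cons_merge[of Y X "[]" As] assms by (simp add: is_dsum_singleton_iff)

lemma is_dsum_zero:
  assumes "zero_object C Z"
  shows "is_dsum C X [X, Z]" "is_dsum C X [Z, X]"
proof -
  have "dsum_data C X [X, Z] (\<lambda>j. if j = 0 then idm C X else 0) (\<lambda>j. if j = 0 then idm C X else 0)"
    using assms idm_closed[of X] idm_left[OF idm_closed[of X]] Comp_zero_left[OF zero_Hom]
      Comp_zero_left[OF idm_closed[of X]] Comp_zero_right[OF idm_closed[of X]]
    by (intro dsum_data2I) (simp_all add: zero_object_def)
  then show "is_dsum C X [X, Z]" unfolding is_dsum_def by blast
  then show "is_dsum C X [Z, X]" using is_dsum_commute[of X "[X]" "[Z]"] by simp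
qed

end

section \<open>Regrouping direct sums, and closure properties of add(T)\<close>

context additive_category
begin

lemma dsum_list_exists: "\<exists>X. is_dsum C X As"
proof (induction As)
  case Nil
  then show ?case using zero_object_exists is_dsum_Nil_iff by blast
next
  case (Cons A As)
  then obtain Y where Y: "is_dsum C Y As" by blast
  obtain X where "is_dsum C X [Y, A]" using dsum_exists by blast
  then have "is_dsum C X (As @ [A])" using is_dsum_Cons_merge Y by blast
  then show ?case using is_dsum_commute[of X As "[A]"] by auto
qed

text \<open>Converse of \<open>is_dsum_Cons_merge\<close>. No new projections are needed: a sum of
  \<open>Y # Bs\<close> exists, it is also a sum of \<open>As @ Bs\<close>, and sums are unique up
  to isomorphism.\<close>

lemma is_dsum_collect:
  assumes "is_dsum C X (As @ Bs)" "is_dsum C Y As"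
  shows "is_dsum C X (Y # Bs)"
proof -
  obtain X' where X': "is_dsum C X' (Y # Bs)" using dsum_list_exists by blast
  then have "is_dsum C X' (As @ Bs)" using is_dsum_Cons_merge assms(2) by blast
  then show ?thesis using is_dsum_iso_left[OF X'] is_dsum_unique assms(1) by blast
qed

lemma is_dsum_split:
  assumes "is_dsum C X (As @ Bs)"
  obtains Y Z where "is_dsum C X [Y, Z]" "is_dsum C Y As" "is_dsum C Z Bs"
proof -
  obtain Y Z where Y: "is_dsum C Y As" and Z: "is_dsum C Z Bs" using dsum_list_exists by metis
  have "is_dsum C X (Bs @ [Y])"
    using is_dsum_commute[of X "[Y]" Bs] is_dsum_collect[OF assms Y] by simp
  then have "is_dsum C X [Y, Z]"
    using is_dsum_commute[of X "[Z]" "[Y]"] is_dsum_collect[OF _ Z] by simp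
  then show ?thesis using that Y Z by blast
qed

lemma is_dsum_append:
  assumes "is_dsum C X [Y, Z]" "is_dsum C Y As" "is_dsum C Z Bs"
  shows "is_dsum C X (As @ Bs)"
proof -
  have "is_dsum C X (Z # As)"
    using is_dsum_Cons_merge[OF assms(1,2)] is_dsum_commute[of X As "[Z]"] by simp
  then show ?thesis using is_dsum_Cons_merge[OF _ assms(3)] is_dsum_commute by blast
qed

lemma is_dsum_summand:
  assumes "is_dsum C X As" "A \<in> set As"
  obtains Y where "is_dsum C X [A, Y]"
proof -
  obtain Ps Qs where As: "As = Ps @ A # Qs" using assms(2) by (meson split_list)
  then have X: "is_dsum C X (A # Qs @ Ps)" using is_dsum_commute[of X Ps "A # Qs"] assms(1) by simp
  obtain Y Z where YZ: "is_dsum C X [Y, Z]" "is_dsum C Y [A]" "is_dsum C Z (Qs @ Ps)"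
    using is_dsum_split[of X "[A]" "Qs @ Ps"] X by auto
  have "is_dsum C X [A, Z]"
    using YZ is_dsum_Cons_merge[of X Y "[Z]" "[A]"] by simp
  then show ?thesis using that by blast
qed

lemma is_dsum_exchange:
  assumes "is_dsum C X [X1, X2]" "is_dsum C X1 [A1, B1]" "is_dsum C X2 [A2, B2]"
    "is_dsum C A [A1, A2]" "is_dsum C B [B1, B2]"
  shows "is_dsum C X [A, B]"
proof -
  have "is_dsum C X ([A1] @ [B1, A2, B2])" using is_dsum_append[OF assms(1-3)] by simp
  then have "is_dsum C X ([B1, A2, B2] @ [A1])" by (rule is_dsum_commute)
  moreover obtain W where W: "is_dsum C W [B1, A2]" using dsum_exists by blast
  ultimately have "is_dsum C X [W, B2, A1]" using is_dsum_collect[of X "[B1, A2]" "[B2, A1]"] by simp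
  moreover have "is_dsum C W [A2, B1]" using is_dsum_commute[of W "[B1]" "[A2]"] W by simp
  ultimately have "is_dsum C X ([A2, B1, B2] @ [A1])"
    using is_dsum_Cons_merge[of X W "[B2, A1]" "[A2, B1]"] by simp
  then have "is_dsum C X ([A1, A2] @ [B1, B2])" using is_dsum_commute[of X "[A2, B1, B2]" "[A1]"] by simp
  then have "is_dsum C X ([B1, B2] @ [A])"
    using is_dsum_collect assms(4) is_dsum_commute[of X "[A]" "[B1, B2]"] by force
  then show ?thesis using is_dsum_collect assms(5) is_dsum_commute[of X "[B]" "[A]"] by force
qed

lemma add_closure_self: "T \<in> add_closure C T"
proof -
  obtain Z where "zero_object C Z" using zero_object_exists by blast
  then have "is_dsum C T [T, Z]" by (rule is_dsum_zero)
  moreover have "is_dsum C T (replicate 1 T)"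
    by (simp add: is_dsum_singleton_iff isomorphic_refl)
  ultimately show ?thesis unfolding add_closure_def by blast
qed

lemma add_closure_summand:
  assumes "X \<in> add_closure C T" "is_dsum C X [A, B]"
  shows "A \<in> add_closure C T"
proof -
  obtain n Y Z where Z: "is_dsum C Z (replicate n T)" "is_dsum C Z [X, Y]"
    using assms(1) unfolding add_closure_def by blast
  have "is_dsum C Z ([A] @ [B, Y])" using is_dsum_Cons_merge[OF Z(2) assms(2)] by simp
  then obtain Y' Z' where YZ: "is_dsum C Z [Y', Z']" "is_dsum C Y' [A]" using is_dsum_split by metis
  have "is_dsum C Z [A, Z']"
    using YZ is_dsum_Cons_merge[of Z Y' "[Z']" "[A]"] by simp
  then show ?thesis using Z(1) unfolding add_closure_def by blast
qed

lemma add_closure_summands: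
  assumes "X \<in> add_closure C T" "is_dsum C X As"
  shows "set As \<subseteq> add_closure C T"
  using assms is_dsum_summand[OF assms(2)] add_closure_summand by (metis subsetI)

lemma add_closure_iso:
  assumes "X \<in> add_closure C T" "isomorphic C X Y"
  shows "Y \<in> add_closure C T"
  using add_closure_summands[OF assms(1), of "[Y]"] assms(2) isomorphic_sym
  by (simp add: is_dsum_singleton_iff)

lemma add_closure_zero:
  assumes "zero_object C Z"
  shows "Z \<in> add_closure C T"
  using add_closure_summands[OF add_closure_self is_dsum_zero(1)[OF assms]] by simp

lemma add_closure_dsum2:
  assumes "A \<in> add_closure C T" "B \<in> add_closure C T" "is_dsum C X [A, B]"
  shows "X \<in> add_closure C T"
proof -
  obtain n Y Z where Z: "is_dsum C Z (replicate n T)" "is_dsum C Z [A, Y]"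
    using assms(1) unfolding add_closure_def by blast
  obtain n' Y' Z' where Z': "is_dsum C Z' (replicate n' T)" "is_dsum C Z' [B, Y']"
    using assms(2) unfolding add_closure_def by blast
  obtain W where W: "is_dsum C W [Z, Z']" using dsum_exists by blast
  have "is_dsum C W (replicate (n + n') T)"
    using is_dsum_append[OF W Z(1) Z'(1)] by (simp add: replicate_add)
  moreover obtain V where V: "is_dsum C V [Y, Y']" using dsum_exists by blast
  then have "is_dsum C W [X, V]" using is_dsum_exchange[OF W Z(2) Z'(2) assms(3)] by blast
  ultimately show ?thesis unfolding add_closure_def by blast
qed

lemma add_closure_dsum:
  assumes "is_dsum C X As" "set As \<subseteq> add_closure C T"
  shows "X \<in> add_closure C T"
  using assms
proof (induction As arbitrary: X)
  case Nil
  then show ?case by (simp add: add_closure_zero is_dsum_Nil_iff)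
next
  case (Cons A As)
  obtain Y Z where YZ: "is_dsum C X [Y, Z]" "is_dsum C Y [A]" "is_dsum C Z As"
    using is_dsum_split[of X "[A]" As] Cons.prems(1) by auto
  have "Z \<in> add_closure C T" using Cons.IH[OF YZ(3)] Cons.prems(2) by simp
  moreover have "Y \<in> add_closure C T"
    using YZ(2) Cons.prems(2) add_closure_iso by (auto simp: is_dsum_singleton_iff)
  ultimately show ?case using add_closure_dsum2 YZ(1) by blast
qed

end

section \<open>Local endomorphism rings\<close>

context linear_category
begin

lemma is_iso_comp:
  assumes "is_iso C X Y f" "is_iso C Y Z g"
  shows "is_iso C X Z (g \<cdot> f)"
proof -
  obtain f' g' where f: "f \<in> Hom C X Y" "f' \<in> Hom C Y X" "f' \<cdot> f = idm C X" "f \<cdot> f' = idm C Y"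
    and g: "g \<in> Hom C Y Z" "g' \<in> Hom C Z Y" "g' \<cdot> g = idm C Y" "g \<cdot> g' = idm C Z"
    using assms unfolding is_iso_def by metis
  have "(f' \<cdot> g') \<cdot> (g \<cdot> f) = idm C X" "(g \<cdot> f) \<cdot> (f' \<cdot> g') = idm C Z"
    using Comp4[OF f(1) g(1,2) f(2)] Comp4[OF g(2) f(2,1) g(1)] f g by (simp_all add: idm_left)
  then show ?thesis
    unfolding is_iso_def using Comp_closed[OF f(1) g(1)] Comp_closed[OF g(2) f(2)] by blast
qed

lemma zero_not_iso: "idm C X \<noteq> 0 \<Longrightarrow> \<not> is_iso C X X 0"
  unfolding is_iso_def by auto

lemma local_End_sum:
  assumes "local_End C X" "finite I" "\<And>i. i \<in> I \<Longrightarrow> f i \<in> Hom C X X" "is_iso C X X (sum f I)"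
  shows "\<exists>i\<in>I. is_iso C X X (f i)"
  using assms(2-4)
proof (induction I rule: finite_induct)
  case empty
  then show ?case using zero_not_iso assms(1) unfolding local_End_def by auto
next
  case (insert i I)
  have "sum f I \<in> Hom C X X" using insert.prems(1) by (intro sum_Hom) auto
  then have "is_iso C X X (f i) \<or> is_iso C X X (sum f I)"
    using assms(1) insert.prems insert.hyps unfolding local_End_def by auto
  then show ?case using insert by auto
qed

text \<open>With \<open>r\<close> the inverse of \<open>q \<cdot> p\<close>, the endomorphism
  \<open>e = p \<cdot> (r \<cdot> q)\<close> of \<open>Y\<close> is idempotent, and locality makes
  \<open>e\<close> or its complement invertible. An invertible idempotent is the identity, so
  \<open>p\<close> is an isomorphism; an invertible complement forces \<open>e = 0\<close>, hence
  \<open>p = 0\<close>, against \<open>idm C X \<noteq> 0\<close>.\<close>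

lemma local_End_retract:
  assumes X: "local_End C X" and Y: "local_End C Y" and p: "p \<in> Hom C X Y" and q: "q \<in> Hom C Y X"
    and iso: "is_iso C X X (q \<cdot> p)"
  shows "isomorphic C X Y"
proof -
  obtain r where r: "r \<in> Hom C X X" "r \<cdot> (q \<cdot> p) = idm C X" "(q \<cdot> p) \<cdot> r = idm C X"
    using iso unfolding is_iso_def by blast
  have qp: "q \<cdot> p \<in> Hom C X X" and rq: "r \<cdot> q \<in> Hom C Y X"
    using Comp_closed[OF p q] Comp_closed[OF q r(1)] .
  define e where "e = p \<cdot> (r \<cdot> q)"
  have e: "e \<in> Hom C Y Y" unfolding e_def using Comp_closed[OF rq p] .
  have rqp: "(r \<cdot> q) \<cdot> p = idm C X" using Comp_assoc[OF p q r(1)] r(2) by simp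
  have ee: "e \<cdot> e = e"
    unfolding e_def using Comp4[OF rq p rq p] rqp idm_left[OF rq] by simp
  have ie: "idm C Y - e \<in> Hom C Y Y" using diff_Hom[OF idm_closed e] .
  have "is_iso C Y Y (e + (idm C Y - e))"
    unfolding is_iso_def using idm_closed idm_left by fastforce
  then consider "is_iso C Y Y e" | "is_iso C Y Y (idm C Y - e)"
    using Y e ie unfolding local_End_def by blast
  then show ?thesis
  proof cases
    case 1
    then obtain s where s: "s \<in> Hom C Y Y" "s \<cdot> e = idm C Y" unfolding is_iso_def by blast
    have "e = (s \<cdot> e) \<cdot> e" using s idm_left[OF e] by simp
    also have "\<dots> = idm C Y" using Comp_assoc[OF e e s(1)] ee s by simp
    finally have "p \<cdot> (r \<cdot> q) = idm C Y" unfolding e_def .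
    then show ?thesis using p rq rqp unfolding isomorphic_def is_iso_def by blast
  next
    case 2
    then obtain s where s: "s \<in> Hom C Y Y" "(idm C Y - e) \<cdot> s = idm C Y" unfolding is_iso_def by blast
    have "e = e \<cdot> ((idm C Y - e) \<cdot> s)" using s idm_right[OF e] by simp
    also have "\<dots> = (e \<cdot> (idm C Y - e)) \<cdot> s" using Comp_assoc[OF s(1) ie e] .
    also have "e \<cdot> (idm C Y - e) = 0"
      using Comp_diff_right[OF idm_closed e e] ee idm_right[OF e] by simp
    finally have e0: "e = 0" using s(1) by simp
    have "e \<cdot> p = p \<cdot> ((r \<cdot> q) \<cdot> p)" unfolding e_def using Comp_assoc[OF p rq p] by simp
    then have "p = 0" using e0 p rqp idm_right[OF p] by simp
    then have "idm C X = 0" using rqp rq by simp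
    then show ?thesis using X unfolding local_End_def by blast
  qed
qed

lemma local_End_iso:
  assumes "local_End C X" "isomorphic C X Y"
  shows "local_End C Y"
proof -
  obtain f g where f: "f \<in> Hom C X Y" and g: "g \<in> Hom C Y X" and gf: "g \<cdot> f = idm C X" "f \<cdot> g = idm C Y"
    using assms(2) unfolding isomorphic_def is_iso_def by blast
  have isof: "is_iso C X Y f" and isog: "is_iso C Y X g" using f g gf unfolding is_iso_def by auto
  have reflect: "is_iso C Y Y a" if a: "a \<in> Hom C Y Y" and "is_iso C X X (g \<cdot> (a \<cdot> f))" for a
  proof -
    have "is_iso C Y Y (f \<cdot> ((g \<cdot> (a \<cdot> f)) \<cdot> g))"
      using is_iso_comp[OF is_iso_comp[OF isog that(2)] isof] .
    moreover have "f \<cdot> ((g \<cdot> (a \<cdot> f)) \<cdot> g) = a"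
    proof -
      have af: "a \<cdot> f \<in> Hom C X Y" using Comp_closed[OF f a] .
      have "f \<cdot> ((g \<cdot> (a \<cdot> f)) \<cdot> g) = (f \<cdot> g) \<cdot> ((a \<cdot> f) \<cdot> g)"
        using Comp4[OF g af g f] by simp
      also have "\<dots> = a" using gf idm_left[OF Comp_closed[OF g af]] Comp_assoc[OF g f a] idm_right[OF a] by simp
      finally show ?thesis .
    qed
    ultimately show ?thesis by simp
  qed
  have "idm C Y \<noteq> 0"
  proof
    assume "idm C Y = 0"
    then have "f = 0" using idm_left[OF f] f by simp
    then show False using gf(1) g assms(1) unfolding local_End_def by simp
  qed
  moreover have "is_iso C Y Y a \<or> is_iso C Y Y b"
    if a: "a \<in> Hom C Y Y" and b: "b \<in> Hom C Y Y" and ab: "is_iso C Y Y (a + b)" for a b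
  proof -
    have "is_iso C X X (g \<cdot> ((a + b) \<cdot> f))" using is_iso_comp[OF is_iso_comp[OF isof ab] isog] .
    also have "g \<cdot> ((a + b) \<cdot> f) = g \<cdot> (a \<cdot> f) + g \<cdot> (b \<cdot> f)"
      using Comp_add_left[OF f a b] Comp_add_right[OF Comp_closed[OF f a] Comp_closed[OF f b] g] by simp
    finally have "is_iso C X X (g \<cdot> (a \<cdot> f)) \<or> is_iso C X X (g \<cdot> (b \<cdot> f))"
      using assms(1) Comp_closed[OF Comp_closed[OF f a] g] Comp_closed[OF Comp_closed[OF f b] g]
      unfolding local_End_def by blast
    then show ?thesis using reflect a b by blast
  qed
  ultimately show ?thesis unfolding local_End_def by blast
qed

end

context additive_category
begin

text \<open>In a decomposition of \<open>X\<close> into objects with local endomorphism rings the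
  first summand is nonzero, so indecomposability makes the rest zero and \<open>X\<close> is
  isomorphic to that summand.\<close>

lemma indecomposable_local_End:
  assumes "Krull_Schmidt C" "indecomposable C X"
  shows "local_End C X"
proof -
  obtain As where As: "is_dsum C X As" "\<forall>A\<in>set As. local_End C A"
    using assms(1) unfolding Krull_Schmidt_def by blast
  have nz: "\<not> zero_object C X" using assms(2) unfolding indecomposable_def by blast
  then obtain A Bs where AB: "As = A # Bs" using As(1) is_dsum_Nil_iff by (cases As) auto
  obtain Y Z where YZ: "is_dsum C X [Y, Z]" "is_dsum C Y [A]" "is_dsum C Z Bs"
    using is_dsum_split[of X "[A]" Bs] As(1) AB by auto
  have locY: "local_End C Y"
    using local_End_iso[of A Y] YZ(2) As(2) AB by (simp add: is_dsum_singleton_iff)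
  then have "\<not> zero_object C Y" unfolding local_End_def zero_object_def by blast
  then have "zero_object C Z" using assms(2) YZ(1) unfolding indecomposable_def by blast
  then have "isomorphic C Y X" using is_dsum_unique[OF is_dsum_zero(1) YZ(1)] by blast
  then show ?thesis using local_End_iso[OF locY] by blast
qed

text \<open>An object of add(U) is a retract of a power of \<open>U\<close>. Decomposing the power
  writes its identity as a sum of endomorphisms that factor through members of \<open>us\<close>.
  This form serves both to recognise local objects of add(U) and to factor maps out of
  add(U).\<close>

lemma add_closure_expand:
  assumes "X \<in> add_closure C U" "is_dsum C U us"
  obtains ws p q where "set ws \<subseteq> set us"
    "\<And>j. j < length ws \<Longrightarrow> p j \<in> Hom C X (ws ! j)" "\<And>j. j < length ws \<Longrightarrow> q j \<in> Hom C (ws ! j) X"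
    "(\<Sum>j<length ws. q j \<cdot> p j) = idm C X"
proof -
  obtain n Y Z where Z: "is_dsum C Z (replicate n U)" "is_dsum C Z [X, Y]"
    using assms(1) unfolding add_closure_def by blast
  \<comment> \<open>The accumulator \<open>As\<close> holds the copies already expanded; the
    induction treats one copy of \<open>U\<close> at a time.\<close>
  have "is_dsum C Z (As @ concat (replicate n us))" if "is_dsum C Z (As @ replicate n U)" for As
    using that
  proof (induction n arbitrary: As)
    case (Suc n)
    then have "is_dsum C Z (U # (replicate n U @ As))"
      using is_dsum_commute[of Z As "U # replicate n U"] by simp
    then have "is_dsum C Z (us @ (replicate n U @ As))"
      using is_dsum_Cons_merge assms(2) by blast
    then have "is_dsum C Z ((As @ us) @ replicate n U)"
      using is_dsum_commute[of Z "us @ replicate n U" As] is_dsum_commute[of Z "us" "replicate n U @ As"]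
        is_dsum_commute[of Z "replicate n U" "As @ us"] by simp
    then show ?case using Suc.IH[of "As @ us"] by simp
  qed simp
  from this[of "[]"] Z(1) obtain \<iota> \<pi> where D: "dsum_data C Z (concat (replicate n us)) \<iota> \<pi>"
    unfolding is_dsum_def by auto
  obtain i p where E: "dsum_data C Z [X, Y] i p" using Z(2) unfolding is_dsum_def by blast
  let ?ws = "concat (replicate n us)"
  note E = dsum_data2D[OF E] and D = dsum_dataD[OF D]
  have "set ?ws \<subseteq> set us" by (induction n) auto
  moreover have "\<pi> j \<cdot> i 0 \<in> Hom C X (?ws ! j)" "p 0 \<cdot> \<iota> j \<in> Hom C (?ws ! j) X" if "j < length ?ws" for j
    using Comp_closed[OF E(1) D(2)] Comp_closed[OF D(1) E(3)] that by auto
  moreover have "(\<Sum>j<length ?ws. (p 0 \<cdot> \<iota> j) \<cdot> (\<pi> j \<cdot> i 0)) = idm C X"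
  proof -
    have DZ: "\<iota> j \<cdot> \<pi> j \<in> Hom C Z Z" "(\<iota> j \<cdot> \<pi> j) \<cdot> i 0 \<in> Hom C X Z" if "j < length ?ws" for j
      using that Comp_closed[OF D(2) D(1)] Comp_closed[OF E(1) Comp_closed[OF D(2) D(1)]] by auto
    have "(\<Sum>j<length ?ws. (p 0 \<cdot> \<iota> j) \<cdot> (\<pi> j \<cdot> i 0)) = (\<Sum>j<length ?ws. p 0 \<cdot> ((\<iota> j \<cdot> \<pi> j) \<cdot> i 0))"
      using Comp4[OF E(1) D(2) D(1) E(3)] by (intro sum.cong) auto
    also have "\<dots> = p 0 \<cdot> (\<Sum>j<length ?ws. (\<iota> j \<cdot> \<pi> j) \<cdot> i 0)"
      by (rule Comp_sum_right[OF E(3), where X = X, symmetric]) (simp add: DZ)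
    also have "(\<Sum>j<length ?ws. (\<iota> j \<cdot> \<pi> j) \<cdot> i 0) = (\<Sum>j<length ?ws. \<iota> j \<cdot> \<pi> j) \<cdot> i 0"
      by (rule Comp_sum_left[OF E(1), where Z = Z, symmetric]) (simp add: DZ)
    finally show ?thesis using D(5) E(1,5) by (simp add: idm_left[OF E(1)])
  qed
  ultimately show ?thesis using that[of ?ws "\<lambda>j. \<pi> j \<cdot> i 0" "\<lambda>j. p 0 \<cdot> \<iota> j"] by blast
qed

text \<open>One of the endomorphisms \<open>q j \<cdot> p j\<close> that add up to the identity is
  invertible by locality, which makes \<open>X\<close> a retract of a local object and hence
  isomorphic to it.\<close>

lemma local_End_in_add_closure:
  assumes "X \<in> add_closure C U" "local_End C X" "is_dsum C U us" "\<And>w. w \<in> set us \<Longrightarrow> local_End C w"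
  obtains w where "w \<in> set us" "isomorphic C X w"
proof -
  obtain ws p q where W: "set ws \<subseteq> set us"
    "\<And>j. j < length ws \<Longrightarrow> p j \<in> Hom C X (ws ! j)" "\<And>j. j < length ws \<Longrightarrow> q j \<in> Hom C (ws ! j) X"
    "(\<Sum>j<length ws. q j \<cdot> p j) = idm C X"
    by (rule add_closure_expand[OF assms(1,3)]) (rule that)
  have "is_iso C X X (\<Sum>j<length ws. q j \<cdot> p j)"
    unfolding W(4) is_iso_def using idm_closed[of X] idm_left[OF idm_closed[of X]] by blast
  moreover have "q j \<cdot> p j \<in> Hom C X X" if "j \<in> {..<length ws}" for j
    using Comp_closed[OF W(2) W(3)] that by blast
  ultimately obtain j where j: "j < length ws" "is_iso C X X (q j \<cdot> p j)"
    using local_End_sum[OF assms(2), of "{..<length ws}" "\<lambda>j. q j \<cdot> p j"] by blast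
  have "ws ! j \<in> set us" using j(1) W(1) by auto
  moreover have "isomorphic C X (ws ! j)"
    by (rule local_End_retract[OF assms(2) assms(4) W(2) W(3) j(2)]) (use j(1) calculation in auto)
  ultimately show ?thesis using that by blast
qed

end

section \<open>Angles\<close>

context linear_category
begin

lemmas Comp_assoc' = Comp_assoc[symmetric]

text \<open>A map that commutes with the inclusion and with the projection of the first summands is
  block diagonal: \<open>inc\<close> removes one off-diagonal block and \<open>proj\<close> the
  other. \<open>b\<close> is the remaining diagonal block.\<close>

lemma dsum_complement_component:
  assumes D: "dsum_data C X [A, B] \<iota> \<pi>" and D': "dsum_data C X' [A', B'] \<iota>' \<pi>'"
    and e: "e \<in> Hom C X X'" and a: "a \<in> Hom C A A'"
    and inc: "\<iota>' 0 \<cdot> a = e \<cdot> \<iota> 0" and proj: "\<pi>' 0 \<cdot> e = a \<cdot> \<pi> 0"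
  defines "b \<equiv> \<pi>' 1 \<cdot> (e \<cdot> \<iota> 1)"
  shows "b \<in> Hom C B B'" "\<iota>' 1 \<cdot> b = e \<cdot> \<iota> 1" "\<pi>' 1 \<cdot> e = b \<cdot> \<pi> 1"
proof -
  note D2 = dsum_data2D[OF D] and D2' = dsum_data2D[OF D']
  have ei: "e \<cdot> \<iota> 1 \<in> Hom C B X'" "e \<cdot> \<iota> 0 \<in> Hom C A X'" using Comp_closed[OF D2(2) e] Comp_closed[OF D2(1) e] .
  show b: "b \<in> Hom C B B'" unfolding b_def using Comp_closed[OF ei(1) D2'(4)] .
  have z: "\<pi>' 0 \<cdot> (e \<cdot> \<iota> 1) = 0"
    using Comp_assoc'[OF D2(2) e D2'(3)] Comp_assoc'[OF D2(2) D2(3) a] proj D2(7) a by simp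
  show "\<iota>' 1 \<cdot> b = e \<cdot> \<iota> 1"
  proof (rule dsum_data2_eq[OF D' Comp_closed[OF b D2'(2)] ei(1)])
    show "\<pi>' 0 \<cdot> (\<iota>' 1 \<cdot> b) = \<pi>' 0 \<cdot> (e \<cdot> \<iota> 1)"
      using z Comp_assoc'[OF b D2'(2,3)] D2'(7) b by simp
    show "\<pi>' 1 \<cdot> (\<iota>' 1 \<cdot> b) = \<pi>' 1 \<cdot> (e \<cdot> \<iota> 1)"
      using Comp_assoc'[OF b D2'(2,4)] D2'(6) idm_left[OF b] b_def by simp
  qed
  have pe: "\<pi>' 1 \<cdot> e \<in> Hom C X B'" using Comp_closed[OF e D2'(4)] .
  have "(\<pi>' 1 \<cdot> e) \<cdot> (\<iota> 0 \<cdot> \<pi> 0) = 0"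
  proof -
    have "(\<pi>' 1 \<cdot> e) \<cdot> (\<iota> 0 \<cdot> \<pi> 0) = \<pi>' 1 \<cdot> ((e \<cdot> \<iota> 0) \<cdot> \<pi> 0)"
      using Comp4[OF D2(3,1) e D2'(4)] .
    also have "\<dots> = (\<pi>' 1 \<cdot> \<iota>' 0) \<cdot> (a \<cdot> \<pi> 0)"
      using Comp4[OF D2(3) a D2'(1) D2'(4)] inc by simp
    finally show ?thesis using D2'(8) Comp_closed[OF D2(3) a] by simp
  qed
  moreover have "(\<pi>' 1 \<cdot> e) \<cdot> (\<iota> 1 \<cdot> \<pi> 1) = b \<cdot> \<pi> 1"
    using Comp4[OF D2(4,2) e D2'(4)] Comp_assoc'[OF D2(4) ei(1) D2'(4)] b_def by simp
  moreover have "\<pi>' 1 \<cdot> e = (\<pi>' 1 \<cdot> e) \<cdot> (\<iota> 0 \<cdot> \<pi> 0 + \<iota> 1 \<cdot> \<pi> 1)"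
    using D2(9) idm_right[OF pe] by simp
  ultimately show "\<pi>' 1 \<cdot> e = b \<cdot> \<pi> 1"
    using Comp_add_right[OF Comp_closed[OF D2(3,1)] Comp_closed[OF D2(4,2)] pe] by simp
qed

lemma dsum_block_diagonal:
  assumes D: "dsum_data C X [A, B] \<iota> \<pi>" and D': "dsum_data C X' [A', B'] \<iota>' \<pi>'"
    and a: "a \<in> Hom C A A'" and b: "b \<in> Hom C B B'"
  defines "g \<equiv> \<iota>' 0 \<cdot> (a \<cdot> \<pi> 0) + \<iota>' 1 \<cdot> (b \<cdot> \<pi> 1)"
  shows "g \<in> Hom C X X'" "\<iota>' 0 \<cdot> a = g \<cdot> \<iota> 0" "\<iota>' 1 \<cdot> b = g \<cdot> \<iota> 1"
    "\<pi>' 0 \<cdot> g = a \<cdot> \<pi> 0" "\<pi>' 1 \<cdot> g = b \<cdot> \<pi> 1"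
proof -
  note D = dsum_data2D[OF D] and D' = dsum_data2D[OF D']
  note ap = Comp_closed[OF D(3) a] and bp = Comp_closed[OF D(4) b]
  note iap = Comp_closed[OF ap D'(1)] and ibp = Comp_closed[OF bp D'(2)]
  show "g \<in> Hom C X X'" unfolding g_def using add_Hom[OF iap ibp] .
  show "\<iota>' 0 \<cdot> a = g \<cdot> \<iota> 0"
    unfolding g_def
    using Comp_add_left[OF D(1) iap ibp] Comp_assoc'[OF D(1) ap D'(1)] Comp_assoc'[OF D(1) bp D'(2)]
      Comp_assoc'[OF D(1,3) a] Comp_assoc'[OF D(1) D(4) b] D(5,8) idm_right[OF a] b D'(2) by simp
  show "\<iota>' 1 \<cdot> b = g \<cdot> \<iota> 1"
    unfolding g_def
    using Comp_add_left[OF D(2) iap ibp] Comp_assoc'[OF D(2) ap D'(1)] Comp_assoc'[OF D(2) bp D'(2)]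
      Comp_assoc'[OF D(2,3) a] Comp_assoc'[OF D(2) D(4) b] D(6,7) idm_right[OF b] a D'(1) by simp
  show "\<pi>' 0 \<cdot> g = a \<cdot> \<pi> 0"
    unfolding g_def
    using Comp_add_right[OF iap ibp D'(3)] Comp_assoc'[OF ap D'(1,3)] Comp_assoc'[OF bp D'(2,3)]
      D'(5,7) idm_left[OF ap] bp by simp
  show "\<pi>' 1 \<cdot> g = b \<cdot> \<pi> 1"
    unfolding g_def
    using Comp_add_right[OF iap ibp D'(4)] Comp_assoc'[OF ap D'(1,4)] Comp_assoc'[OF bp D'(2,4)]
      D'(6,8) idm_left[OF bp] ap by simp
qed

end

section \<open>The shift, rotation, and exactness of Hom along an angle\<close>

context angulated_category
begin

lemma \<Sigma>_Hom: "f \<in> Hom C X Y \<Longrightarrow> \<Sigma>M C f \<in> Hom C (\<Sigma>O C X) (\<Sigma>O C Y)"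
  using \<Sigma>_functor unfolding is_functor_def by blast

lemma \<Sigma>_idm: "\<Sigma>M C (idm C X) = idm C (\<Sigma>O C X)"
  using \<Sigma>_functor unfolding is_functor_def by blast

lemma \<Sigma>_Comp: "f \<in> Hom C X Y \<Longrightarrow> g \<in> Hom C Y Z \<Longrightarrow> \<Sigma>M C (g \<cdot> f) = \<Sigma>M C g \<cdot> \<Sigma>M C f"
  using \<Sigma>_functor unfolding is_functor_def by blast

lemma \<Sigma>_zero [simp]: "\<Sigma>M C 0 = 0"
  \<comment> \<open>The zero vector lies in every Hom space, so any two objects will do.\<close>
  using \<Sigma>_add[of 0 undefined undefined 0] by simp

lemma \<Sigma>_inject: "f \<in> Hom C X Y \<Longrightarrow> g \<in> Hom C X Y \<Longrightarrow> \<Sigma>M C f = \<Sigma>M C g \<longleftrightarrow> f = g"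
  using \<Sigma>M_bij[of X Y] unfolding bij_betw_def by (meson inj_on_eq_iff)

lemma \<Sigma>_preimage:
  assumes "g \<in> Hom C (\<Sigma>O C X) (\<Sigma>O C Y)"
  obtains f where "f \<in> Hom C X Y" "\<Sigma>M C f = g"
proof -
  have "g \<in> \<Sigma>M C ` Hom C X Y" using assms bij_betw_imp_surj_on[OF \<Sigma>M_bij] by simp
  then show ?thesis using that by auto
qed

lemma \<Sigma>_zero_object [simp]: "zero_object C (\<Sigma>O C Z) \<longleftrightarrow> zero_object C Z"
  unfolding zero_object_def using \<Sigma>_inject[OF idm_closed zero_Hom, of Z] by (simp add: \<Sigma>_idm)

lemma zero_\<Sigma>_zero: obtains Z where "zero_object C Z" "zero_object C (\<Sigma>O C Z)"
  using zero_object_exists by auto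

lemma \<Sigma>_dsum_data:
  assumes "dsum_data C X [A, B] \<iota> \<pi>"
  shows "dsum_data C (\<Sigma>O C X) [\<Sigma>O C A, \<Sigma>O C B] (\<lambda>j. \<Sigma>M C (\<iota> j)) (\<lambda>j. \<Sigma>M C (\<pi> j))"
proof -
  note D = dsum_data2D[OF assms, unfolded One_nat_def]
  show ?thesis
    using D \<Sigma>_Comp[OF D(1,3)] \<Sigma>_Comp[OF D(2,4)] \<Sigma>_Comp[OF D(2,3)] \<Sigma>_Comp[OF D(1,4)]
      \<Sigma>_Comp[OF D(3,1)] \<Sigma>_Comp[OF D(4,2)] \<Sigma>_add[OF Comp_closed[OF D(3,1)] Comp_closed[OF D(4,2)], symmetric]
    by (intro dsum_data2I) (simp_all add: \<Sigma>_Hom \<Sigma>_idm)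
qed

lemma \<Sigma>_isomorphic:
  assumes "isomorphic C (\<Sigma>O C X) (\<Sigma>O C Y)"
  shows "isomorphic C X Y"
proof -
  obtain f' g' where "f' \<in> Hom C (\<Sigma>O C X) (\<Sigma>O C Y)" "g' \<in> Hom C (\<Sigma>O C Y) (\<Sigma>O C X)"
    and e: "g' \<cdot> f' = idm C (\<Sigma>O C X)" "f' \<cdot> g' = idm C (\<Sigma>O C Y)"
    using assms unfolding isomorphic_def is_iso_def by blast
  then obtain f g where f: "f \<in> Hom C X Y" "\<Sigma>M C f = f'" and g: "g \<in> Hom C Y X" "\<Sigma>M C g = g'"
    using \<Sigma>_preimage by metis
  have "g \<cdot> f = idm C X" "f \<cdot> g = idm C Y"
    using \<Sigma>_inject[OF Comp_closed[OF f(1) g(1)] idm_closed] \<Sigma>_Comp[OF f(1) g(1)]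
      \<Sigma>_inject[OF Comp_closed[OF g(1) f(1)] idm_closed] \<Sigma>_Comp[OF g(1) f(1)] f(2) g(2) e
    by (simp_all add: \<Sigma>_idm)
  then show ?thesis unfolding isomorphic_def is_iso_def using f(1) g(1) by blast
qed

lemma \<Sigma>_is_dsum: "is_dsum C (\<Sigma>O C X) [\<Sigma>O C A, \<Sigma>O C B] \<longleftrightarrow> is_dsum C X [A, B]"
proof
  have \<Sigma>: "is_dsum C (\<Sigma>O C W) [\<Sigma>O C A, \<Sigma>O C B]" if "is_dsum C W [A, B]" for W
    using that \<Sigma>_dsum_data unfolding is_dsum_def by blast
  show "is_dsum C X [A, B] \<Longrightarrow> is_dsum C (\<Sigma>O C X) [\<Sigma>O C A, \<Sigma>O C B]" by (rule \<Sigma>)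
  assume X: "is_dsum C (\<Sigma>O C X) [\<Sigma>O C A, \<Sigma>O C B]"
  obtain W where W: "is_dsum C W [A, B]" using dsum_exists by blast
  show "is_dsum C X [A, B]"
    using is_dsum_iso_left[OF W \<Sigma>_isomorphic[OF is_dsum_unique[OF \<Sigma>[OF W] X]]] .
qed

lemma angle_length: "(cs, \<gamma>) \<in> angles C \<Longrightarrow> length cs = d + 2 \<and> length \<gamma> = d + 2"
  using angles_sequence unfolding sigma_sequence_def by blast

lemma angle_Hom:
  assumes "(cs, \<gamma>) \<in> angles C" "i \<le> d + 1"
  shows "\<gamma> ! i \<in> Hom C (cs ! i) ((cs @ [\<Sigma>O C (cs ! 0)]) ! Suc i)"
  using angles_sequence[OF assms(1)] assms(2) unfolding sigma_sequence_def
  by (cases "i = d + 1") (auto simp: nth_append)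

lemma rotate_angle:
  assumes "(cs, \<gamma>) \<in> angles C" "k \<le> d + 2"
  shows "(drop k cs @ map (\<Sigma>O C) (take k cs),
          drop k \<gamma> @ map (\<lambda>f. scl C ((- 1) ^ d) (\<Sigma>M C f)) (take k \<gamma>)) \<in> angles C"
  using assms(2)
proof (induction k)
  case 0
  then show ?case using assms by simp
next
  case (Suc k)
  let ?cs = "drop k cs @ map (\<Sigma>O C) (take k cs)"
  let ?\<gamma> = "drop k \<gamma> @ map (\<lambda>f. scl C ((- 1) ^ d) (\<Sigma>M C f)) (take k \<gamma>)"
  have a: "(?cs, ?\<gamma>) \<in> angles C" using Suc by simp
  note len = angle_length[OF assms(1)]
  have "(left_rotation_objects C ?cs, left_rotation_morphisms C d ?\<gamma>) \<in> angles C"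
    using N2[OF angles_sequence[OF a]] a by blast
  moreover have "left_rotation_objects C ?cs = drop (Suc k) cs @ map (\<Sigma>O C) (take (Suc k) cs)"
    using Suc.prems len
    by (simp add: left_rotation_objects_def take_Suc_conv_app_nth hd_append hd_drop_conv_nth tl_append2 drop_Suc tl_drop)
  moreover have "left_rotation_morphisms C d ?\<gamma> =
      drop (Suc k) \<gamma> @ map (\<lambda>f. scl C ((- 1) ^ d) (\<Sigma>M C f)) (take (Suc k) \<gamma>)"
    using Suc.prems len
    by (simp add: left_rotation_morphisms_def take_Suc_conv_app_nth hd_append hd_drop_conv_nth tl_append2 drop_Suc tl_drop)
  ultimately show ?case by simp
qed

text \<open>The identity and \<open>\<gamma> ! 0\<close> start a morphism from the trivial angle on
  \<open>cs ! 0\<close>. In its next square the map of the trivial angle is zero, and the other side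
  is the composite in question.\<close>

lemma angle_comp_zero_start:
  assumes "(cs, \<gamma>) \<in> angles C"
  shows "\<gamma> ! 1 \<cdot> \<gamma> ! 0 = 0"
proof -
  obtain Z where Z: "zero_object C Z" using zero_object_exists by blast
  note len = angle_length[OF assms]
  have g0: "\<gamma> ! 0 \<in> Hom C (cs ! 0) (cs ! 1)" using angle_Hom[OF assms, of 0] len by (simp add: nth_append)
  obtain \<phi> where \<phi>: "\<phi> 1 = \<gamma> ! 0"
    "sequence_morphism C d (cs ! 0 # cs ! 0 # replicate d Z) (idm C (cs ! 0) # replicate (d + 1) 0) cs \<gamma> \<phi>"
    using N3[OF N1_trivial[OF Z] assms, of "idm C (cs ! 0)" "cs ! 0" "\<gamma> ! 0"] g0 idm_closed
    by auto
  have "\<phi> 2 \<cdot> 0 = \<gamma> ! 1 \<cdot> \<phi> 1" "\<phi> 2 \<in> Hom C Z (cs ! 2)"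
    using \<phi>(2) d_pos unfolding sequence_morphism_def
    by (auto simp: numeral_2_eq_2 dest: spec[of _ "1::nat"] spec[of _ "2::nat"])
  then show ?thesis using \<phi>(1) Comp_zero_right by metis
qed

text \<open>Both the given angle and the trivial angle on \<open>X\<close> are rotated once. The
  hypothesis on \<open>f\<close> is then the first commuting square, with zero as second component,
  and N3 supplies a last component from \<Sigma> X to the shift of \<open>cs ! 0\<close>;
  \<open>g\<close> is its preimage under the shift.\<close>

lemma angle_exact_start:
  assumes "(cs, \<gamma>) \<in> angles C" and f: "f \<in> Hom C X (cs ! 1)" and "\<gamma> ! 1 \<cdot> f = 0"
  obtains g where "g \<in> Hom C X (cs ! 0)" "f = \<gamma> ! 0 \<cdot> g"
proof -
  obtain Z where Z: "zero_object C Z" using zero_object_exists by blast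
  note len = angle_length[OF assms(1)]
  let ?s = "(- 1) ^ d :: 'k"
  have g0: "\<gamma> ! 0 \<in> Hom C (cs ! 0) (cs ! 1)" using angle_Hom[OF assms(1), of 0] len by (simp add: nth_append)
  let ?cs = "drop 1 cs @ map (\<Sigma>O C) (take 1 cs)"
  let ?\<gamma> = "drop 1 \<gamma> @ map (\<lambda>f. scl C ?s (\<Sigma>M C f)) (take 1 \<gamma>)"
  let ?bs = "drop 1 (X # X # replicate d Z) @ map (\<Sigma>O C) (take 1 (X # X # replicate d Z))"
  let ?\<beta> = "drop 1 (idm C X # replicate (d + 1) 0) @
    map (\<lambda>f. scl C ?s (\<Sigma>M C f)) (take 1 (idm C X # replicate (d + 1) 0))"
  have ac: "(?cs, ?\<gamma>) \<in> angles C" using rotate_angle[OF assms(1), of 1] by simp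
  have ab: "(?bs, ?\<beta>) \<in> angles C" using rotate_angle[OF N1_trivial[OF Z, of X], of 1] by simp
  have e: "?cs ! 0 = cs ! 1" "?\<gamma> ! 0 = \<gamma> ! 1" "?bs ! 0 = X" "?\<beta> ! 0 = 0"
    "?cs ! (d + 1) = \<Sigma>O C (cs ! 0)" "?\<gamma> ! (d + 1) = scl C ?s (\<Sigma>M C (\<gamma> ! 0))"
    "?bs ! (d + 1) = \<Sigma>O C X" "?\<beta> ! (d + 1) = scl C ?s (idm C (\<Sigma>O C X))"
    using len by (auto simp: nth_append take_Suc_conv_app_nth \<Sigma>_idm)
  have "(0 \<cdot> ?\<beta> ! 0 :: 'm) = ?\<gamma> ! 0 \<cdot> f" using e(2,4) assms(3) Comp_zero_left[OF zero_Hom] by simp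
  then obtain \<phi> where \<phi>: "\<phi> 0 = f" "sequence_morphism C d ?bs ?\<beta> ?cs ?\<gamma> \<phi>"
    using N3[OF ab ac, of f 0] f e(1,3) by auto
  have last: "\<Sigma>M C (\<phi> 0) \<cdot> (?\<beta> ! (d + 1)) = (?\<gamma> ! (d + 1)) \<cdot> \<phi> (d + 1)"
    and last2: "\<phi> (d + 1) \<in> Hom C (?bs ! (d + 1)) (?cs ! (d + 1))"
    using \<phi>(2) unfolding sequence_morphism_def by auto
  obtain g where g: "g \<in> Hom C X (cs ! 0)" "\<Sigma>M C g = \<phi> (d + 1)"
    using last2 \<Sigma>_preimage e(5,7) by metis
  \<comment> \<open>The rotation sign occurs on both sides of the last square and cancels.\<close>
  have "scl C ?s (\<Sigma>M C f) = scl C ?s (\<Sigma>M C (\<gamma> ! 0) \<cdot> \<Sigma>M C g)"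
    using last \<phi>(1) e(6,8) g Comp_scl_right[OF idm_closed \<Sigma>_Hom[OF f], of ?s]
      Comp_scl_left[OF \<Sigma>_Hom[OF g(1)] \<Sigma>_Hom[OF g0], of ?s] idm_right[OF \<Sigma>_Hom[OF f]] by simp
  then have "\<Sigma>M C f = \<Sigma>M C (\<gamma> ! 0 \<cdot> g)" using \<Sigma>_Comp[OF g(1) g0] by simp
  then have "f = \<gamma> ! 0 \<cdot> g" using \<Sigma>_inject[OF f Comp_closed[OF g(1) g0]] by simp
  then show ?thesis using that g(1) by blast
qed

text \<open>Dual to \<open>angle_exact_start\<close>: the given angle is mapped to a right rotation
  of the trivial angle on \<open>X\<close>, and the component in degree 2 is the factor
  sought.\<close>

lemma angle_coexact_start:
  assumes "(cs, \<gamma>) \<in> angles C" and f: "f \<in> Hom C (cs ! 1) X" and "f \<cdot> \<gamma> ! 0 = 0"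
  obtains g where "g \<in> Hom C (cs ! 2) X" "f = g \<cdot> \<gamma> ! 1"
proof -
  obtain Z where Z: "zero_object C Z" "zero_object C (\<Sigma>O C Z)" using zero_\<Sigma>_zero .
  note len = angle_length[OF assms(1)]
  have d: "d = Suc (d - 1)" using d_pos by simp
  \<comment> \<open>The padding is \<open>\<Sigma>O C Z\<close>, not \<open>Z\<close>, because left
    rotation appends the shift of the head; the result is then literally a trivial angle padded with
    one zero object.\<close>
  let ?bs = "Z # X # X # replicate (d - 1) (\<Sigma>O C Z)" and ?\<beta> = "0 # idm C X # replicate d 0"
  have "left_rotation_objects C ?bs = X # X # replicate d (\<Sigma>O C Z)"
    by (subst (2) d) (simp add: left_rotation_objects_def replicate_append_same del: replicate_Suc, simp)
  moreover have "left_rotation_morphisms C d ?\<beta> = idm C X # replicate (d + 1) 0"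
    by (simp add: left_rotation_morphisms_def replicate_append_same)
  moreover have "sigma_sequence C d ?bs ?\<beta>"
    unfolding sigma_sequence_def using d_pos
    by (auto simp: nth_Cons' idm_closed)
  ultimately have ab: "(?bs, ?\<beta>) \<in> angles C" using N2 N1_trivial[OF Z(2), of X] by simp
  have "f \<cdot> \<gamma> ! 0 = ?\<beta> ! 0 \<cdot> 0" using assms(3) Comp_zero_left[OF zero_Hom] by simp
  then obtain \<phi> where \<phi>: "\<phi> 1 = f" "sequence_morphism C d cs \<gamma> ?bs ?\<beta> \<phi>"
    using N3[OF assms(1) ab, of 0 f] f by auto
  have "\<phi> 2 \<cdot> \<gamma> ! 1 = idm C X \<cdot> \<phi> 1" "\<phi> 2 \<in> Hom C (cs ! 2) X"
    using \<phi>(2) d_pos unfolding sequence_morphism_def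
    by (auto simp: numeral_2_eq_2 dest: spec[of _ "1::nat"] spec[of _ "2::nat"])
  then show ?thesis using that \<phi>(1) idm_left[OF f] by metis
qed

text \<open>Reduces composition and exactness at an inner position to the front of an angle. For
  \<open>i \<le> d\<close> the first two morphisms after rotation are original ones, so no sign
  appears.\<close>

lemma rotate_angle_start:
  assumes "(cs, \<gamma>) \<in> angles C" "i \<le> d"
  obtains cs' \<gamma>' where "(cs', \<gamma>') \<in> angles C" "cs' ! 0 = cs ! i" "cs' ! 1 = cs ! Suc i"
    "cs' ! 2 = (cs @ [\<Sigma>O C (cs ! 0)]) ! (i + 2)" "\<gamma>' ! 0 = \<gamma> ! i" "\<gamma>' ! 1 = \<gamma> ! Suc i"
proof -
  note len = angle_length[OF assms(1)]
  show ?thesis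
  proof (rule that[OF rotate_angle[OF assms(1)]])
    show "(drop i cs @ map (\<Sigma>O C) (take i cs)) ! 2 = (cs @ [\<Sigma>O C (cs ! 0)]) ! (i + 2)"
      using len assms(2) d_pos by (cases "i = d") (auto simp: nth_append)
  qed (use len assms(2) in \<open>auto simp: nth_append\<close>)
qed

text \<open>Here the second morphism has passed the end of the list and carries the sign of the
  rotation; the statements about the end of an angle have to remove it.\<close>

lemma rotate_angle_end:
  assumes "(cs, \<gamma>) \<in> angles C"
  obtains cs' \<gamma>' where "(cs', \<gamma>') \<in> angles C" "cs' ! 0 = cs ! (d + 1)" "cs' ! 1 = \<Sigma>O C (cs ! 0)"
    "cs' ! 2 = \<Sigma>O C (cs ! 1)" "\<gamma>' ! 0 = \<gamma> ! (d + 1)" "\<gamma>' ! 1 = scl C ((- 1) ^ d) (\<Sigma>M C (\<gamma> ! 0))"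
proof -
  note len = angle_length[OF assms(1)]
  show ?thesis
    using that[OF rotate_angle[OF assms(1), of "d + 1"]] len d_pos by (simp add: nth_append)
qed

lemma angle_comp_zero:
  assumes "(cs, \<gamma>) \<in> angles C" "i \<le> d"
  shows "\<gamma> ! Suc i \<cdot> \<gamma> ! i = 0"
  using rotate_angle_start[OF assms] angle_comp_zero_start by metis

lemma angle_Hom_start:
  assumes "(cs, \<gamma>) \<in> angles C"
  shows "\<gamma> ! 0 \<in> Hom C (cs ! 0) (cs ! 1)" "\<gamma> ! (d + 1) \<in> Hom C (cs ! (d + 1)) (\<Sigma>O C (cs ! 0))"
  using angles_sequence[OF assms] unfolding sigma_sequence_def by auto

lemma angle_comp_zero_end:
  assumes "(cs, \<gamma>) \<in> angles C"
  shows "\<Sigma>M C (\<gamma> ! 0) \<cdot> \<gamma> ! (d + 1) = 0"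
proof -
  note H = angle_Hom_start[OF assms]
  have "scl C ((- 1) ^ d) (\<Sigma>M C (\<gamma> ! 0)) \<cdot> \<gamma> ! (d + 1) = 0"
    using rotate_angle_end[OF assms] angle_comp_zero_start by metis
  then show ?thesis using Comp_scl_left[OF H(2) \<Sigma>_Hom[OF H(1)]] by simp
qed

lemma angle_exact:
  assumes "(cs, \<gamma>) \<in> angles C" "i \<le> d" "f \<in> Hom C X (cs ! Suc i)" "\<gamma> ! Suc i \<cdot> f = 0"
  obtains g where "g \<in> Hom C X (cs ! i)" "f = \<gamma> ! i \<cdot> g"
  using rotate_angle_start[OF assms(1,2)] angle_exact_start assms(3,4) by metis

lemma angle_coexact:
  assumes "(cs, \<gamma>) \<in> angles C" "i \<le> d" "f \<in> Hom C (cs ! Suc i) X" "f \<cdot> \<gamma> ! i = 0"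
  obtains g where "g \<in> Hom C ((cs @ [\<Sigma>O C (cs ! 0)]) ! (i + 2)) X" "f = g \<cdot> \<gamma> ! Suc i"
  using rotate_angle_start[OF assms(1,2)] angle_coexact_start assms(3,4) by metis

lemma angle_exact_end:
  assumes "(cs, \<gamma>) \<in> angles C" "f \<in> Hom C X (cs ! 0)" "\<gamma> ! 0 \<cdot> f = 0"
  obtains g where "g \<in> Hom C (\<Sigma>O C X) (cs ! (d + 1))" "\<Sigma>M C f = \<gamma> ! (d + 1) \<cdot> g"
proof -
  note H = angle_Hom_start[OF assms(1)]
  have "scl C ((- 1) ^ d) (\<Sigma>M C (\<gamma> ! 0)) \<cdot> \<Sigma>M C f = 0"
    using Comp_scl_left[OF \<Sigma>_Hom[OF assms(2)] \<Sigma>_Hom[OF H(1)]] \<Sigma>_Comp[OF assms(2) H(1)] assms(3) by simp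
  then show ?thesis
    using rotate_angle_end[OF assms(1)] angle_exact_start \<Sigma>_Hom[OF assms(2)] that by metis
qed

lemma angle_coexact_end:
  assumes "(cs, \<gamma>) \<in> angles C" "f \<in> Hom C (\<Sigma>O C (cs ! 0)) X" "f \<cdot> \<gamma> ! (d + 1) = 0"
  obtains g where "g \<in> Hom C (\<Sigma>O C (cs ! 1)) X" "f = g \<cdot> \<Sigma>M C (\<gamma> ! 0)"
proof -
  note H = angle_Hom_start[OF assms(1)]
  obtain g where g: "g \<in> Hom C (\<Sigma>O C (cs ! 1)) X" "f = g \<cdot> scl C ((- 1) ^ d) (\<Sigma>M C (\<gamma> ! 0))"
    using rotate_angle_end[OF assms(1)] angle_coexact_start assms(2,3) by metis
  then have "f = scl C ((- 1) ^ d) g \<cdot> \<Sigma>M C (\<gamma> ! 0)"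
    using Comp_scl_right[OF \<Sigma>_Hom[OF H(1)] g(1)] Comp_scl_left[OF \<Sigma>_Hom[OF H(1)] g(1)] by simp
  then show ?thesis using that scl_Hom[OF g(1)] by blast
qed

text \<open>The index sees only the objects of an angle. Once the morphisms are forgotten, rotation
  works in both directions without signs, and cones need to be known only up to their terms.\<close>

definition angle_objects :: "'o list \<Rightarrow> bool" where
  "angle_objects cs \<longleftrightarrow> (\<exists>\<gamma>. (cs, \<gamma>) \<in> angles C)"

lemma angle_objects_length: "angle_objects cs \<Longrightarrow> length cs = d + 2"
  unfolding angle_objects_def using angle_length by blast

lemma angle_objects_rotate1:
  assumes "length xs = d + 1"
  shows "angle_objects (x # xs) \<longleftrightarrow> angle_objects (xs @ [\<Sigma>O C x])"
proof
  assume "angle_objects (x # xs)"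
  then obtain \<gamma> where \<gamma>: "(x # xs, \<gamma>) \<in> angles C" unfolding angle_objects_def by blast
  then show "angle_objects (xs @ [\<Sigma>O C x])"
    using rotate_angle[OF \<gamma>, of 1] unfolding angle_objects_def by auto
next
  assume "angle_objects (xs @ [\<Sigma>O C x])"
  then obtain \<gamma> where \<gamma>: "(xs @ [\<Sigma>O C x], \<gamma>) \<in> angles C" unfolding angle_objects_def by blast
  note len = angle_length[OF \<gamma>] and H = angles_sequence[OF \<gamma>, unfolded sigma_sequence_def]
  let ?s = "(- 1) ^ d :: 'k"
  have ss: "?s * ?s = 1" by (simp flip: power_add)
  have "\<gamma> ! (d + 1) \<in> Hom C (\<Sigma>O C x) (\<Sigma>O C (xs ! 0))"
    using H assms by (auto simp: nth_append)
  \<comment> \<open>The sign is put in here because left rotation multiplies by it once more, and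
    its square is 1.\<close>
  then obtain h where h: "h \<in> Hom C x (xs ! 0)" "\<Sigma>M C h = scl C ?s (\<gamma> ! (d + 1))"
    using \<Sigma>_preimage scl_Hom by metis
  let ?\<gamma> = "h # butlast \<gamma>"
  have H': "\<gamma> ! i \<in> Hom C ((xs @ [\<Sigma>O C x]) ! i) ((xs @ [\<Sigma>O C x]) ! Suc i)" if "i \<le> d" for i
    using H that by blast
  have "?\<gamma> ! i \<in> Hom C ((x # xs) ! i) ((x # xs) ! Suc i)" if "i \<le> d" for i
    using H'[of "i - 1"] that h(1) len assms by (cases i) (auto simp: nth_append nth_butlast)
  moreover have "?\<gamma> ! (d + 1) \<in> Hom C ((x # xs) ! (d + 1)) (\<Sigma>O C ((x # xs) ! 0))"
    using H'[of d] len assms by (auto simp: nth_append nth_butlast)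
  ultimately have seq: "sigma_sequence C d (x # xs) ?\<gamma>"
    unfolding sigma_sequence_def using len assms by auto
  have "left_rotation_morphisms C d ?\<gamma> = \<gamma>"
  proof -
    have "\<gamma> \<noteq> []" using len by auto
    then have e: "scl C ?s (\<Sigma>M C h) = last \<gamma>" using h(2) ss len by (simp add: last_conv_nth)
    show ?thesis using e \<open>\<gamma> \<noteq> []\<close> by (simp add: left_rotation_morphisms_def)
  qed
  then have "(x # xs, ?\<gamma>) \<in> angles C"
    using N2[OF seq] \<gamma> by (simp add: left_rotation_objects_def)
  then show "angle_objects (x # xs)" unfolding angle_objects_def by blast
qed

lemma angle_objects_rotate:
  assumes "length xs + length ys = d + 2"
  shows "angle_objects (xs @ ys) \<longleftrightarrow> angle_objects (ys @ map (\<Sigma>O C) xs)"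
  using assms
proof (induction xs arbitrary: ys)
  case (Cons x xs)
  then show ?case using angle_objects_rotate1[of "xs @ ys" x] Cons.IH[of "ys @ [\<Sigma>O C x]"] by simp
qed simp

text \<open>The morphisms between the complements \<open>bs\<close> are not given but forced: the
  angle is block diagonal with respect to \<open>as\<close>, and its second blocks form a sequence
  to which closure under summands applies.\<close>

lemma angle_summand:
  assumes E: "(es, \<epsilon>) \<in> angles C" and A: "sigma_sequence C d as \<alpha>" and lb: "length bs = d + 2"
    and D: "\<And>i. i \<le> d + 1 \<Longrightarrow> dsum_data C (es ! i) [as ! i, bs ! i] (\<iota> i) (\<pi> i)"
    and inc: "sequence_morphism C d as \<alpha> es \<epsilon> (\<lambda>i. \<iota> i 0)"
    and proj: "sequence_morphism C d es \<epsilon> as \<alpha> (\<lambda>i. \<pi> i 0)"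
  shows "angle_objects bs"
proof -
  note SE = angles_sequence[OF E, unfolded sigma_sequence_def]
    and SA = A[unfolded sigma_sequence_def]
    and SI = inc[unfolded sequence_morphism_def] and SP = proj[unfolded sequence_morphism_def]
  have SD: "dsum_data C (\<Sigma>O C (es ! 0)) [\<Sigma>O C (as ! 0), \<Sigma>O C (bs ! 0)]
      (\<lambda>j. \<Sigma>M C (\<iota> 0 j)) (\<lambda>j. \<Sigma>M C (\<pi> 0 j))"
    using \<Sigma>_dsum_data[OF D[of 0]] by simp
  define b where "b i = \<pi> (Suc i) 1 \<cdot> (\<epsilon> ! i \<cdot> \<iota> i 1)" for i
  define b' where "b' = \<Sigma>M C (\<pi> 0 1) \<cdot> (\<epsilon> ! (d + 1) \<cdot> \<iota> (d + 1) 1)"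
  define \<beta> where "\<beta> = map b [0..<d + 1] @ [b']"
  have \<beta>: "\<beta> ! i = b i" if "i \<le> d" for i
    unfolding \<beta>_def using that by (simp add: nth_append less_Suc_eq_le del: upt_Suc)
  have \<beta>': "\<beta> ! (d + 1) = b'" unfolding \<beta>_def by (simp add: nth_append del: upt_Suc)
  have B: "b i \<in> Hom C (bs ! i) (bs ! Suc i)" "\<iota> (Suc i) 1 \<cdot> b i = \<epsilon> ! i \<cdot> \<iota> i 1"
    "\<pi> (Suc i) 1 \<cdot> \<epsilon> ! i = b i \<cdot> \<pi> i 1" if "i \<le> d" for i
    unfolding b_def
    using dsum_complement_component[OF D[of i] D[of "Suc i"], of "\<epsilon> ! i" "\<alpha> ! i"] that SE SA SI SP by auto
  have B': "b' \<in> Hom C (bs ! (d + 1)) (\<Sigma>O C (bs ! 0))" "\<Sigma>M C (\<iota> 0 1) \<cdot> b' = \<epsilon> ! (d + 1) \<cdot> \<iota> (d + 1) 1"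
    "\<Sigma>M C (\<pi> 0 1) \<cdot> \<epsilon> ! (d + 1) = b' \<cdot> \<pi> (d + 1) 1"
    unfolding b'_def
    using dsum_complement_component[OF D[of "d + 1"] SD, of "\<epsilon> ! (d + 1)" "\<alpha> ! (d + 1)"] SE SA SI SP by auto
  have seq: "sigma_sequence C d bs \<beta>"
    unfolding sigma_sequence_def using lb B(1) B'(1) \<beta> \<beta>' by (auto simp: \<beta>_def)
  have "sequence_morphism C d bs \<beta> es \<epsilon> (\<lambda>i. \<iota> i 1)"
    unfolding sequence_morphism_def using dsum_data2D(2)[OF D] B(2) B'(2) \<beta> \<beta>' by auto
  moreover have "sequence_morphism C d es \<epsilon> bs \<beta> (\<lambda>i. \<pi> i 1)"
    unfolding sequence_morphism_def using dsum_data2D(4)[OF D] B(3) B'(3) \<beta> \<beta>' by auto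
  ultimately have "sequence_dsum C d es \<epsilon> as \<alpha> bs \<beta>"
    unfolding sequence_dsum_def using D inc proj by blast
  then have "(bs, \<beta>) \<in> angles C" using N1_sums_summands[OF A seq angles_sequence[OF E]] E by blast
  then show ?thesis unfolding angle_objects_def by blast
qed

lemma angle_objects_dsum:
  assumes "angle_objects as" "angle_objects bs" "length cs = d + 2"
    and "\<And>i. i \<le> d + 1 \<Longrightarrow> is_dsum C (cs ! i) [as ! i, bs ! i]"
  shows "angle_objects cs"
proof -
  obtain \<alpha> \<beta> where A: "(as, \<alpha>) \<in> angles C" and B: "(bs, \<beta>) \<in> angles C"
    using assms(1,2) unfolding angle_objects_def by blast
  obtain \<iota> \<pi> where D: "\<And>i. i \<le> d + 1 \<Longrightarrow> dsum_data C (cs ! i) [as ! i, bs ! i] (\<iota> i) (\<pi> i)"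
    using assms(4) unfolding is_dsum_def by metis
  note SA = angles_sequence[OF A] and SB = angles_sequence[OF B]
  note SA' = SA[unfolded sigma_sequence_def] and SB' = SB[unfolded sigma_sequence_def]
  have SD: "dsum_data C (\<Sigma>O C (cs ! 0)) [\<Sigma>O C (as ! 0), \<Sigma>O C (bs ! 0)]
      (\<lambda>j. \<Sigma>M C (\<iota> 0 j)) (\<lambda>j. \<Sigma>M C (\<pi> 0 j))"
    using \<Sigma>_dsum_data[OF D[of 0]] by simp
  define c where "c i = \<iota> (Suc i) 0 \<cdot> (\<alpha> ! i \<cdot> \<pi> i 0) + \<iota> (Suc i) 1 \<cdot> (\<beta> ! i \<cdot> \<pi> i 1)" for i
  define c' where "c' = \<Sigma>M C (\<iota> 0 0) \<cdot> (\<alpha> ! (d + 1) \<cdot> \<pi> (d + 1) 0) +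
    \<Sigma>M C (\<iota> 0 1) \<cdot> (\<beta> ! (d + 1) \<cdot> \<pi> (d + 1) 1)"
  define \<gamma> where "\<gamma> = map c [0..<d + 1] @ [c']"
  have \<gamma>: "\<gamma> ! i = c i" if "i \<le> d" for i
    unfolding \<gamma>_def using that by (simp add: nth_append less_Suc_eq_le del: upt_Suc)
  have \<gamma>': "\<gamma> ! (d + 1) = c'" unfolding \<gamma>_def by (simp add: nth_append del: upt_Suc)
  have G: "c i \<in> Hom C (cs ! i) (cs ! Suc i)" "\<iota> (Suc i) 0 \<cdot> \<alpha> ! i = c i \<cdot> \<iota> i 0"
    "\<iota> (Suc i) 1 \<cdot> \<beta> ! i = c i \<cdot> \<iota> i 1" "\<pi> (Suc i) 0 \<cdot> c i = \<alpha> ! i \<cdot> \<pi> i 0"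
    "\<pi> (Suc i) 1 \<cdot> c i = \<beta> ! i \<cdot> \<pi> i 1" if "i \<le> d" for i
    unfolding c_def
    using dsum_block_diagonal[OF D[of i] D[of "Suc i"], of "\<alpha> ! i" "\<beta> ! i"] that SA' SB' by auto
  have G': "c' \<in> Hom C (cs ! (d + 1)) (\<Sigma>O C (cs ! 0))" "\<Sigma>M C (\<iota> 0 0) \<cdot> \<alpha> ! (d + 1) = c' \<cdot> \<iota> (d + 1) 0"
    "\<Sigma>M C (\<iota> 0 1) \<cdot> \<beta> ! (d + 1) = c' \<cdot> \<iota> (d + 1) 1"
    "\<Sigma>M C (\<pi> 0 0) \<cdot> c' = \<alpha> ! (d + 1) \<cdot> \<pi> (d + 1) 0"
    "\<Sigma>M C (\<pi> 0 1) \<cdot> c' = \<beta> ! (d + 1) \<cdot> \<pi> (d + 1) 1"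
    unfolding c'_def
    using dsum_block_diagonal[OF D[of "d + 1"] SD, of "\<alpha> ! (d + 1)" "\<beta> ! (d + 1)"] SA' SB' by auto
  have seq: "sigma_sequence C d cs \<gamma>"
    unfolding sigma_sequence_def using assms(3) G(1) G'(1) \<gamma> \<gamma>' by (auto simp: \<gamma>_def)
  have "sequence_morphism C d as \<alpha> cs \<gamma> (\<lambda>i. \<iota> i 0)"
    unfolding sequence_morphism_def using dsum_data2D(1)[OF D] G(2) G'(2) \<gamma> \<gamma>' by auto
  moreover have "sequence_morphism C d bs \<beta> cs \<gamma> (\<lambda>i. \<iota> i 1)"
    unfolding sequence_morphism_def using dsum_data2D(2)[OF D] G(3) G'(3) \<gamma> \<gamma>' by auto
  moreover have "sequence_morphism C d cs \<gamma> as \<alpha> (\<lambda>i. \<pi> i 0)"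
    unfolding sequence_morphism_def using dsum_data2D(3)[OF D] G(4) G'(4) \<gamma> \<gamma>' by auto
  moreover have "sequence_morphism C d cs \<gamma> bs \<beta> (\<lambda>i. \<pi> i 1)"
    unfolding sequence_morphism_def using dsum_data2D(4)[OF D] G(5) G'(5) \<gamma> \<gamma>' by auto
  ultimately have "sequence_dsum C d cs \<gamma> as \<alpha> bs \<beta>"
    unfolding sequence_dsum_def using D by blast
  then have "(cs, \<gamma>) \<in> angles C" using N1_sums_summands[OF SA SB seq] A B by blast
  then show ?thesis unfolding angle_objects_def by blast
qed

text \<open>The two conditions on \<open>\<epsilon> ! 0\<close> make the trivial angle on
  \<open>c\<close> a summand. Its remaining maps commute because consecutive morphisms of an angle
  compose to zero, and its complement is the shortened sequence.\<close>

lemma angle_cancel: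
  assumes E: "(es, \<epsilon>) \<in> angles C"
    and D0: "dsum_data C (es ! 0) [c, x] \<iota>0 \<pi>0" and D1: "dsum_data C (es ! 1) [c, y] \<iota>1 \<pi>1"
    and inc: "\<iota>1 0 = \<epsilon> ! 0 \<cdot> \<iota>0 0" and proj: "\<pi>0 0 = \<pi>1 0 \<cdot> \<epsilon> ! 0"
  shows "angle_objects (x # y # drop 2 es)"
proof -
  obtain Z where Z: "zero_object C Z" using zero_object_exists by blast
  note len = angle_length[OF E]
  note SE = angles_sequence[OF E, unfolded sigma_sequence_def]
  note tr = N1_trivial[OF Z, of c]
  let ?as = "c # c # replicate d Z" and ?\<alpha> = "idm C c # replicate (d + 1) 0"
  let ?bs = "x # y # drop 2 es"
  \<comment> \<open>From degree 2 on the trivial angle consists of zero objects, so its inclusions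
    and projections are zero and the complement is the whole object.\<close>
  define \<iota> where "\<iota> i = (if i = 0 then \<iota>0 else if i = 1 then \<iota>1
    else (\<lambda>j::nat. if j = 0 then 0 else idm C (es ! i)))" for i :: nat
  define \<pi> where "\<pi> i = (if i = 0 then \<pi>0 else if i = 1 then \<pi>1
    else (\<lambda>j::nat. if j = 0 then 0 else idm C (es ! i)))" for i :: nat
  have idZ: "idm C Z = 0" using Z unfolding zero_object_def .
  note H0 = dsum_data2D[OF D0] and H1 = dsum_data2D[OF D1]
  have e0: "\<epsilon> ! 0 \<in> Hom C (es ! 0) (es ! 1)" using SE by auto
  have D: "dsum_data C (es ! i) [?as ! i, ?bs ! i] (\<iota> i) (\<pi> i)" if "i \<le> d + 1" for i
  proof -
    consider "i = 0" | "i = 1" | k where "i = Suc (Suc k)" by (metis One_nat_def not0_implies_Suc)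
    then show ?thesis
    proof cases
      case (3 k)
      then have "?as ! i = Z" "?bs ! i = es ! i" using that len by (auto simp: nth_append)
      moreover have "dsum_data C (es ! i) [Z, es ! i] (\<iota> i) (\<pi> i)"
        using 3 idm_left[OF idm_closed, of "es ! i"]
        by (intro dsum_data2I) (auto simp: \<iota>_def \<pi>_def idm_closed idZ Comp_zero_left[OF zero_Hom]
          Comp_zero_left[OF idm_closed] Comp_zero_right[OF idm_closed])
      ultimately show ?thesis by simp
    qed (use D0 D1 in \<open>simp_all add: \<iota>_def \<pi>_def\<close>)
  qed
  have inc': "sequence_morphism C d ?as ?\<alpha> es \<epsilon> (\<lambda>i. \<iota> i 0)"
    unfolding sequence_morphism_def
  proof (intro conjI allI impI)
    fix i assume "i \<le> d + 1"
    then show "\<iota> i 0 \<in> Hom C (?as ! i) (es ! i)" using dsum_data2D(1)[OF D] by blast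
  next
    fix i assume i: "i \<le> d"
    have ei: "\<epsilon> ! i \<in> Hom C (es ! i) (es ! Suc i)" using SE i by blast
    consider "i = 0" | "i = 1" | k where "i = Suc (Suc k)" by (metis One_nat_def not0_implies_Suc)
    then show "\<iota> (Suc i) 0 \<cdot> ?\<alpha> ! i = \<epsilon> ! i \<cdot> \<iota> i 0"
    proof cases
      case 1
      then show ?thesis using inc idm_right[OF H1(1)] by (simp add: \<iota>_def)
    next
      case 2
      have "\<epsilon> ! 1 \<cdot> \<iota>1 0 = (\<epsilon> ! 1 \<cdot> \<epsilon> ! 0) \<cdot> \<iota>0 0"
        using inc Comp_assoc[OF H0(1) e0 ei[unfolded 2]] by (simp add: numeral_2_eq_2)
      then have "\<epsilon> ! 1 \<cdot> \<iota>1 0 = 0" using angle_comp_zero_start[OF E] H0(1) by simp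
      then show ?thesis using 2 d_pos by (simp add: \<iota>_def Comp_zero_left[OF zero_Hom])
    next
      case 3
      then show ?thesis using i ei by (simp add: \<iota>_def Comp_zero_left[OF zero_Hom])
    qed
  next
    show "\<Sigma>M C (\<iota> 0 0) \<cdot> ?\<alpha> ! (d + 1) = \<epsilon> ! (d + 1) \<cdot> \<iota> (d + 1) 0"
      using d_pos Comp_zero_right[OF angle_Hom_start(2)[OF E]] Comp_zero_right[OF \<Sigma>_Hom[OF H0(1)]]
      by (simp add: \<iota>_def)
  qed
  have proj': "sequence_morphism C d es \<epsilon> ?as ?\<alpha> (\<lambda>i. \<pi> i 0)"
    unfolding sequence_morphism_def
  proof (intro conjI allI impI)
    fix i assume "i \<le> d + 1"
    then show "\<pi> i 0 \<in> Hom C (es ! i) (?as ! i)" using dsum_data2D(3)[OF D] by blast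
  next
    fix i assume i: "i \<le> d"
    have ei: "\<epsilon> ! i \<in> Hom C (es ! i) (es ! Suc i)" using SE i by blast
    consider "i = 0" | "i = 1" | k where "i = Suc (Suc k)" by (metis One_nat_def not0_implies_Suc)
    then show "\<pi> (Suc i) 0 \<cdot> \<epsilon> ! i = ?\<alpha> ! i \<cdot> \<pi> i 0"
    proof cases
      case 1
      then show ?thesis using proj idm_left[OF H0(3)] by (simp add: \<pi>_def)
    next
      case 2
      then show ?thesis using d_pos ei Comp_zero_left[OF H1(3)] by (simp add: \<pi>_def)
    next
      case 3
      then show ?thesis using i ei by (simp add: \<pi>_def Comp_zero_left[OF zero_Hom])
    qed
  next
    have "\<Sigma>M C (\<pi>0 0) \<cdot> \<epsilon> ! (d + 1) = \<Sigma>M C (\<pi>1 0) \<cdot> (\<Sigma>M C (\<epsilon> ! 0) \<cdot> \<epsilon> ! (d + 1))"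
      using proj \<Sigma>_Comp[OF e0 H1(3)] Comp_assoc[OF angle_Hom_start(2)[OF E] \<Sigma>_Hom[OF e0] \<Sigma>_Hom[OF H1(3)]]
      by simp
    also have "\<dots> = 0" using angle_comp_zero_end[OF E] \<Sigma>_Hom[OF H1(3)] by simp
    finally show "\<Sigma>M C (\<pi> 0 0) \<cdot> \<epsilon> ! (d + 1) = ?\<alpha> ! (d + 1) \<cdot> \<pi> (d + 1) 0"
      using d_pos by (simp add: \<pi>_def Comp_zero_left[OF zero_Hom])
  qed
  show ?thesis
    by (rule angle_summand[OF E angles_sequence[OF tr] _ D inc' proj']) (use len in auto)
qed

end

section \<open>Gaussian elimination in mapping cones, and splicing of angles\<close>

context linear_category
begin

lemma dsum_data_swap:
  assumes "dsum_data C X [A, B] \<iota> \<pi>"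
  shows "dsum_data C X [B, A] (\<lambda>j. if j = 0 then \<iota> 1 else \<iota> 0) (\<lambda>j. if j = 0 then \<pi> 1 else \<pi> 0)"
  using dsum_data2D[OF assms] by (intro dsum_data2I) (simp_all add: add.commute)

text \<open>Change of coordinates by an elementary matrix. It straightens a component that is an
  isomorphism on one block but has further entries in its row or column.\<close>

lemma dsum_data_shear:
  assumes "dsum_data C X [A, B] \<iota> \<pi>" "h \<in> Hom C B A"
  shows "dsum_data C X [A, B] (\<lambda>j. if j = 0 then \<iota> 0 else \<iota> 1 - \<iota> 0 \<cdot> h)
    (\<lambda>j. if j = 0 then \<pi> 0 + h \<cdot> \<pi> 1 else \<pi> 1)"
proof -
  note D = dsum_data2D[OF assms(1)] and h = assms(2)
  have ih: "\<iota> 0 \<cdot> h \<in> Hom C B X" and hp: "h \<cdot> \<pi> 1 \<in> Hom C X A"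
    using Comp_closed[OF h D(1)] Comp_closed[OF D(4) h] .
  have "(\<pi> 0 + h \<cdot> \<pi> 1) \<cdot> \<iota> 0 = idm C A"
    using Comp_add_left[OF D(1,3) hp] Comp_assoc'[OF D(1,4) h] D(5,8) h by simp
  moreover have "\<pi> 1 \<cdot> (\<iota> 1 - \<iota> 0 \<cdot> h) = idm C B"
    using Comp_diff_right[OF D(2) ih D(4)] Comp_assoc[OF h D(1,4)] D(6,8) h by simp
  moreover have "\<pi> 1 \<cdot> \<iota> 0 = 0" using D(8) .
  moreover have "(\<pi> 0 + h \<cdot> \<pi> 1) \<cdot> (\<iota> 1 - \<iota> 0 \<cdot> h) = 0"
  proof -
    have "\<pi> 0 \<cdot> (\<iota> 1 - \<iota> 0 \<cdot> h) = - h"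
      using Comp_diff_right[OF D(2) ih D(3)] Comp_assoc[OF h D(1,3)] D(5,7) idm_left[OF h] by simp
    moreover have "(h \<cdot> \<pi> 1) \<cdot> (\<iota> 1 - \<iota> 0 \<cdot> h) = h"
      using Comp_assoc'[OF diff_Hom[OF D(2) ih] D(4) h] \<open>\<pi> 1 \<cdot> (\<iota> 1 - \<iota> 0 \<cdot> h) = idm C B\<close> idm_right[OF h]
      by simp
    ultimately show ?thesis using Comp_add_left[OF diff_Hom[OF D(2) ih] D(3) hp] by simp
  qed
  moreover have "\<iota> 0 \<cdot> (\<pi> 0 + h \<cdot> \<pi> 1) + (\<iota> 1 - \<iota> 0 \<cdot> h) \<cdot> \<pi> 1 = idm C X"
    using Comp_add_right[OF D(3) hp D(1)] Comp_diff_left[OF D(4,2) ih] Comp_assoc[OF D(4) h D(1)] D(9)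
    by simp
  moreover have "\<pi> 0 + h \<cdot> \<pi> 1 \<in> Hom C X A" "\<iota> 1 - \<iota> 0 \<cdot> h \<in> Hom C B X"
    using add_Hom[OF D(3) hp] diff_Hom[OF D(2) ih] .
  ultimately show ?thesis using D(1,4) by (intro dsum_data2I) simp_all
qed

end

context angulated_category
begin

text \<open>The mapping cone of a morphism which is the identity in degree 1 splits off that identity.\<close>

lemma angle_objects_cone:
  assumes "angle_objects (b # c # bs)" "angle_objects (a # c # as)" "Hom C b (hd as) = {0}"
  obtains es where "length es = d" "angle_objects (a # hd bs # es)"
    "\<And>j. j < d \<Longrightarrow> is_dsum C (es ! j) [(tl bs @ [\<Sigma>O C b]) ! j, as ! j]"
proof -
  obtain \<beta> \<gamma> where B: "(b # c # bs, \<beta>) \<in> angles C" and A: "(a # c # as, \<gamma>) \<in> angles C"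
    using assms(1,2) unfolding angle_objects_def by blast
  have len: "length bs = d" "length as = d" using angle_length[OF A] angle_length[OF B] by auto
  then have bs: "bs = hd bs # tl bs" and as: "as = hd as # tl as" using d_pos by (cases bs; cases as; auto)+
  have \<beta>0: "\<beta> ! 0 \<in> Hom C b c" and \<gamma>0: "\<gamma> ! 0 \<in> Hom C a c"
    using angle_Hom_start(1)[OF B] angle_Hom_start(1)[OF A] by auto
  have \<beta>1: "\<beta> ! 1 \<in> Hom C c (hd bs)" and \<gamma>1: "\<gamma> ! 1 \<in> Hom C c (hd as)"
    using angle_Hom[OF B, of 1] angle_Hom[OF A, of 1] bs as d_pos
    by (metis One_nat_def append_Cons le_add2 nth_Cons_0 nth_Cons_Suc)+
  \<comment> \<open>The vanishing Hom space is the only obstruction to lifting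
    \<open>\<beta> ! 0\<close> through \<open>\<gamma> ! 0\<close>; the lift and the identity of
    \<open>c\<close> are the square to which N4 applies.\<close>
  have "\<gamma> ! 1 \<cdot> \<beta> ! 0 = 0" using Comp_closed[OF \<beta>0 \<gamma>1] assms(3) by auto
  then obtain \<phi>0 where \<phi>0: "\<phi>0 \<in> Hom C b a" "\<beta> ! 0 = \<gamma> ! 0 \<cdot> \<phi>0"
    using angle_exact_start[OF A, of "\<beta> ! 0" b] \<beta>0 by auto
  obtain \<phi> es \<epsilon> where \<phi>: "\<phi> 1 = idm C c"
    and M: "mapping_cone C d (b # c # bs) \<beta> (a # c # as) \<gamma> \<phi> es \<epsilon>" and E: "(es, \<epsilon>) \<in> angles C"
    using N4[OF B A, of \<phi>0 "idm C c"] \<phi>0 idm_closed idm_left[OF \<beta>0] by auto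
  obtain \<iota> \<pi> where
    D: "\<And>i. i \<le> d \<Longrightarrow> dsum_data C (es ! i) [(b # c # bs) ! Suc i, (a # c # as) ! i] (\<iota> i) (\<pi> i)"
    and Dl: "dsum_data C (es ! (d + 1)) [\<Sigma>O C b, (a # c # as) ! (d + 1)] (\<iota> (d + 1)) (\<pi> (d + 1))"
    and e: "\<epsilon> ! 0 = \<iota> (Suc 0) 0 \<cdot> (- (\<beta> ! Suc 0)) \<cdot> \<pi> 0 0
          + \<iota> (Suc 0) 1 \<cdot> \<phi> (Suc 0) \<cdot> \<pi> 0 0 + \<iota> (Suc 0) 1 \<cdot> (\<gamma> ! 0) \<cdot> \<pi> 0 1"
    using M unfolding mapping_cone_def by auto
  have b1: "(b # c # bs) ! Suc (Suc 0) = hd bs" using bs by (metis nth_Cons_0 nth_Cons_Suc)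
  have D0: "dsum_data C (es ! 0) [c, a] (\<iota> 0) (\<pi> 0)" using D[of 0] by simp
  have D1: "dsum_data C (es ! 1) [hd bs, c] (\<iota> 1) (\<pi> 1)" using D[of 1] b1 d_pos by simp
  note H0 = dsum_data2D[OF D0] and H1 = dsum_data2D[OF D1]
  \<comment> \<open>The three blocks of the first cone morphism. \<open>e2\<close> is the identity
    of \<open>c\<close>, which occurs in the source as first and in the target as second
    summand.\<close>
  define e1 e2 e3 where "e1 = (\<iota> 1 0 \<cdot> \<beta> ! 1) \<cdot> \<pi> 0 0" and "e2 = \<iota> 1 1 \<cdot> \<pi> 0 0"
    and "e3 = (\<iota> 1 1 \<cdot> \<gamma> ! 0) \<cdot> \<pi> 0 1"
  note ib = Comp_closed[OF \<beta>1 H1(1)] and ig = Comp_closed[OF \<gamma>0 H1(2)]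
  have eH: "e1 \<in> Hom C (es ! 0) (es ! 1)" "e2 \<in> Hom C (es ! 0) (es ! 1)" "e3 \<in> Hom C (es ! 0) (es ! 1)"
    unfolding e1_def e2_def e3_def
    using Comp_closed[OF H0(3) ib] Comp_closed[OF H0(3) H1(2)] Comp_closed[OF H0(4) ig] .
  have e': "\<epsilon> ! 0 = (e2 - e1) + e3"
    using e \<phi> Comp_minus_right[OF \<beta>1 H1(1)] Comp_minus_left[OF H0(3) ib] idm_right[OF H1(2)]
    by (simp add: e1_def e2_def e3_def)
  have inc: "\<iota> 1 1 - \<iota> 1 0 \<cdot> \<beta> ! 1 = \<epsilon> ! 0 \<cdot> \<iota> 0 0"
  proof -
    have "e1 \<cdot> \<iota> 0 0 = \<iota> 1 0 \<cdot> \<beta> ! 1" "e2 \<cdot> \<iota> 0 0 = \<iota> 1 1" "e3 \<cdot> \<iota> 0 0 = 0"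
      using Comp_assoc'[OF H0(1,3) ib] Comp_assoc'[OF H0(1,3) H1(2)] Comp_assoc'[OF H0(1,4) ig]
        H0(5,8) idm_right[OF ib] idm_right[OF H1(2)] ig by (simp_all add: e1_def e2_def e3_def)
    then show ?thesis
      unfolding e' using Comp_add_left[OF H0(1) diff_Hom[OF eH(2,1)] eH(3)] Comp_diff_left[OF H0(1) eH(2,1)]
      by simp
  qed
  have proj: "\<pi> 0 0 + \<gamma> ! 0 \<cdot> \<pi> 0 1 = \<pi> 1 1 \<cdot> \<epsilon> ! 0"
  proof -
    have "\<pi> 1 1 \<cdot> e1 = 0"
      using Comp_assoc[OF H0(3) ib H1(4)] Comp_assoc[OF \<beta>1 H1(1,4)] H1(8) \<beta>1 H0(3) by (simp add: e1_def)
    moreover have "\<pi> 1 1 \<cdot> e2 = \<pi> 0 0"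
      using Comp_assoc[OF H0(3) H1(2,4)] H1(6) idm_left[OF H0(3)] by (simp add: e2_def)
    moreover have "\<pi> 1 1 \<cdot> e3 = \<gamma> ! 0 \<cdot> \<pi> 0 1"
      using Comp_assoc[OF H0(4) ig H1(4)] Comp_assoc[OF \<gamma>0 H1(2,4)] H1(6) idm_left[OF \<gamma>0]
      by (simp add: e3_def)
    ultimately show ?thesis
      unfolding e' using Comp_add_right[OF diff_Hom[OF eH(2,1)] eH(3) H1(4)] Comp_diff_right[OF eH(2,1) H1(4)]
      by simp
  qed
  \<comment> \<open>Shearing the source by \<open>\<gamma> ! 0\<close> and the target by
    \<open>\<beta> ! 1\<close> clears the row and the column of the identity block; the swap brings
    \<open>c\<close> to the front of the target.\<close>
  have "angle_objects (a # hd bs # drop 2 es)"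
    by (rule angle_cancel[OF E dsum_data_shear[OF D0 \<gamma>0] dsum_data_swap[OF dsum_data_shear[OF D1 \<beta>1]]])
       (use inc proj in simp_all)
  moreover have "is_dsum C (drop 2 es ! j) [(tl bs @ [\<Sigma>O C b]) ! j, as ! j]" if j: "j < d" for j
  proof -
    have "drop 2 es ! j = es ! (j + 2)" using angle_length[OF E] j by (simp add: add.commute)
    moreover have "is_dsum C (es ! (j + 2)) [(tl bs @ [\<Sigma>O C b]) ! j, as ! j]"
    proof (cases "j + 2 \<le> d")
      case True
      then have "j < length (tl bs)" using len by auto
      then have "(b # c # bs) ! Suc (j + 2) = (tl bs @ [\<Sigma>O C b]) ! j"
        by (simp add: nth_append nth_tl)
      then show ?thesis using D[OF True] unfolding is_dsum_def by auto
    next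
      case False
      then have "j = d - 1" "j + 2 = d + 1" using j by auto
      then show ?thesis using Dl len unfolding is_dsum_def by (auto simp: nth_append)
    qed
    ultimately show ?thesis by simp
  qed
  ultimately show ?thesis using that[of "drop 2 es"] angle_length[OF E] by simp
qed

text \<open>Rotation moves the common last object \<open>c\<close> to second place, where the cone
  cancels it. In alternating sums the resulting angle is the difference of the two given ones, so
  \<open>c\<close> is eliminated at no cost.\<close>

lemma angle_objects_splice:
  assumes X: "angle_objects (xs @ [x, c])" and Y: "angle_objects (ys @ [y, c])"
    and zero: "Hom C x (\<Sigma>O C (hd ys)) = {0}"
  obtains ws where "length ws = d" "angle_objects (hd xs # ws @ [y])"
    "\<And>j. j < d \<Longrightarrow> is_dsum C (ws ! j) [(tl xs @ [x]) ! j, ys ! j]"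
proof -
  have len: "length xs = d" "length ys = d" using angle_objects_length[OF X] angle_objects_length[OF Y] by auto
  then have ne: "xs \<noteq> []" "ys \<noteq> []" using d_pos by auto
  have X': "angle_objects (x # c # map (\<Sigma>O C) xs)" and Y': "angle_objects (y # c # map (\<Sigma>O C) ys)"
    using angle_objects_rotate[of xs "[x, c]"] angle_objects_rotate[of ys "[y, c]"] X Y len by auto
  have "Hom C x (hd (map (\<Sigma>O C) ys)) = {0}" using zero ne by (simp add: hd_map)
  then obtain es where es: "length es = d" "angle_objects (y # hd (map (\<Sigma>O C) xs) # es)"
    "\<And>j. j < d \<Longrightarrow> is_dsum C (es ! j) [(tl (map (\<Sigma>O C) xs) @ [\<Sigma>O C x]) ! j, map (\<Sigma>O C) ys ! j]"
    using angle_objects_cone[OF X' Y'] by metis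
  \<comment> \<open>All terms of the cone angle except \<open>y\<close> are shifts; the objects are
    unshifted so that the angle can be rotated back.\<close>
  define ws where "ws = map (inv_into UNIV (\<Sigma>O C)) es"
  have ws: "map (\<Sigma>O C) ws = es"
    unfolding ws_def using \<Sigma>O_bij by (simp add: bij_is_surj surj_f_inv_f map_idI o_def)
  have lw: "length ws = d" using es(1) unfolding ws_def by simp
  have "angle_objects ([y] @ map (\<Sigma>O C) (hd xs # ws))" using es(2) ws ne by (simp add: hd_map)
  then have "angle_objects ((hd xs # ws) @ [y])"
    using angle_objects_rotate[of "hd xs # ws" "[y]"] lw by simp
  moreover have "is_dsum C (ws ! j) [(tl xs @ [x]) ! j, ys ! j]" if j: "j < d" for j
  proof -
    have "(tl (map (\<Sigma>O C) xs) @ [\<Sigma>O C x]) ! j = \<Sigma>O C ((tl xs @ [x]) ! j)"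
      using j len by (auto simp: nth_append map_tl[symmetric])
    then show ?thesis using es(3)[OF j] ws j len lw by (metis \<Sigma>_is_dsum nth_map)
  qed
  ultimately show ?thesis using that[of ws] lw by simp
qed

end

section \<open>Dimensions of Hom spaces along angles\<close>

primrec alt_sum :: "('a \<Rightarrow> int) \<Rightarrow> 'a list \<Rightarrow> int" where
  "alt_sum f [] = 0"
| "alt_sum f (x # xs) = f x - alt_sum f xs"

lemma alt_sum_append: "alt_sum f (xs @ ys) = alt_sum f xs + (- 1) ^ length xs * alt_sum f ys"
  by (induction xs) auto

lemma alt_sum_conv_sum: "alt_sum f xs = (\<Sum>i<length xs. (- 1) ^ i * f (xs ! i))"
  by (induction xs) (simp_all add: sum.lessThan_Suc_shift sum_negf[symmetric] del: sum.lessThan_Suc)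

lemma alt_sum_rev: "alt_sum f (rev xs) = - ((- 1) ^ length xs * alt_sum f xs)"
  by (induction xs) (auto simp: alt_sum_append algebra_simps)

lemma alt_sum_cong: "(\<And>x. x \<in> set xs \<Longrightarrow> f x = g x) \<Longrightarrow> alt_sum f xs = alt_sum g xs"
  by (induction xs) auto

lemma alt_sum_map: "alt_sum f (map g xs) = alt_sum (\<lambda>x. f (g x)) xs"
  by (induction xs) auto

lemma alt_sum_add:
  assumes "length xs = length ws" "length ys = length ws"
    "\<And>j. j < length ws \<Longrightarrow> f (ws ! j) = g (xs ! j) + h (ys ! j)"
  shows "alt_sum f ws = alt_sum g xs + alt_sum h ys"
  using assms by (simp add: alt_sum_conv_sum distrib_left sum.distrib)

lemma alt_sum_telescope:
  assumes "\<And>i. i < n \<Longrightarrow> f (xs ! i) = r i + r (Suc i)" "length xs = n"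
  shows "alt_sum f xs = r 0 - (- 1) ^ n * r n"
proof -
  have "(\<Sum>i<m. (- 1) ^ i * f (xs ! i)) = r 0 - (- 1) ^ m * r m" if "m \<le> n" for m
    using that by (induction m) (auto simp: assms(1) algebra_simps)
  then show ?thesis using assms(2) by (simp add: alt_sum_conv_sum)
qed

text \<open>General enough to treat Hom(s,-) and its radical by the same dimension counts.\<close>

definition covariant_subfunctor ::
  "('o, 'm::ab_group_add, 'k::field, 'z) lincat_scheme \<Rightarrow> 'o \<Rightarrow> ('o \<Rightarrow> 'm set) \<Rightarrow> bool" where
  "covariant_subfunctor C s R \<longleftrightarrow>
     (\<forall>X. module.subspace (scl C) (R X) \<and> R X \<subseteq> Hom C s X) \<and>
     (\<forall>X Y. \<forall>f\<in>R X. \<forall>g\<in>Hom C X Y. g \<cdot>\<^bsub>C\<^esub> f \<in> R Y)"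

text \<open>The maps out of \<open>s\<close> that are not split monomorphisms: for \<open>s\<close>
  with local endomorphism ring, the radical of the functor Hom(s,-).\<close>

definition Hom_rad :: "('o, 'm::ab_group_add, 'k, 'z) lincat_scheme \<Rightarrow> 'o \<Rightarrow> 'o \<Rightarrow> 'm set" where
  "Hom_rad C s X = {f \<in> Hom C s X. \<forall>g\<in>Hom C X s. \<not> is_iso C s s (g \<cdot>\<^bsub>C\<^esub> f)}"

locale ks_angulated_category = angulated_category C d
  for C :: "('o, 'm::ab_group_add, 'k::field, 'z) angcat_scheme" (structure) and d :: nat +
  assumes Hom_finite: "Hom_finite C" and Krull_Schmidt: "Krull_Schmidt C"
begin

lemma Hom_spanned: obtains B where "finite B" "Hom C X Y \<subseteq> vs.span B"
  using Hom_finite unfolding Hom_finite_def by (metis order_refl)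

lemma kdim_kernel_image:
  assumes "vs.subspace V" "V \<subseteq> Hom C X Y"
    "\<And>x y. x \<in> V \<Longrightarrow> y \<in> V \<Longrightarrow> f (x + y) = f x + f y"
    "\<And>a x. x \<in> V \<Longrightarrow> f (scl C a x) = scl C a (f x)"
  shows "kdim C V = kdim C {x\<in>V. f x = 0} + kdim C (f ` V)"
proof -
  obtain B where "finite B" "Hom C X Y \<subseteq> vs.span B" using Hom_spanned .
  then show ?thesis using vs.dim_kernel_image[OF assms(1) _ _ assms(3,4)] assms(2) by blast
qed

lemma kdim_zero [simp]: "kdim C {0} = 0"
  using vs.dim_le_card[of "{0}" "{}"] by simp

lemma kdim_image_inj:
  assumes "vs.subspace V" "V \<subseteq> Hom C X Y"
    "\<And>x y. x \<in> V \<Longrightarrow> y \<in> V \<Longrightarrow> f (x + y) = f x + f y"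
    "\<And>a x. x \<in> V \<Longrightarrow> f (scl C a x) = scl C a (f x)"
    "\<And>x. x \<in> V \<Longrightarrow> f x = 0 \<Longrightarrow> x = 0"
  shows "kdim C (f ` V) = kdim C V"
proof -
  have "f 0 = 0" using assms(4)[of 0 0] vs.subspace_0[OF assms(1)] by simp
  then have "{x\<in>V. f x = 0} = {0}" using assms(5) vs.subspace_0[OF assms(1)] by auto
  then show ?thesis using kdim_kernel_image[OF assms(1-4)] by simp
qed

lemma kdim_postcomp:
  assumes "covariant_subfunctor C s R" "g \<in> Hom C X Y"
  shows "kdim C (R X) = kdim C {f\<in>R X. g \<cdot> f = 0} + kdim C ((\<lambda>f. g \<cdot> f) ` R X)"
proof (rule kdim_kernel_image)
  show "vs.subspace (R X)" and R: "R X \<subseteq> Hom C s X" using assms(1) unfolding covariant_subfunctor_def by auto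
  show "g \<cdot> (x + y) = g \<cdot> x + g \<cdot> y" if "x \<in> R X" "y \<in> R X" for x y
    using Comp_add_right[of x s X y g Y] that R assms(2) by blast
  show "g \<cdot> scl C a x = scl C a (g \<cdot> x)" if "x \<in> R X" for a x
    using Comp_scl_right[of x s X g Y] that R assms(2) by blast
qed

lemma kdim_precomp:
  assumes "g \<in> Hom C X Y"
  shows "kdim C (Hom C Y Z) = kdim C {f\<in>Hom C Y Z. f \<cdot> g = 0} + kdim C ((\<lambda>f. f \<cdot> g) ` Hom C Y Z)"
  by (rule kdim_kernel_image[OF subspace_Hom order_refl])
     (use Comp_add_left[OF assms] Comp_scl_left[OF assms] in blast)+

lemma covariant_subfunctor_Hom: "covariant_subfunctor C s (Hom C s)"
  unfolding covariant_subfunctor_def using subspace_Hom Comp_closed by blast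

text \<open>Closure under sums is where locality enters: if \<open>h \<cdot> (f + g)\<close> is
  invertible, then so is \<open>h \<cdot> f\<close> or \<open>h \<cdot> g\<close>.\<close>

lemma covariant_subfunctor_Hom_rad:
  assumes "local_End C s"
  shows "covariant_subfunctor C s (Hom_rad C s)"
proof -
  have "vs.subspace (Hom_rad C s X)" for X
  proof (rule vs.subspaceI)
    show "0 \<in> Hom_rad C s X"
      using zero_not_iso[of s] assms by (auto simp: Hom_rad_def local_End_def)
    show "f + g \<in> Hom_rad C s X" if "f \<in> Hom_rad C s X" "g \<in> Hom_rad C s X" for f g
    proof -
      have f: "f \<in> Hom C s X" and g: "g \<in> Hom C s X" using that unfolding Hom_rad_def by auto
      have "\<not> is_iso C s s (h \<cdot> (f + g))" if h: "h \<in> Hom C X s" for h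
        using assms \<open>f \<in> Hom_rad C s X\<close> \<open>g \<in> Hom_rad C s X\<close> h Comp_add_right[OF f g h]
          Comp_closed[OF f h] Comp_closed[OF g h]
        unfolding local_End_def Hom_rad_def by auto
      then show ?thesis using add_Hom[OF f g] unfolding Hom_rad_def by blast
    qed
    show "scl C a f \<in> Hom_rad C s X" if f: "f \<in> Hom_rad C s X" for a f
    proof -
      have fH: "f \<in> Hom C s X" using f unfolding Hom_rad_def by auto
      have "\<not> is_iso C s s (h \<cdot> scl C a f)" if h: "h \<in> Hom C X s" for h
      proof -
        have "h \<cdot> scl C a f = scl C a h \<cdot> f" using Comp_scl_left[OF fH h] Comp_scl_right[OF fH h] by simp
        then show ?thesis using f scl_Hom[OF h] unfolding Hom_rad_def by auto
      qed
      then show ?thesis using scl_Hom[OF fH] unfolding Hom_rad_def by blast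
    qed
  qed
  moreover have "g \<cdot> f \<in> Hom_rad C s Y" if f: "f \<in> Hom_rad C s X" and g: "g \<in> Hom C X Y" for X Y f g
  proof -
    have fH: "f \<in> Hom C s X" using f unfolding Hom_rad_def by auto
    have "\<not> is_iso C s s (h \<cdot> (g \<cdot> f))" if h: "h \<in> Hom C Y s" for h
      using Comp_assoc[OF fH g h] Comp_closed[OF g h] f unfolding Hom_rad_def by auto
    then show ?thesis using Comp_closed[OF fH g] unfolding Hom_rad_def by blast
  qed
  ultimately show ?thesis unfolding covariant_subfunctor_def Hom_rad_def by blast
qed

text \<open>A subfunctor is stable under composition with the inclusions and projections, so the
  projection to \<open>B\<close> maps \<open>R X\<close> onto \<open>R B\<close> with kernel a copy
  of \<open>R A\<close>.\<close>

lemma kdim_covariant_dsum: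
  assumes R: "covariant_subfunctor C s R" and "is_dsum C X [A, B]"
  shows "kdim C (R X) = kdim C (R A) + kdim C (R B)"
proof -
  obtain \<iota> \<pi> where "dsum_data C X [A, B] \<iota> \<pi>" using assms(2) unfolding is_dsum_def by blast
  note D = dsum_data2D[OF this] and Deq = dsum_data2_eq[OF this]
  have RH: "f \<in> Hom C s Y" if "f \<in> R Y" for f Y
    using R that unfolding covariant_subfunctor_def by blast
  have Rc: "g \<cdot> f \<in> R Z" if "f \<in> R Y" "g \<in> Hom C Y Z" for f g Y Z
    using R that unfolding covariant_subfunctor_def by blast
  have RS: "vs.subspace (R Y)" for Y using R unfolding covariant_subfunctor_def by blast
  have "(\<lambda>f. \<pi> 1 \<cdot> f) ` R X = R B"
  proof
    show "(\<lambda>f. \<pi> 1 \<cdot> f) ` R X \<subseteq> R B" using Rc D(4) by blast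
    show "R B \<subseteq> (\<lambda>f. \<pi> 1 \<cdot> f) ` R X"
    proof
      fix f assume f: "f \<in> R B"
      have "f = \<pi> 1 \<cdot> (\<iota> 1 \<cdot> f)" using Comp_assoc[OF RH[OF f] D(2,4)] D(6) idm_left[OF RH[OF f]] by simp
      then show "f \<in> (\<lambda>f. \<pi> 1 \<cdot> f) ` R X" using Rc[OF f D(2)] by blast
    qed
  qed
  moreover have "{f\<in>R X. \<pi> 1 \<cdot> f = 0} = (\<lambda>f. \<iota> 0 \<cdot> f) ` R A"
  proof
    show "(\<lambda>f. \<iota> 0 \<cdot> f) ` R A \<subseteq> {f\<in>R X. \<pi> 1 \<cdot> f = 0}"
      using Rc D(1) Comp_assoc[OF RH D(1,4)] D(8) Comp_zero_left[OF RH] by auto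
    show "{f\<in>R X. \<pi> 1 \<cdot> f = 0} \<subseteq> (\<lambda>f. \<iota> 0 \<cdot> f) ` R A"
    proof
      fix f assume "f \<in> {f\<in>R X. \<pi> 1 \<cdot> f = 0}"
      then have f: "f \<in> R X" "\<pi> 1 \<cdot> f = 0" by auto
      note fH = RH[OF f(1)]
      have pf: "\<pi> 0 \<cdot> f \<in> Hom C s A" using Comp_closed[OF fH D(3)] .
      have "f = \<iota> 0 \<cdot> (\<pi> 0 \<cdot> f)"
        using Deq[OF fH Comp_closed[OF pf D(1)]] Comp_assoc[OF pf D(1,3)] Comp_assoc[OF pf D(1,4)]
          D(5,8) f(2) idm_left[OF pf] pf by simp
      then show "f \<in> (\<lambda>f. \<iota> 0 \<cdot> f) ` R A" using Rc[OF f(1) D(3)] by blast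
    qed
  qed
  moreover have "kdim C ((\<lambda>f. \<iota> 0 \<cdot> f) ` R A) = kdim C (R A)"
  proof (rule kdim_image_inj[OF RS])
    show "R A \<subseteq> Hom C s A" using RH by blast
    show "\<iota> 0 \<cdot> (x + y) = \<iota> 0 \<cdot> x + \<iota> 0 \<cdot> y" if "x \<in> R A" "y \<in> R A" for x y
      using Comp_add_right[OF RH RH D(1)] that .
    show "\<iota> 0 \<cdot> scl C a x = scl C a (\<iota> 0 \<cdot> x)" if "x \<in> R A" for a x
      using Comp_scl_right[OF RH D(1)] that .
    show "x = 0" if x: "x \<in> R A" "\<iota> 0 \<cdot> x = 0" for x
    proof -
      have "x = \<pi> 0 \<cdot> (\<iota> 0 \<cdot> x)" using Comp_assoc[OF RH[OF x(1)] D(1,3)] D(5) idm_left[OF RH[OF x(1)]] by simp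
      then show ?thesis using x(2) D(3) by simp
    qed
  qed
  ultimately show ?thesis using kdim_postcomp[OF R D(4)] by simp
qed

lemma kdim_contravariant_dsum:
  assumes "is_dsum C X [A, B]"
  shows "kdim C (Hom C X Y) = kdim C (Hom C A Y) + kdim C (Hom C B Y)"
proof -
  obtain \<iota> \<pi> where "dsum_data C X [A, B] \<iota> \<pi>" using assms unfolding is_dsum_def by blast
  note D = dsum_data2D[OF this]
  have "(\<lambda>f. f \<cdot> \<iota> 1) ` Hom C X Y = Hom C B Y"
  proof
    show "(\<lambda>f. f \<cdot> \<iota> 1) ` Hom C X Y \<subseteq> Hom C B Y" using Comp_closed[OF D(2)] by blast
    show "Hom C B Y \<subseteq> (\<lambda>f. f \<cdot> \<iota> 1) ` Hom C X Y"
    proof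
      fix f assume f: "f \<in> Hom C B Y"
      have "f = (f \<cdot> \<pi> 1) \<cdot> \<iota> 1" using Comp_assoc[OF D(2,4) f] D(6) idm_right[OF f] by simp
      then show "f \<in> (\<lambda>f. f \<cdot> \<iota> 1) ` Hom C X Y" using Comp_closed[OF D(4) f] by blast
    qed
  qed
  moreover have "{f\<in>Hom C X Y. f \<cdot> \<iota> 1 = 0} = (\<lambda>f. f \<cdot> \<pi> 0) ` Hom C A Y"
  proof
    show "(\<lambda>f. f \<cdot> \<pi> 0) ` Hom C A Y \<subseteq> {f\<in>Hom C X Y. f \<cdot> \<iota> 1 = 0}"
      using Comp_closed[OF D(3)] Comp_assoc'[OF D(2,3)] D(7) Comp_zero_right by auto
    show "{f\<in>Hom C X Y. f \<cdot> \<iota> 1 = 0} \<subseteq> (\<lambda>f. f \<cdot> \<pi> 0) ` Hom C A Y"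
    proof
      fix f assume "f \<in> {f\<in>Hom C X Y. f \<cdot> \<iota> 1 = 0}"
      then have f: "f \<in> Hom C X Y" "f \<cdot> \<iota> 1 = 0" by auto
      have "f \<cdot> (\<iota> 1 \<cdot> \<pi> 1) = 0" using Comp_assoc[OF D(4,2) f(1)] f(2) D(4) by simp
      then have "f = f \<cdot> (\<iota> 0 \<cdot> \<pi> 0)"
        using Comp_add_right[OF Comp_closed[OF D(3,1)] Comp_closed[OF D(4,2)] f(1)] D(9) idm_right[OF f(1)]
        by simp
      also have "\<dots> = (f \<cdot> \<iota> 0) \<cdot> \<pi> 0" using Comp_assoc[OF D(3,1) f(1)] .
      finally show "f \<in> (\<lambda>f. f \<cdot> \<pi> 0) ` Hom C A Y" using Comp_closed[OF D(1) f(1)] by blast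
    qed
  qed
  moreover have "kdim C ((\<lambda>f. f \<cdot> \<pi> 0) ` Hom C A Y) = kdim C (Hom C A Y)"
  proof (rule kdim_image_inj[OF subspace_Hom order_refl])
    show "(x + y) \<cdot> \<pi> 0 = x \<cdot> \<pi> 0 + y \<cdot> \<pi> 0" if "x \<in> Hom C A Y" "y \<in> Hom C A Y" for x y
      using Comp_add_left[OF D(3)] that .
    show "scl C a x \<cdot> \<pi> 0 = scl C a (x \<cdot> \<pi> 0)" if "x \<in> Hom C A Y" for a x
      using Comp_scl_left[OF D(3)] that .
    show "x = 0" if x: "x \<in> Hom C A Y" "x \<cdot> \<pi> 0 = 0" for x
    proof -
      have "x = (x \<cdot> \<pi> 0) \<cdot> \<iota> 0" using Comp_assoc[OF D(1,3) x(1)] D(5) idm_right[OF x(1)] by simp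
      then show ?thesis using x(2) D(1) by simp
    qed
  qed
  ultimately show ?thesis using kdim_precomp[OF D(2), of Y] by simp
qed

text \<open>An angle with zero connecting morphism consists of von Neumann regular morphisms; hence any
  subfunctor of a covariant Hom functor turns it into an exact sequence.\<close>

lemma split_angle_regular:
  assumes A: "(cs, \<gamma>) \<in> angles C" and z: "\<gamma> ! (d + 1) = 0" and "i \<le> d + 1"
  shows "\<exists>h \<in> Hom C ((cs @ [\<Sigma>O C (cs ! 0)]) ! Suc i) (cs ! i). \<gamma> ! i \<cdot> (h \<cdot> \<gamma> ! i) = \<gamma> ! i"
  using assms(3)
proof (induction i rule: inc_induct)
  case base
  have "0 \<cdot> \<gamma> ! (d + 1) = 0" unfolding z using Comp_zero_left[OF zero_Hom] .
  then show ?case using z Comp_zero_right[OF zero_Hom] by (intro bexI[of _ 0]) simp_all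
next
  case (step i)
  have i: "i \<le> d" using step by simp
  have len: "length cs = d + 2" using angle_length[OF A] by blast
  have ci: "(cs @ [\<Sigma>O C (cs ! 0)]) ! Suc i = cs ! Suc i" using i len by (simp add: nth_append)
  let ?V = "(cs @ [\<Sigma>O C (cs ! 0)]) ! Suc (Suc i)"
  have g0: "\<gamma> ! i \<in> Hom C (cs ! i) (cs ! Suc i)" using angle_Hom[OF A, of i] i ci by simp
  have g1: "\<gamma> ! Suc i \<in> Hom C (cs ! Suc i) ?V" using angle_Hom[OF A, of "Suc i"] i by simp
  obtain h' where h': "h' \<in> Hom C ?V (cs ! Suc i)" "\<gamma> ! Suc i \<cdot> (h' \<cdot> \<gamma> ! Suc i) = \<gamma> ! Suc i"
    using step.IH by blast
  note hg = Comp_closed[OF g1 h'(1)]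
  \<comment> \<open>Regularity moves down by one degree: the complementary idempotent of the next
    map is killed by that map, so by exactness it factors through
    \<open>\<gamma> ! i\<close>.\<close>
  have "\<gamma> ! Suc i \<cdot> (idm C (cs ! Suc i) - h' \<cdot> \<gamma> ! Suc i) = 0"
    using Comp_diff_right[OF idm_closed hg g1] h'(2) idm_right[OF g1] by simp
  then obtain h where h: "h \<in> Hom C (cs ! Suc i) (cs ! i)" "idm C (cs ! Suc i) - h' \<cdot> \<gamma> ! Suc i = \<gamma> ! i \<cdot> h"
    using angle_exact[OF A i diff_Hom[OF idm_closed hg]] by blast
  have "(h' \<cdot> \<gamma> ! Suc i) \<cdot> \<gamma> ! i = 0"
    using Comp_assoc'[OF g0 g1 h'(1)] angle_comp_zero[OF A i] h'(1) by simp
  then have "(\<gamma> ! i \<cdot> h) \<cdot> \<gamma> ! i = \<gamma> ! i"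
    using h(2)[symmetric] Comp_diff_left[OF g0 idm_closed hg] idm_left[OF g0] by simp
  then have "\<gamma> ! i \<cdot> (h \<cdot> \<gamma> ! i) = \<gamma> ! i" using Comp_assoc[OF g0 h(1) g0] by simp
  then show ?case using h(1) ci by auto
qed

lemma split_angle_kdim:
  assumes A: "(cs, \<gamma>) \<in> angles C" and z: "\<gamma> ! (d + 1) = 0" and R: "covariant_subfunctor C s R"
  shows "alt_sum (\<lambda>X. int (kdim C (R X))) cs = 0"
proof -
  note len = angle_length[OF A]
  have RH: "f \<in> Hom C s Y" if "f \<in> R Y" for f Y
    using R that unfolding covariant_subfunctor_def by blast
  have Rc: "g \<cdot> f \<in> R Z" if "f \<in> R Y" "g \<in> Hom C Y Z" for f g Y Z
    using R that unfolding covariant_subfunctor_def by blast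
  have R0: "0 \<in> R Y" for Y
    using R vs.subspace_0 unfolding covariant_subfunctor_def by blast
  have ci: "(cs @ [\<Sigma>O C (cs ! 0)]) ! Suc i = cs ! Suc i" if "i \<le> d" for i
    using that len by (simp add: nth_append)
  \<comment> \<open>\<open>r i\<close> is the rank on \<open>R\<close> of the map entering position
    \<open>i\<close>. Nothing enters position 0, and \<open>\<gamma> ! 0\<close> acts injectively
    because what it kills comes, after a shift, from the zero connecting morphism.\<close>
  define r where "r i = (case i of 0 \<Rightarrow> 0 | Suc j \<Rightarrow> kdim C ((\<lambda>f. \<gamma> ! j \<cdot> f) ` R (cs ! j)))" for i
  have "int (kdim C (R (cs ! i))) = int (r i) + int (r (Suc i))" if i: "i < d + 2" for i
  proof (cases i)
    case 0
    have g: "\<gamma> ! 0 \<in> Hom C (cs ! 0) (cs ! 1)" using angle_Hom_start(1)[OF A] .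
    have "{f\<in>R (cs ! 0). \<gamma> ! 0 \<cdot> f = 0} = {0}"
    proof
      show "{f\<in>R (cs ! 0). \<gamma> ! 0 \<cdot> f = 0} \<subseteq> {0}"
      proof
        fix f assume "f \<in> {f\<in>R (cs ! 0). \<gamma> ! 0 \<cdot> f = 0}"
        then have f: "f \<in> Hom C s (cs ! 0)" "\<gamma> ! 0 \<cdot> f = 0" using RH by auto
        obtain g where "g \<in> Hom C (\<Sigma>O C s) (cs ! (d + 1))" "\<Sigma>M C f = \<gamma> ! (d + 1) \<cdot> g"
          using angle_exact_end[OF A f] .
        then have "\<Sigma>M C f = \<Sigma>M C 0" using z by simp
        then show "f \<in> {0}" using \<Sigma>_inject[OF f(1) zero_Hom] by simp
      qed
      show "{0} \<subseteq> {f\<in>R (cs ! 0). \<gamma> ! 0 \<cdot> f = 0}" using R0 g by simp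
    qed
    then show ?thesis using kdim_postcomp[OF R g] 0 by (simp add: r_def)
  next
    case (Suc j)
    then have j: "j \<le> d" using i by simp
    let ?V = "(cs @ [\<Sigma>O C (cs ! 0)]) ! Suc (Suc j)"
    have g: "\<gamma> ! Suc j \<in> Hom C (cs ! Suc j) ?V" using angle_Hom[OF A, of "Suc j"] j by simp
    have g0: "\<gamma> ! j \<in> Hom C (cs ! j) (cs ! Suc j)" using angle_Hom[OF A, of j] j ci by simp
    obtain h where h: "h \<in> Hom C (cs ! Suc j) (cs ! j)" "\<gamma> ! j \<cdot> (h \<cdot> \<gamma> ! j) = \<gamma> ! j"
      using split_angle_regular[OF A z, of j] j ci[OF j] by auto
    have "{f\<in>R (cs ! Suc j). \<gamma> ! Suc j \<cdot> f = 0} = (\<lambda>f. \<gamma> ! j \<cdot> f) ` R (cs ! j)"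
    proof
      show "(\<lambda>f. \<gamma> ! j \<cdot> f) ` R (cs ! j) \<subseteq> {f\<in>R (cs ! Suc j). \<gamma> ! Suc j \<cdot> f = 0}"
        using Rc g0 Comp_assoc[OF RH g0 g] angle_comp_zero[OF A j] Comp_zero_left[OF RH] by auto
      show "{f\<in>R (cs ! Suc j). \<gamma> ! Suc j \<cdot> f = 0} \<subseteq> (\<lambda>f. \<gamma> ! j \<cdot> f) ` R (cs ! j)"
      proof
        fix f assume "f \<in> {f\<in>R (cs ! Suc j). \<gamma> ! Suc j \<cdot> f = 0}"
        then have f: "f \<in> R (cs ! Suc j)" "\<gamma> ! Suc j \<cdot> f = 0" by auto
        obtain g' where g': "g' \<in> Hom C s (cs ! j)" "f = \<gamma> ! j \<cdot> g'"
          using angle_exact[OF A j RH[OF f(1)] f(2)] .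
        \<comment> \<open>Exactness gives a preimage \<open>g'\<close> only in the full Hom space.
          Regularity replaces it by \<open>h \<cdot> f\<close>, which stays in
          \<open>R\<close>.\<close>
        have "f = (\<gamma> ! j \<cdot> (h \<cdot> \<gamma> ! j)) \<cdot> g'" using g' h(2) by simp
        also have "\<dots> = \<gamma> ! j \<cdot> (h \<cdot> f)"
          using Comp_assoc'[OF g'(1) Comp_closed[OF g0 h(1)] g0] Comp_assoc'[OF g'(1) g0 h(1)] g'(2) by simp
        finally show "f \<in> (\<lambda>f. \<gamma> ! j \<cdot> f) ` R (cs ! j)" using Rc[OF f(1) h(1)] by blast
      qed
    qed
    then show ?thesis using kdim_postcomp[OF R g] Suc by (simp add: r_def)
  qed
  then have "alt_sum (\<lambda>X. int (kdim C (R X))) cs = int (r 0) - (- 1) ^ (d + 2) * int (r (d + 2))"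
    using alt_sum_telescope[of "d + 2" "\<lambda>X. int (kdim C (R X))" cs "\<lambda>i. int (r i)"] len by simp
  moreover have "r (d + 2) = 0"
  proof -
    have "(\<lambda>f. \<gamma> ! (d + 1) \<cdot> f) ` R (cs ! (d + 1)) = {0}"
      unfolding z using Comp_zero_left[OF RH] R0 by force
    then show ?thesis by (simp add: r_def)
  qed
  ultimately show ?thesis by (simp add: r_def)
qed

text \<open>The long exact sequence of Hom(-, \<open>Y\<close>), cut off at both ends: inner ranks
  cancel in pairs and only those of the first and of the connecting morphism survive.\<close>

lemma angle_kdim_contravariant:
  assumes A: "(cs, \<gamma>) \<in> angles C"
  shows "alt_sum (\<lambda>X. int (kdim C (Hom C X Y))) (tl cs) =
    int (kdim C ((\<lambda>f. f \<cdot> \<gamma> ! 0) ` Hom C (cs ! 1) Y)) +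
    (- 1) ^ d * int (kdim C ((\<lambda>f. f \<cdot> \<gamma> ! (d + 1)) ` Hom C (\<Sigma>O C (cs ! 0)) Y))"
proof -
  note len = angle_length[OF A]
  let ?W = "\<lambda>i. (cs @ [\<Sigma>O C (cs ! 0)]) ! i"
  have ci: "?W i = cs ! i" if "i \<le> d + 1" for i using that len by (simp add: nth_append)
  define r where "r i = kdim C ((\<lambda>f. f \<cdot> \<gamma> ! i) ` Hom C (?W (Suc i)) Y)" for i
  have "int (kdim C (Hom C (tl cs ! i) Y)) = int (r i) + int (r (Suc i))" if "i < d + 1" for i
  proof -
    have i: "i \<le> d" using that by simp
    have t: "tl cs ! i = cs ! Suc i" "?W (Suc i) = cs ! Suc i" using i len ci[of "Suc i"] by (auto simp: nth_tl)
    have g0: "\<gamma> ! i \<in> Hom C (cs ! i) (cs ! Suc i)" using angle_Hom[OF A, of i] i t(2) by simp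
    have g: "\<gamma> ! Suc i \<in> Hom C (cs ! Suc i) (?W (Suc (Suc i)))" using angle_Hom[OF A, of "Suc i"] i by simp
    have "{f\<in>Hom C (cs ! Suc i) Y. f \<cdot> \<gamma> ! i = 0} = (\<lambda>f. f \<cdot> \<gamma> ! Suc i) ` Hom C (?W (Suc (Suc i))) Y"
    proof
      show "(\<lambda>f. f \<cdot> \<gamma> ! Suc i) ` Hom C (?W (Suc (Suc i))) Y \<subseteq> {f\<in>Hom C (cs ! Suc i) Y. f \<cdot> \<gamma> ! i = 0}"
        using Comp_closed[OF g] Comp_assoc'[OF g0 g] angle_comp_zero[OF A i] Comp_zero_right by auto
      show "{f\<in>Hom C (cs ! Suc i) Y. f \<cdot> \<gamma> ! i = 0} \<subseteq> (\<lambda>f. f \<cdot> \<gamma> ! Suc i) ` Hom C (?W (Suc (Suc i))) Y"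
      proof
        fix f assume "f \<in> {f\<in>Hom C (cs ! Suc i) Y. f \<cdot> \<gamma> ! i = 0}"
        then have f: "f \<in> Hom C (cs ! Suc i) Y" "f \<cdot> \<gamma> ! i = 0" by auto
        obtain g' where "g' \<in> Hom C (?W (i + 2)) Y" "f = g' \<cdot> \<gamma> ! Suc i"
          using angle_coexact[OF A i f] .
        then show "f \<in> (\<lambda>f. f \<cdot> \<gamma> ! Suc i) ` Hom C (?W (Suc (Suc i))) Y" by simp
      qed
    qed
    then show ?thesis using kdim_precomp[OF g0, of Y] t by (simp add: r_def)
  qed
  then have "alt_sum (\<lambda>X. int (kdim C (Hom C X Y))) (tl cs) = int (r 0) - (- 1) ^ (d + 1) * int (r (d + 1))"
    using alt_sum_telescope[of "d + 1" "\<lambda>X. int (kdim C (Hom C X Y))" "tl cs" "\<lambda>i. int (r i)"] len by simp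
  moreover have "?W (Suc 0) = cs ! 1" "?W (Suc (d + 1)) = \<Sigma>O C (cs ! 0)"
    using ci[of 1] len by (auto simp: nth_append)
  ultimately show ?thesis by (simp add: r_def)
qed

end

section \<open>Additive functions and the split Grothendieck group\<close>

text \<open>These functions are the homomorphisms from \<open>K0_split\<close> to the integers, seen
  on objects. Working with them avoids cosets until the c-vector has to be unfolded.\<close>

definition additive_on ::
  "('o, 'm::ab_group_add, 'k, 'z) lincat_scheme \<Rightarrow> 'o \<Rightarrow> ('o \<Rightarrow> int) \<Rightarrow> bool" where
  "additive_on C T \<mu> \<longleftrightarrow> (\<forall>X\<in>add_closure C T. \<forall>A B. is_dsum C X [A, B] \<longrightarrow> \<mu> X = \<mu> A + \<mu> B)"

definition free_eval :: "('a \<Rightarrow> int) \<Rightarrow> ('a \<Rightarrow>\<^sub>0 int) \<Rightarrow> int" where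
  "free_eval \<mu> x = (\<Sum>i\<in>Poly_Mapping.keys x. Poly_Mapping.lookup x i * \<mu> i)"

lemma free_eval_superset:
  assumes "finite S" "Poly_Mapping.keys x \<subseteq> S"
  shows "free_eval \<mu> x = (\<Sum>i\<in>S. Poly_Mapping.lookup x i * \<mu> i)"
  unfolding free_eval_def using assms by (intro sum.mono_neutral_left) (auto simp: in_keys_iff)

lemma free_eval_diff: "free_eval \<mu> (x - y) = free_eval \<mu> x - free_eval \<mu> y"
proof -
  let ?S = "Poly_Mapping.keys x \<union> Poly_Mapping.keys y"
  have S: "finite ?S" "Poly_Mapping.keys (x - y) \<subseteq> ?S" by (simp_all add: keys_diff)
  show ?thesis
    using free_eval_superset[OF S, of \<mu>] free_eval_superset[OF S(1), of x \<mu>]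
      free_eval_superset[OF S(1), of y \<mu>]
    by (simp add: lookup_minus algebra_simps sum_subtractf)
qed

lemma free_eval_0 [simp]: "free_eval \<mu> 0 = 0"
  by (simp add: free_eval_def)

lemma free_eval_add: "free_eval \<mu> (x + y) = free_eval \<mu> x + free_eval \<mu> y"
  using free_eval_diff[of \<mu> "x + y" y] by simp

lemma free_eval_frag_of [simp]: "free_eval \<mu> (frag_of a) = \<mu> a"
  by (simp add: free_eval_def keys_frag_of)

primrec alt_frag :: "'a list \<Rightarrow> ('a \<Rightarrow>\<^sub>0 int)" where
  "alt_frag [] = 0"
| "alt_frag (x # xs) = frag_of x - alt_frag xs"

lemma free_eval_alt_frag [simp]: "free_eval \<mu> (alt_frag xs) = alt_sum \<mu> xs"
  by (induction xs) (auto simp: free_eval_diff)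

lemma keys_alt_frag: "Poly_Mapping.keys (alt_frag xs) \<subseteq> set xs"
proof (induction xs)
  case (Cons x xs)
  then show ?case using keys_diff[of "frag_of x" "alt_frag xs"] by (auto simp: keys_frag_of)
qed simp

lemma alt_frag_conv_sum:
  "alt_frag xs = (\<Sum>i<length xs. frag_cmul ((- 1) ^ i) (frag_of (xs ! i)))"
proof (induction xs)
  case (Cons x xs)
  have "(\<Sum>i<length xs. frag_cmul ((- 1) ^ Suc i) (frag_of (xs ! i))) =
      - (\<Sum>i<length xs. frag_cmul ((- 1) ^ i) (frag_of (xs ! i)))"
    unfolding sum_negf[symmetric] by (intro sum.cong) auto
  then show ?case using Cons
    by (simp add: sum.lessThan_Suc_shift del: sum.lessThan_Suc power_Suc)
qed simp

lemma alt_sum_diff_fun: "alt_sum (\<lambda>x. f x - g x) xs = alt_sum f xs - alt_sum g xs"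
  by (induction xs) auto

lemma alt_sum_replicate_zero: "f z = 0 \<Longrightarrow> alt_sum f (replicate n z) = 0"
  by (induction n) auto

context additive_category
begin

lemma K0_relations_subgroup: "subgroup (K0_relations C T) (free_Abelian_group (add_closure C T))"
  unfolding K0_relations_def
proof (rule group.generate_is_subgroup)
  show "{frag_of t - (frag_of t0 + frag_of t1) |t t0 t1. t \<in> add_closure C T \<and>
      t0 \<in> add_closure C T \<and> t1 \<in> add_closure C T \<and> is_dsum C t [t0, t1]}
    \<subseteq> carrier (free_Abelian_group (add_closure C T))"
  proof (clarsimp simp del: frag_of_eq)
    fix t t0 t1 x
    assume "t \<in> add_closure C T" "t0 \<in> add_closure C T" "t1 \<in> add_closure C T"
      and x: "x \<in> Poly_Mapping.keys (frag_of t - (frag_of t0 + frag_of t1))"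
    then show "x \<in> add_closure C T"
      using keys_diff[of "frag_of t" "frag_of t0 + frag_of t1"] keys_add[of "frag_of t0" "frag_of t1"]
      by (auto simp: keys_frag_of)
  qed
qed simp

lemma K0_relations_keys: "x \<in> K0_relations C T \<Longrightarrow> Poly_Mapping.keys x \<subseteq> add_closure C T"
  using subsetD[OF subgroup.subset[OF K0_relations_subgroup]] carrier_free_Abelian_group_iff by metis

lemma K0_relations_zero: "0 \<in> K0_relations C T"
  using subgroup.one_closed[OF K0_relations_subgroup, of T] by simp

lemma K0_relations_add: "x \<in> K0_relations C T \<Longrightarrow> y \<in> K0_relations C T \<Longrightarrow> x + y \<in> K0_relations C T"
  using subgroup.m_closed[OF K0_relations_subgroup, of x T y] by simp

lemma K0_relations_minus: "x \<in> K0_relations C T \<Longrightarrow> - x \<in> K0_relations C T"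
  using subgroup.m_inv_closed[OF K0_relations_subgroup, of x T] K0_relations_keys[of x T] by simp

lemma K0_relations_diff: "x \<in> K0_relations C T \<Longrightarrow> y \<in> K0_relations C T \<Longrightarrow> x - y \<in> K0_relations C T"
  using K0_relations_add[of x T "- y"] K0_relations_minus by simp

lemma K0_relations_dsum:
  assumes "t \<in> add_closure C T" "is_dsum C t [t0, t1]"
  shows "frag_of t - (frag_of t0 + frag_of t1) \<in> K0_relations C T"
proof -
  have "t0 \<in> add_closure C T" "t1 \<in> add_closure C T" using add_closure_summands[OF assms] by auto
  then show ?thesis unfolding K0_relations_def using assms by (intro generate.incl) blast
qed

lemma K0_relations_zero_object:
  assumes "zero_object C Z"
  shows "frag_of Z \<in> K0_relations C T"
  using K0_relations_minus[OF K0_relations_dsum[OF add_closure_zero is_dsum_zero(1)]] assms by simp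

lemma K0_relations_isomorphic:
  assumes "X \<in> add_closure C T" "isomorphic C X Y"
  shows "frag_of X - frag_of Y \<in> K0_relations C T"
proof -
  obtain Z where Z: "zero_object C Z" using zero_object_exists by blast
  have "is_dsum C X [Y, Z]" using is_dsum_iso_left[OF is_dsum_zero(1)[OF Z]] isomorphic_sym[OF assms(2)] .
  then have "frag_of X - (frag_of Y + frag_of Z) + frag_of Z \<in> K0_relations C T"
    using K0_relations_dsum[OF assms(1)] K0_relations_zero_object[OF Z] K0_relations_add by blast
  then show ?thesis by (simp add: algebra_simps)
qed

lemma free_eval_K0_relations:
  assumes "additive_on C T \<mu>" "x \<in> K0_relations C T"
  shows "free_eval \<mu> x = 0"
proof -
  let ?G = "free_Abelian_group (add_closure C T)"
  have gen: "free_eval \<mu> h = 0"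
    if mem: "h \<in> {frag_of t - (frag_of t0 + frag_of t1) |t t0 t1. t \<in> add_closure C T \<and>
      t0 \<in> add_closure C T \<and> t1 \<in> add_closure C T \<and> is_dsum C t [t0, t1]}" for h
  proof -
    obtain t t0 t1 where h: "h = frag_of t - (frag_of t0 + frag_of t1)"
      and t: "t \<in> add_closure C T" "is_dsum C t [t0, t1]" using mem by blast
    have "\<mu> t = \<mu> t0 + \<mu> t1" using assms(1) t unfolding additive_on_def by blast
    then show ?thesis by (simp add: h free_eval_diff free_eval_add)
  qed
  have "x \<in> generate ?G {frag_of t - (frag_of t0 + frag_of t1) |t t0 t1. t \<in> add_closure C T \<and>
      t0 \<in> add_closure C T \<and> t1 \<in> add_closure C T \<and> is_dsum C t [t0, t1]}"
    using assms(2) unfolding K0_relations_def .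
  then show ?thesis
  proof (induction rule: generate.induct)
    case one
    then show ?case by simp
  next
    case (incl h)
    then show ?case by (rule gen)
  next
    case (inv h)
    then have "h \<in> K0_relations C T" unfolding K0_relations_def by (rule generate.incl)
    then have "inv\<^bsub>?G\<^esub> h = 0 - h" using K0_relations_keys[of h T] by simp
    then show ?case using gen[OF inv] free_eval_diff[of \<mu> 0 h] by simp
  next
    case (eng h1 h2)
    then show ?case by (simp add: free_eval_add)
  qed
qed

lemma additive_on_zero:
  assumes "additive_on C T \<mu>" "zero_object C Z"
  shows "\<mu> Z = 0"
proof -
  have "\<mu> Z = \<mu> Z + \<mu> Z"
    using assms(1) add_closure_zero[OF assms(2), of T] is_dsum_zero(1)[OF assms(2), of Z]
    unfolding additive_on_def by blast
  then show ?thesis by simp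
qed

lemma additive_on_iso:
  assumes "additive_on C T \<mu>" "X \<in> add_closure C T" "isomorphic C X Y"
  shows "\<mu> X = \<mu> Y"
proof -
  have "free_eval \<mu> (frag_of X - frag_of Y) = 0"
    by (rule free_eval_K0_relations[OF assms(1) K0_relations_isomorphic[OF assms(2,3)]])
  then show ?thesis by (simp add: free_eval_diff)
qed

text \<open>The two idempotents of a decomposition add up to the identity, so one of them is
  invertible, and then the other summand vanishes.\<close>

lemma local_End_indecomposable:
  assumes "local_End C X"
  shows "indecomposable C X"
  unfolding indecomposable_def
proof (intro conjI allI impI)
  show "\<not> zero_object C X" using assms unfolding local_End_def zero_object_def by blast
next
  fix A B assume "is_dsum C X [A, B]"
  then obtain \<iota> \<pi> where "dsum_data C X [A, B] \<iota> \<pi>" unfolding is_dsum_def by blast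
  note dd = this and D = dsum_data2D[OF this]
  have key: "zero_object C B'" if "dsum_data C X [A', B'] i p" and iso: "is_iso C X X (i 0 \<cdot> p 0)" for A' B' i p
  proof -
    note D = dsum_data2D[OF that(1)]
    obtain s where s: "s \<in> Hom C X X" "s \<cdot> (i 0 \<cdot> p 0) = idm C X" using iso unfolding is_iso_def by blast
    have "i 1 = s \<cdot> ((i 0 \<cdot> p 0) \<cdot> i 1)"
      using Comp_assoc[OF D(2) Comp_closed[OF D(3,1)] s(1)] s(2) idm_left[OF D(2)] by simp
    also have "\<dots> = 0" using Comp_assoc'[OF D(2,3,1)] D(1,7) s(1) by simp
    finally have "idm C B' = 0" using D(4,6) by simp
    then show ?thesis unfolding zero_object_def .
  qed
  have "is_iso C X X (\<iota> 0 \<cdot> \<pi> 0 + \<iota> 1 \<cdot> \<pi> 1)"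
    unfolding D(9) is_iso_def using idm_closed[of X] idm_left[OF idm_closed[of X]] by blast
  then have "is_iso C X X (\<iota> 0 \<cdot> \<pi> 0) \<or> is_iso C X X (\<iota> 1 \<cdot> \<pi> 1)"
    using assms Comp_closed[OF D(3,1)] Comp_closed[OF D(4,2)] unfolding local_End_def by blast
  then show "zero_object C A \<or> zero_object C B"
    using key[OF dd] key[OF dsum_data_swap[OF dd]] by auto
qed

lemma Krull_Schmidt_add_closure:
  assumes "Krull_Schmidt C" "X \<in> add_closure C T"
  obtains As where "is_dsum C X As" "set As \<subseteq> add_closure C T" "\<And>A. A \<in> set As \<Longrightarrow> local_End C A"
proof -
  obtain As where As: "is_dsum C X As" "\<forall>A\<in>set As. local_End C A"
    using assms(1) unfolding Krull_Schmidt_def by blast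
  show ?thesis by (rule that[OF As(1) add_closure_summands[OF assms(2) As(1)]]) (use As(2) in blast)
qed

lemma additive_on_eqI:
  assumes "Krull_Schmidt C" "additive_on C U \<mu>" "additive_on C U \<nu>"
    and eq: "\<And>v. v \<in> Indec C U \<Longrightarrow> \<mu> v = \<nu> v" and "X \<in> add_closure C U"
  shows "\<mu> X = \<nu> X"
proof -
  obtain As where As: "is_dsum C X As" "set As \<subseteq> add_closure C U" "\<And>A. A \<in> set As \<Longrightarrow> local_End C A"
    using Krull_Schmidt_add_closure[OF assms(1,5)] by blast
  show ?thesis using As assms(5)
  proof (induction As arbitrary: X)
    case Nil
    then have "zero_object C X" by (simp add: is_dsum_Nil_iff)
    then show ?case using additive_on_zero[OF assms(2)] additive_on_zero[OF assms(3)] by simp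
  next
    case (Cons A As)
    obtain Y Z where YZ: "is_dsum C X [Y, Z]" "is_dsum C Y [A]" "is_dsum C Z As"
      using is_dsum_split[of X "[A]" As] Cons.prems(1) by auto
    have in_add: "Y \<in> add_closure C U" "Z \<in> add_closure C U"
      using add_closure_summands[OF Cons.prems(4) YZ(1)] by auto
    have "local_End C Y"
      using local_End_iso[of A Y] YZ(2) Cons.prems(3) by (simp add: is_dsum_singleton_iff)
    then have "\<mu> Y = \<nu> Y" using eq[of Y] in_add(1) local_End_indecomposable unfolding Indec_def by blast
    moreover have "\<mu> Z = \<nu> Z" using Cons.IH[OF YZ(3) _ _ in_add(2)] Cons.prems(2,3) by simp
    ultimately show ?case using assms(2,3) YZ(1) Cons.prems(4) unfolding additive_on_def by simp
  qed
qed

end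

section \<open>Multiplicities of local objects detect the relations\<close>

context ks_angulated_category
begin

text \<open>Normal form modulo relations: every object is broken into local summands, and each of
  these is replaced by a chosen member of its isomorphism class.\<close>

lemma K0_relations_local_representatives:
  assumes "Poly_Mapping.keys x \<subseteq> add_closure C T"
  obtains y where "x - y \<in> K0_relations C T"
    "\<And>A. A \<in> Poly_Mapping.keys y \<Longrightarrow> A \<in> add_closure C T \<and> local_End C A"
    "\<And>A B. A \<in> Poly_Mapping.keys y \<Longrightarrow> B \<in> Poly_Mapping.keys y \<Longrightarrow> isomorphic C A B \<Longrightarrow> A = B"
proof -
  let ?L = "{A \<in> add_closure C T. local_End C A}"
  \<comment> \<open>Isomorphic objects define the same predicate \<open>isomorphic C A\<close>, so
    the choice depends on the isomorphism class only.\<close>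
  define rep where "rep A = (SOME B. isomorphic C A B)" for A
  have rep: "isomorphic C A (rep A)" for A
    unfolding rep_def by (rule someI[of _ A]) (rule isomorphic_refl)
  have rep_eq: "rep A = rep B" if "isomorphic C A B" for A B
  proof -
    have "isomorphic C A = isomorphic C B"
      using that isomorphic_trans isomorphic_sym by blast
    then show ?thesis unfolding rep_def by simp
  qed
  have repL: "rep A \<in> ?L" if "A \<in> ?L" for A
    using that rep add_closure_iso local_End_iso by blast
  have rep_inj: "A = B" if mem: "A \<in> rep ` ?L" "B \<in> rep ` ?L" and iso: "isomorphic C A B" for A B
  proof -
    obtain A' B' where "A = rep A'" "B = rep B'" using mem by blast
    then have "isomorphic C A' B'" using iso rep isomorphic_trans isomorphic_sym by metis
    then show ?thesis using rep_eq \<open>A = rep A'\<close> \<open>B = rep B'\<close> by simp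
  qed
  have list: "\<exists>y. Poly_Mapping.keys y \<subseteq> rep ` ?L \<and> frag_of X - y \<in> K0_relations C T"
    if "is_dsum C X As" "set As \<subseteq> ?L" "X \<in> add_closure C T" for X As
    using that
  proof (induction As arbitrary: X)
    case Nil
    then have "frag_of X - 0 \<in> K0_relations C T"
      using K0_relations_zero_object is_dsum_Nil_iff by simp
    then show ?case by (intro exI[of _ 0]) simp
  next
    case (Cons A As)
    obtain Y Z where YZ: "is_dsum C X [Y, Z]" "is_dsum C Y [A]" "is_dsum C Z As"
      using is_dsum_split[of X "[A]" As] Cons.prems(1) by auto
    have in_add: "Y \<in> add_closure C T" "Z \<in> add_closure C T"
      using add_closure_summands[OF Cons.prems(3) YZ(1)] by auto
    obtain y where y: "Poly_Mapping.keys y \<subseteq> rep ` ?L" "frag_of Z - y \<in> K0_relations C T"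
      using Cons.IH[OF YZ(3) _ in_add(2)] Cons.prems(2) by auto
    have "isomorphic C Y (rep A)"
      using YZ(2) rep isomorphic_trans isomorphic_sym by (metis is_dsum_singleton_iff)
    then have "frag_of Y - frag_of (rep A) \<in> K0_relations C T"
      using K0_relations_isomorphic in_add(1) by blast
    then have "(frag_of X - (frag_of Y + frag_of Z)) + ((frag_of Y - frag_of (rep A)) + (frag_of Z - y))
        \<in> K0_relations C T"
      using K0_relations_dsum[OF Cons.prems(3) YZ(1)] y(2) by (intro K0_relations_add)
    then have "frag_of X - (frag_of (rep A) + y) \<in> K0_relations C T" by (simp add: algebra_simps)
    moreover have "Poly_Mapping.keys (frag_of (rep A) + y) \<subseteq> rep ` ?L"
      using keys_add[of "frag_of (rep A)" y] y(1) Cons.prems(2) by (auto simp: keys_frag_of)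
    ultimately show ?case by blast
  qed
  have "\<exists>y. Poly_Mapping.keys y \<subseteq> rep ` ?L \<and> x - y \<in> K0_relations C T"
    using assms
  proof (induction rule: frag_induction)
    case zero
    then show ?case using K0_relations_zero by (intro exI[of _ 0]) simp
  next
    case (one X)
    obtain As where As: "is_dsum C X As" "set As \<subseteq> add_closure C T" "\<And>A. A \<in> set As \<Longrightarrow> local_End C A"
      using Krull_Schmidt_add_closure[OF Krull_Schmidt one] by blast
    have "set As \<subseteq> ?L" using As(2,3) by blast
    then show ?case using list[OF As(1) _ one] by blast
  next
    case (diff a b)
    then obtain y z where y: "Poly_Mapping.keys y \<subseteq> rep ` ?L" "a - y \<in> K0_relations C T"
      and z: "Poly_Mapping.keys z \<subseteq> rep ` ?L" "b - z \<in> K0_relations C T" by blast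
    have "(a - b) - (y - z) \<in> K0_relations C T"
      using K0_relations_diff[OF y(2) z(2)] by (simp add: algebra_simps)
    moreover have "Poly_Mapping.keys (y - z) \<subseteq> rep ` ?L" using keys_diff[of y z] y(1) z(1) by blast
    ultimately show ?case by blast
  qed
  then obtain y where y: "Poly_Mapping.keys y \<subseteq> rep ` ?L" "x - y \<in> K0_relations C T" by blast
  show ?thesis
  proof (rule that[OF y(2)])
    show "A \<in> add_closure C T \<and> local_End C A" if "A \<in> Poly_Mapping.keys y" for A
      using subsetD[OF y(1) that] repL by auto
    show "A = B" if "A \<in> Poly_Mapping.keys y" "B \<in> Poly_Mapping.keys y" "isomorphic C A B" for A B
      by (rule rep_inj[OF subsetD[OF y(1)] subsetD[OF y(1)]]) (rule that)+
  qed
qed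

text \<open>For local \<open>s\<close>, the dimension of the quotient of Hom(s,X) by its radical:
  the multiplicity of \<open>s\<close> in \<open>X\<close> times the dimension of the residue
  division algebra of \<open>s\<close>. That factor is positive, which suffices for detecting
  zero.\<close>

definition top_mult :: "'o \<Rightarrow> 'o \<Rightarrow> int" where
  "top_mult s X = int (kdim C (Hom C s X)) - int (kdim C (Hom_rad C s X))"

lemma top_mult_self:
  assumes "local_End C s"
  shows "top_mult s s > 0"
proof -
  have "is_iso C s s (idm C s \<cdot> idm C s)"
    using idm_closed[of s] idm_left[OF idm_closed[of s]] unfolding is_iso_def by auto
  then have "idm C s \<notin> Hom_rad C s s"
    using idm_closed[of s] unfolding Hom_rad_def by blast
  moreover have "Hom_rad C s s \<subseteq> Hom C s s" unfolding Hom_rad_def by blast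
  ultimately have "Hom_rad C s s \<subset> Hom C s s" using idm_closed[of s] by blast
  moreover have "vs.subspace (Hom_rad C s s)"
    using covariant_subfunctor_Hom_rad[OF assms] unfolding covariant_subfunctor_def by blast
  moreover obtain B where "finite B" "Hom C s s \<subseteq> vs.span B" using Hom_spanned .
  ultimately have "kdim C (Hom_rad C s s) < kdim C (Hom C s s)"
    by (intro vs.dim_psubset_subspace)
  then show ?thesis unfolding top_mult_def by simp
qed

lemma top_mult_local:
  assumes "local_End C s" "local_End C s'" "\<not> isomorphic C s s'"
  shows "top_mult s s' = 0"
proof -
  have "Hom_rad C s s' = Hom C s s'"
    using local_End_retract[OF assms(1,2)] assms(3) unfolding Hom_rad_def by blast
  then show ?thesis unfolding top_mult_def by simp
qed

lemma additive_on_top_mult: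
  assumes "local_End C s"
  shows "additive_on C T (top_mult s)"
  unfolding additive_on_def top_mult_def
  using kdim_covariant_dsum[OF covariant_subfunctor_Hom]
    kdim_covariant_dsum[OF covariant_subfunctor_Hom_rad[OF assms]] by auto

text \<open>On a normal form \<open>top_mult s\<close> vanishes at every key but \<open>s\<close>
  itself, so each evaluation isolates one coefficient. Membership in the relations thereby becomes a
  question about dimensions.\<close>

lemma K0_relations_detect:
  assumes "Poly_Mapping.keys x \<subseteq> add_closure C T"
    and eval: "\<And>s. s \<in> add_closure C T \<Longrightarrow> local_End C s \<Longrightarrow> free_eval (top_mult s) x = 0"
  shows "x \<in> K0_relations C T"
proof -
  obtain y where y: "x - y \<in> K0_relations C T"
    "\<And>A. A \<in> Poly_Mapping.keys y \<Longrightarrow> A \<in> add_closure C T \<and> local_End C A"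
    "\<And>A B. A \<in> Poly_Mapping.keys y \<Longrightarrow> B \<in> Poly_Mapping.keys y \<Longrightarrow> isomorphic C A B \<Longrightarrow> A = B"
    using K0_relations_local_representatives[OF assms(1)] by blast
  have "Poly_Mapping.keys y = {}"
  proof (rule ccontr)
    assume "Poly_Mapping.keys y \<noteq> {}"
    then obtain s where s: "s \<in> Poly_Mapping.keys y" by blast
    then have locs: "local_End C s" and sT: "s \<in> add_closure C T" using y(2) by auto
    have "free_eval (top_mult s) y = 0"
      using free_eval_K0_relations[OF additive_on_top_mult[OF locs] y(1)] eval[OF sT locs]
      by (simp add: free_eval_diff)
    moreover have "free_eval (top_mult s) y =
        (\<Sum>i\<in>Poly_Mapping.keys y. if i = s then Poly_Mapping.lookup y s * top_mult s s else 0)"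
      unfolding free_eval_def
      using top_mult_local[OF locs] y(2,3)[OF s] y(2) by (intro sum.cong) auto
    ultimately have "Poly_Mapping.lookup y s * top_mult s s = 0" using s by simp
    then show False using top_mult_self[OF locs] s by (auto simp: in_keys_iff)
  qed
  then show ?thesis using y(1) by simp
qed

section \<open>The index\<close>

text \<open>Rigidity kills the connecting morphism, so the dimension count for split angles applies
  to Hom(s,-) and to its radical, and hence to their difference.\<close>

lemma alt_frag_angle:
  assumes A: "angle_objects cs" and cs: "set cs \<subseteq> add_closure C T"
    and rigid: "\<And>X Y. X \<in> add_closure C T \<Longrightarrow> Y \<in> add_closure C T \<Longrightarrow> Hom C X (\<Sigma>O C Y) = {0}"
  shows "alt_frag cs \<in> K0_relations C T"
proof (rule K0_relations_detect)
  show "Poly_Mapping.keys (alt_frag cs) \<subseteq> add_closure C T" using keys_alt_frag[of cs] cs by blast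
  obtain \<gamma> where \<gamma>: "(cs, \<gamma>) \<in> angles C" using A unfolding angle_objects_def by blast
  have len: "length cs = d + 2" using angle_length[OF \<gamma>] by blast
  have "cs ! (d + 1) \<in> add_closure C T" "cs ! 0 \<in> add_closure C T" using cs len by (auto simp: subset_iff)
  then have z: "\<gamma> ! (d + 1) = 0" using angle_Hom_start(2)[OF \<gamma>] rigid by blast
  show "free_eval (top_mult s) (alt_frag cs) = 0" if "local_End C s" for s
    using split_angle_kdim[OF \<gamma> z covariant_subfunctor_Hom, of s]
      split_angle_kdim[OF \<gamma> z covariant_subfunctor_Hom_rad[OF that]]
    by (simp add: top_mult_def[abs_def] alt_sum_diff_fun)
qed

text \<open>The terms of \<open>ys\<close> move one place to the right in the spliced angle, hence
  the minus sign. Three functions are allowed because a resolution over T may be measured by \<mu>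
  while the other angle is measured by the index.\<close>

lemma alt_sum_splice:
  assumes "length xs = d" "length ys = d" "length ws = d"
    and "\<And>j. j < d \<Longrightarrow> f (ws ! j) = g ((tl xs @ [x]) ! j) + h (ys ! j)"
    and "f (hd xs) = g (hd xs)" "f y = h y"
  shows "alt_sum f (hd xs # ws @ [y]) = alt_sum g (xs @ [x]) - alt_sum h (ys @ [y])"
proof -
  have "xs \<noteq> []" using assms(1) d_pos by auto
  then have xs: "xs @ [x] = hd xs # (tl xs @ [x])" by simp
  have "alt_sum f ws = alt_sum g (tl xs @ [x]) + alt_sum h ys"
    using assms(1-4) d_pos by (intro alt_sum_add) auto
  then show ?thesis
    unfolding xs using assms(2,3,5,6) by (simp add: alt_sum_append)
qed

text \<open>The functional \<mu> applied to the index. The resolution is an arbitrary choice,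
  justified for additive \<mu> by \<open>index_fun_eq\<close>.\<close>

definition index_fun :: "'o \<Rightarrow> ('o \<Rightarrow> int) \<Rightarrow> 'o \<Rightarrow> int" where
  "index_fun T \<mu> c = alt_sum \<mu> (SOME ts. T_resolution C d T c ts)"

lemma T_resolution_iff:
  "T_resolution C d T c ts \<longleftrightarrow> length ts = d + 1 \<and> set ts \<subseteq> add_closure C T \<and> angle_objects (rev ts @ [c])"
  unfolding T_resolution_def angle_objects_def by blast

end

locale cluster_tilting_category = ks_angulated_category C d
  for C :: "('o, 'm::ab_group_add, 'k::field, 'z) angcat_scheme" (structure) and d :: nat +
  fixes T :: 'o
  assumes cluster_tilting: "cluster_tilting C d T"
begin

lemma rigid: "X \<in> add_closure C T \<Longrightarrow> Y \<in> add_closure C T \<Longrightarrow> Hom C X (\<Sigma>O C Y) = {0}"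
  using cluster_tilting unfolding cluster_tilting_def by blast

lemma resolution_exists: obtains ts where "T_resolution C d T c ts"
  using cluster_tilting unfolding cluster_tilting_def by blast

lemma resolution_split:
  assumes "T_resolution C d T c ts"
  obtains xs x where "rev ts = xs @ [x]" "length xs = d" "set xs \<subseteq> add_closure C T" "x \<in> add_closure C T"
    "angle_objects (xs @ [x, c])" "hd xs \<in> add_closure C T"
    "\<And>j. j < d \<Longrightarrow> (tl xs @ [x]) ! j \<in> add_closure C T"
proof -
  have l: "length ts = d + 1" "set ts \<subseteq> add_closure C T" "angle_objects (rev ts @ [c])"
    using assms unfolding T_resolution_iff by auto
  then have ne: "rev ts \<noteq> []" by auto
  then have e: "rev ts = butlast (rev ts) @ [last (rev ts)]"
    by (rule append_butlast_last_id[symmetric])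
  let ?xs = "butlast (rev ts)" and ?x = "last (rev ts)"
  have lx: "length ?xs = d" using l(1) by simp
  then have nx: "?xs \<noteq> []" using d_pos by (metis less_irrefl list.size(3))
  have sub: "set ?xs \<subseteq> add_closure C T" "?x \<in> add_closure C T"
    using l(2) last_in_set[OF ne] in_set_butlastD[of _ "rev ts"] by auto
  moreover have "angle_objects (?xs @ [?x, c])"
    using l(3) e by (metis append.assoc append_Cons append_Nil)
  moreover have "(tl ?xs @ [?x]) ! j \<in> add_closure C T" if "j < d" for j
  proof -
    have "(tl ?xs @ [?x]) ! j \<in> set (tl ?xs @ [?x])" by (rule nth_mem) (use that l(1) in simp)
    then show ?thesis using sub list.set_sel(2)[OF nx] by auto
  qed
  moreover have "hd ?xs \<in> add_closure C T" using sub(1) hd_in_set[OF nx] by blast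
  ultimately show ?thesis using that[OF e lx] by blast
qed

lemma splice:
  assumes X: "angle_objects (xs @ [x, c])" and Y: "angle_objects (ys @ [y, c])"
    and "x \<in> add_closure C T" "ys ! 0 \<in> add_closure C T"
  obtains ws where "length ws = d" "angle_objects (hd xs # ws @ [y])"
    "\<And>j. j < d \<Longrightarrow> is_dsum C (ws ! j) [(tl xs @ [x]) ! j, ys ! j]"
proof -
  have "ys \<noteq> []" using angle_objects_length[OF Y] d_pos by auto
  then have "Hom C x (\<Sigma>O C (hd ys)) = {0}" using rigid assms(3,4) by (simp add: hd_conv_nth)
  then show ?thesis using angle_objects_splice[OF X Y] that by blast
qed

lemma resolution_unique:
  assumes "T_resolution C d T c ts" "T_resolution C d T c ts'"
  shows "alt_frag ts - alt_frag ts' \<in> K0_relations C T"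
proof -
  obtain xs x where X: "rev ts = xs @ [x]" "length xs = d" "set xs \<subseteq> add_closure C T"
    "x \<in> add_closure C T" "angle_objects (xs @ [x, c])" "hd xs \<in> add_closure C T"
    "\<And>j. j < d \<Longrightarrow> (tl xs @ [x]) ! j \<in> add_closure C T"
    by (rule resolution_split[OF assms(1)]) (rule that)
  obtain ys y where Y: "rev ts' = ys @ [y]" "length ys = d" "set ys \<subseteq> add_closure C T"
    "y \<in> add_closure C T" "angle_objects (ys @ [y, c])"
    by (rule resolution_split[OF assms(2)]) (rule that)
  have "ys ! 0 \<in> add_closure C T" using Y(2,3) d_pos by (auto simp: subset_iff)
  then obtain ws where W: "length ws = d" "angle_objects (hd xs # ws @ [y])"
    "\<And>j. j < d \<Longrightarrow> is_dsum C (ws ! j) [(tl xs @ [x]) ! j, ys ! j]"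
    using splice[OF X(5) Y(5) X(4)] by blast
  have ysT: "ys ! j \<in> add_closure C T" if "j < d" for j
    using that Y(2,3) by (auto simp: subset_iff)
  have wsT: "ws ! j \<in> add_closure C T" if "j < d" for j
    using add_closure_dsum2[OF X(7)[OF that] ysT[OF that] W(3)[OF that]] .
  then have "set ws \<subseteq> add_closure C T" using W(1) by (auto simp: in_set_conv_nth)
  then have all: "set (hd xs # ws @ [y]) \<subseteq> add_closure C T" using X(6) Y(4) by auto
  show ?thesis
  proof (rule K0_relations_detect)
    show "Poly_Mapping.keys (alt_frag ts - alt_frag ts') \<subseteq> add_closure C T"
      using keys_diff[of "alt_frag ts" "alt_frag ts'"] keys_alt_frag[of ts] keys_alt_frag[of ts']
        assms unfolding T_resolution_def by blast
    fix s assume s: "local_End C s"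
    note add = additive_on_top_mult[OF s, of T]
    have "alt_sum (top_mult s) (hd xs # ws @ [y]) = 0"
      using free_eval_K0_relations[OF add alt_frag_angle[OF W(2) all rigid]]
      by (simp only: free_eval_alt_frag)
    moreover have "top_mult s (ws ! j) = top_mult s ((tl xs @ [x]) ! j) + top_mult s (ys ! j)" if "j < d" for j
      using add wsT[OF that] W(3)[OF that] unfolding additive_on_def by blast
    ultimately have "alt_sum (top_mult s) (rev ts) = alt_sum (top_mult s) (rev ts')"
      using alt_sum_splice[OF X(2) Y(2) W(1), of "top_mult s" "top_mult s" x "top_mult s" y] X(1) Y(1) by simp
    \<comment> \<open>Equal lengths, so reversal changes both alternating sums by the same
      sign.\<close>
    moreover have "length ts = length ts'" using assms unfolding T_resolution_def by simp
    ultimately show "free_eval (top_mult s) (alt_frag ts - alt_frag ts') = 0"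
      by (simp add: free_eval_diff alt_sum_rev)
  qed
qed

lemma index_fun_eq:
  assumes "additive_on C T \<mu>" "T_resolution C d T c ts"
  shows "index_fun T \<mu> c = alt_sum \<mu> ts"
proof -
  have "T_resolution C d T c (SOME ts. T_resolution C d T c ts)"
    by (rule someI[where P = "T_resolution C d T c", OF assms(2)])
  then have "free_eval \<mu> (alt_frag (SOME ts. T_resolution C d T c ts) - alt_frag ts) = 0"
    using free_eval_K0_relations[OF assms(1)] resolution_unique assms(2) by blast
  then show ?thesis by (simp add: index_fun_def free_eval_diff)
qed

lemma index_fun_self:
  assumes \<mu>: "additive_on C T \<mu>" and t: "t \<in> add_closure C T"
  shows "index_fun T \<mu> t = \<mu> t"
proof -
  \<comment> \<open>The trivial angle is padded with the shift of \<open>Z\<close>, so that rotating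
    it back yields the resolution of \<open>t\<close> by itself followed by copies of
    \<open>Z\<close>.\<close>
  obtain Z where Z: "zero_object C Z" "zero_object C (\<Sigma>O C Z)" using zero_\<Sigma>_zero .
  have "angle_objects ([t, t] @ map (\<Sigma>O C) (replicate d Z))"
    using N1_trivial[OF Z(2), of t] unfolding angle_objects_def by auto
  then have "angle_objects (replicate d Z @ [t, t])"
    using angle_objects_rotate[of "replicate d Z" "[t, t]"] by simp
  then have "T_resolution C d T t (t # replicate d Z)"
    unfolding T_resolution_iff using t add_closure_zero[OF Z(1), of T] by auto
  then have "index_fun T \<mu> t = alt_sum \<mu> (t # replicate d Z)" by (rule index_fun_eq[OF \<mu>])
  then show ?thesis using alt_sum_replicate_zero[of \<mu> Z] additive_on_zero[OF \<mu> Z(1)] by simp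
qed

lemma index_fun_dsum:
  assumes \<mu>: "additive_on C T \<mu>" and D: "is_dsum C X [A, B]"
  shows "index_fun T \<mu> X = index_fun T \<mu> A + index_fun T \<mu> B"
proof -
  obtain as bs where A: "T_resolution C d T A as" and B: "T_resolution C d T B bs"
    using resolution_exists by metis
  have lens: "length as = d + 1" "length bs = d + 1" and angs: "angle_objects (rev as @ [A])" "angle_objects (rev bs @ [B])"
    and sub: "set as \<subseteq> add_closure C T" "set bs \<subseteq> add_closure C T"
    using A B unfolding T_resolution_iff by auto
  have "\<exists>W. \<forall>i. is_dsum C (W i) [as ! i, bs ! i]" using dsum_exists by (intro choice allI)
  then obtain W where W: "\<And>i. is_dsum C (W i) [as ! i, bs ! i]" by blast
  define ws where "ws = map W [0..<d + 1]"
  have lw: "length ws = d + 1" unfolding ws_def by simp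
  have wsi: "is_dsum C (ws ! i) [as ! i, bs ! i]" if "i < d + 1" for i
    using W[of i] that unfolding ws_def by (simp del: upt_Suc)
  have wT: "ws ! i \<in> add_closure C T" if "i < d + 1" for i
    by (rule add_closure_dsum2[OF _ _ wsi[OF that]]) (use sub lens that in \<open>auto simp: subset_iff\<close>)
  have "angle_objects (rev ws @ [X])"
  proof (rule angle_objects_dsum[OF angs])
    show "length (rev ws @ [X]) = d + 2" using lw by simp
    show "is_dsum C ((rev ws @ [X]) ! i) [(rev as @ [A]) ! i, (rev bs @ [B]) ! i]" if "i \<le> d + 1" for i
      using that lens lw wsi[of "d - i"] D by (cases "i = d + 1") (auto simp: nth_append rev_nth)
  qed
  then have "T_resolution C d T X ws"
    unfolding T_resolution_iff using lw wT by (auto simp: in_set_conv_nth)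
  moreover have "alt_sum \<mu> ws = alt_sum \<mu> as + alt_sum \<mu> bs"
    using wsi wT \<mu> lens lw unfolding additive_on_def by (intro alt_sum_add) auto
  ultimately show ?thesis using index_fun_eq[OF \<mu>] A B by simp
qed

text \<open>Splicing the last object of an angle with its resolution yields an angle whose alternating
  sum of indices is the negative, and which starts with one more object of \<open>add(T)\<close>. After
  finitely many steps all objects lie in \<open>add(T)\<close>.\<close>

lemma index_fun_angle:
  assumes \<mu>: "additive_on C T \<mu>" and "angle_objects cs" "hd cs \<in> add_closure C T"
  shows "alt_sum (index_fun T \<mu>) cs = 0"
proof -
  \<comment> \<open>Downward induction on the number \<open>k\<close> of leading objects known to
    lie in add(T); for \<open>k = d + 2\<close> the angle is split.\<close>
  have "alt_sum (index_fun T \<mu>) cs = 0"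
    if "angle_objects cs" "\<forall>i<k. cs ! i \<in> add_closure C T" "1 \<le> k" "k \<le> d + 2" for k cs
    using that(4,1,2,3)
  proof (induction k arbitrary: cs rule: inc_induct)
    case base
    then have "set cs \<subseteq> add_closure C T" using angle_objects_length by (auto simp: in_set_conv_nth)
    then show ?case
      using free_eval_K0_relations[OF \<mu> alt_frag_angle[OF base(1) _ rigid]] index_fun_self[OF \<mu>]
        alt_sum_cong[of cs "index_fun T \<mu>" \<mu>] by auto
  next
    case (step k)
    have len: "length cs = d + 2" using angle_objects_length step.prems(1) by blast
    define ys where "ys = take d cs"
    have "cs = take d cs @ drop d cs" by simp
    also have "drop d cs = [cs ! d, cs ! (d + 1)]"
      using len by (simp add: Cons_nth_drop_Suc[symmetric])
    finally have cs: "cs = ys @ [cs ! d, cs ! (d + 1)]" unfolding ys_def .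
    have ly: "length ys = d" using len unfolding ys_def by simp
    have ysi: "ys ! j = cs ! j" if "j < d" for j using that unfolding ys_def by simp
    let ?y = "cs ! d" and ?c = "cs ! (d + 1)"
    obtain ts where ts: "T_resolution C d T ?c ts" using resolution_exists .
    obtain xs x where X: "rev ts = xs @ [x]" "length xs = d" "set xs \<subseteq> add_closure C T"
      "x \<in> add_closure C T" "angle_objects (xs @ [x, ?c])" and hx: "hd xs \<in> add_closure C T"
      and xsT: "\<And>j. j < d \<Longrightarrow> (tl xs @ [x]) ! j \<in> add_closure C T"
      by (rule resolution_split[OF ts]) (rule that)
    have "ys ! 0 \<in> add_closure C T" using ysi[of 0] d_pos step.prems by simp
    then obtain ws where W: "length ws = d" "angle_objects (hd xs # ws @ [?y])"
      "\<And>j. j < d \<Longrightarrow> is_dsum C (ws ! j) [(tl xs @ [x]) ! j, ys ! j]"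
      using splice[OF X(5) _ X(4), of ys ?y] step.prems(1) cs by metis
    \<comment> \<open>Object \<open>Suc j\<close> of the new angle is object \<open>j\<close> of the
      old one, summed with an object of add(T) when \<open>j < d\<close>, and \<open>hd xs\<close>
      is added in front; so one more leading object lies in add(T).\<close>
    have "(hd xs # ws @ [?y]) ! i \<in> add_closure C T" if i: "i < Suc k" for i
    proof (cases i)
      case 0
      then show ?thesis using hx by simp
    next
      case (Suc j)
      then have jk: "j < k" "j \<le> d" using i step.hyps by auto
      show ?thesis
      proof (cases "j < d")
        case True
        then show ?thesis
          using Suc W(1) add_closure_dsum2[OF xsT[OF True] _ W(3)[OF True]] ysi[OF True] step.prems(2) jk(1)
          by (simp add: nth_append)
      next
        case False
        then show ?thesis using Suc W(1) jk step.prems(2) by (simp add: nth_append)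
      qed
    qed
    then have "alt_sum (index_fun T \<mu>) (hd xs # ws @ [?y]) = 0"
      using step.IH[OF W(2)] by simp
    moreover have "alt_sum (index_fun T \<mu>) (hd xs # ws @ [?y]) =
        alt_sum \<mu> (xs @ [x]) - alt_sum (index_fun T \<mu>) (ys @ [?y])"
      using index_fun_dsum[OF \<mu> W(3)] index_fun_self[OF \<mu>] xsT hx
      by (intro alt_sum_splice[OF X(2) ly W(1)]) auto
    \<comment> \<open>The index lists a resolution from its end at \<open>?c\<close>, the angle from
      its beginning; reversing \<open>d + 1\<close> terms costs this sign.\<close>
    moreover have "index_fun T \<mu> ?c = (- 1) ^ d * alt_sum \<mu> (xs @ [x])"
    proof -
      have "length ts = d + 1" using ts unfolding T_resolution_def by simp
      then have "alt_sum \<mu> (xs @ [x]) = (- 1) ^ d * alt_sum \<mu> ts"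
        using alt_sum_rev[of \<mu> ts] X(1) by simp
      then show ?thesis using index_fun_eq[OF \<mu> ts] by (simp flip: power_add mult.assoc)
    qed
    moreover have "alt_sum (index_fun T \<mu>) cs =
        alt_sum (index_fun T \<mu>) (ys @ [?y]) + (- 1) ^ (d + 1) * index_fun T \<mu> ?c"
      using ly by (subst cs) (simp add: alt_sum_append algebra_simps)
    ultimately show ?case by (simp flip: power_add mult.assoc)
  qed
  from this[of cs 1] show ?thesis using assms(2,3) angle_objects_length[OF assms(2)]
    by (cases cs) auto
qed

end

section \<open>Homomorphisms on the split Grothendieck group\<close>

context additive_category
begin

lemma K0_relations_normal: "K0_relations C T \<lhd> free_Abelian_group (add_closure C T)"
  by (rule comm_group.subgroup_imp_normal[OF abelian_free_Abelian_group K0_relations_subgroup])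

lemma K0_class_carrier:
  "Poly_Mapping.keys x \<subseteq> add_closure C T \<Longrightarrow> K0_class C T x \<in> carrier (K0_split C T)"
  unfolding K0_split_def K0_class_def FactGroup_def RCOSETS_def by auto

lemma K0_split_carrierE:
  assumes "c \<in> carrier (K0_split C T)"
  obtains x where "Poly_Mapping.keys x \<subseteq> add_closure C T" "c = K0_class C T x"
  using assms unfolding K0_split_def K0_class_def FactGroup_def RCOSETS_def by auto

lemma K0_class_add:
  assumes "Poly_Mapping.keys x \<subseteq> add_closure C T" "Poly_Mapping.keys y \<subseteq> add_closure C T"
  shows "K0_class C T (x + y) = K0_class C T x \<otimes>\<^bsub>K0_split C T\<^esub> K0_class C T y"
  using normal.rcos_sum[OF K0_relations_normal, of x T y] assms
  unfolding K0_class_def K0_split_def FactGroup_def by simp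

lemma K0_class_eq_iff:
  assumes "Poly_Mapping.keys x \<subseteq> add_closure C T" "Poly_Mapping.keys y \<subseteq> add_closure C T"
  shows "K0_class C T x = K0_class C T y \<longleftrightarrow> x - y \<in> K0_relations C T"
proof
  assume "K0_class C T x = K0_class C T y"
  moreover have "x \<in> K0_class C T x"
    unfolding K0_class_def r_coset_def using K0_relations_zero by force
  ultimately obtain r where "r \<in> K0_relations C T" "x = r + y"
    unfolding K0_class_def r_coset_def by auto
  then show "x - y \<in> K0_relations C T" by simp
next
  assume r: "x - y \<in> K0_relations C T"
  have "\<exists>h\<in>K0_relations C T. h' + x = h + y" if "h' \<in> K0_relations C T" for h'
    by (rule bexI[of _ "h' + (x - y)"]) (use K0_relations_add[OF that r] in simp_all)
  moreover have "\<exists>h\<in>K0_relations C T. h' + y = h + x" if "h' \<in> K0_relations C T" for h'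
    by (rule bexI[of _ "h' - (x - y)"]) (use K0_relations_diff[OF that r] in simp_all)
  ultimately show "K0_class C T x = K0_class C T y"
    unfolding K0_class_def r_coset_def by fastforce
qed

lemma dual_group_additive:
  assumes "\<chi> \<in> dual_group (K0_split C T)"
  shows "additive_on C T (\<lambda>X. \<chi> (K0_class C T (frag_of X)))"
    and "Poly_Mapping.keys x \<subseteq> add_closure C T \<Longrightarrow>
      \<chi> (K0_class C T x) = free_eval (\<lambda>X. \<chi> (K0_class C T (frag_of X))) x"
proof -
  have add: "\<chi> (K0_class C T (x + y)) = \<chi> (K0_class C T x) + \<chi> (K0_class C T y)"
    if "Poly_Mapping.keys x \<subseteq> add_closure C T" "Poly_Mapping.keys y \<subseteq> add_closure C T" for x y
    using assms K0_class_add[OF that] K0_class_carrier[OF that(1)] K0_class_carrier[OF that(2)]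
    unfolding dual_group_def hom_def integer_group_def by simp
  have frag: "Poly_Mapping.keys (frag_of X) \<subseteq> add_closure C T" if "X \<in> add_closure C T" for X
    using that by (simp add: keys_frag_of)
  show "additive_on C T (\<lambda>X. \<chi> (K0_class C T (frag_of X)))"
    unfolding additive_on_def
  proof (intro ballI allI impI)
    fix X A B assume X: "X \<in> add_closure C T" and D: "is_dsum C X [A, B]"
    then have AB: "A \<in> add_closure C T" "B \<in> add_closure C T" using add_closure_summands[OF X D] by auto
    then have keys: "Poly_Mapping.keys (frag_of A + frag_of B) \<subseteq> add_closure C T"
      using keys_add[of "frag_of A" "frag_of B"] by (auto simp: keys_frag_of)
    have "K0_class C T (frag_of X) = K0_class C T (frag_of A + frag_of B)"
      using K0_class_eq_iff[OF frag[OF X] keys] K0_relations_dsum[OF X D] by simp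
    then show "\<chi> (K0_class C T (frag_of X)) = \<chi> (K0_class C T (frag_of A)) + \<chi> (K0_class C T (frag_of B))"
      using add[OF frag[OF AB(1)] frag[OF AB(2)]] by simp
  qed
  have zero: "\<chi> (K0_class C T 0) = 0" using add[of 0 0] by simp
  show "\<chi> (K0_class C T x) = free_eval (\<lambda>X. \<chi> (K0_class C T (frag_of X))) x"
    if "Poly_Mapping.keys x \<subseteq> add_closure C T"
  proof -
    have "Poly_Mapping.keys x \<subseteq> add_closure C T \<and>
        \<chi> (K0_class C T x) = free_eval (\<lambda>X. \<chi> (K0_class C T (frag_of X))) x"
      using that
    proof (induction rule: frag_induction)
      case (diff a b)
      then have keys: "Poly_Mapping.keys (a - b) \<subseteq> add_closure C T" using keys_diff[of a b] by blast
      have "\<chi> (K0_class C T a) = \<chi> (K0_class C T (a - b)) + \<chi> (K0_class C T b)"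
        using add[OF keys, of b] diff by simp
      then show ?case using diff keys by (simp add: free_eval_diff)
    qed (use zero frag in auto)
    then show ?thesis by blast
  qed
qed

text \<open>Converse of \<open>dual_group_additive\<close>. Evaluating at a chosen representative is
  well defined because additive functions vanish on the relations.\<close>

lemma additive_dual_group:
  assumes "additive_on C T \<mu>"
  obtains \<chi> where "\<chi> \<in> dual_group (K0_split C T)"
    "\<And>x. Poly_Mapping.keys x \<subseteq> add_closure C T \<Longrightarrow> \<chi> (K0_class C T x) = free_eval \<mu> x"
proof -
  define pick where "pick c = (SOME x. Poly_Mapping.keys x \<subseteq> add_closure C T \<and> c = K0_class C T x)" for c
  define \<chi> where "\<chi> = restrict (\<lambda>c. free_eval \<mu> (pick c)) (carrier (K0_split C T))"
  have val: "\<chi> (K0_class C T x) = free_eval \<mu> x" if x: "Poly_Mapping.keys x \<subseteq> add_closure C T" for x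
  proof -
    have p: "Poly_Mapping.keys (pick (K0_class C T x)) \<subseteq> add_closure C T \<and>
        K0_class C T x = K0_class C T (pick (K0_class C T x))"
      unfolding pick_def by (rule someI[of _ x]) (use x in simp)
    then have "x - pick (K0_class C T x) \<in> K0_relations C T" using K0_class_eq_iff[OF x] by blast
    then have "free_eval \<mu> (x - pick (K0_class C T x)) = 0" by (rule free_eval_K0_relations[OF assms])
    then show ?thesis using K0_class_carrier[OF x] unfolding \<chi>_def by (simp add: free_eval_diff)
  qed
  have "\<chi> (c \<otimes>\<^bsub>K0_split C T\<^esub> c') = \<chi> c + \<chi> c'"
    if c: "c \<in> carrier (K0_split C T)" and c': "c' \<in> carrier (K0_split C T)" for c c'
  proof -
    obtain x y where x: "Poly_Mapping.keys x \<subseteq> add_closure C T" "c = K0_class C T x"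
      and y: "Poly_Mapping.keys y \<subseteq> add_closure C T" "c' = K0_class C T y"
      using K0_split_carrierE[OF c] K0_split_carrierE[OF c'] by metis
    have "Poly_Mapping.keys (x + y) \<subseteq> add_closure C T" using keys_add[of x y] x(1) y(1) by blast
    then show ?thesis using val x y K0_class_add[OF x(1) y(1)] by (metis free_eval_add)
  qed
  then have "\<chi> \<in> dual_group (K0_split C T)"
    unfolding dual_group_def hom_def integer_group_def by (auto simp: \<chi>_def)
  then show ?thesis using that val by blast
qed

end

context cluster_tilting_category
begin

lemma Ind_eq:
  assumes "T_resolution C d T c ts"
  shows "Ind C d T c = K0_class C T (alt_frag ts)"
proof -
  have sum: "(\<Sum>i\<le>d. frag_cmul ((- 1) ^ i) (frag_of (xs ! i))) = alt_frag xs"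
    if "T_resolution C d T c xs" for xs
    using that unfolding T_resolution_def alt_frag_conv_sum by (simp add: lessThan_Suc_atMost)
  have keys: "Poly_Mapping.keys (alt_frag xs) \<subseteq> add_closure C T" if "T_resolution C d T c xs" for xs
    using that keys_alt_frag[of xs] unfolding T_resolution_def by blast
  show ?thesis
    unfolding Ind_def
  proof (rule the_equality)
    show "\<exists>xs. T_resolution C d T c xs \<and> K0_class C T (alt_frag ts) =
        K0_class C T (\<Sum>i\<le>d. frag_cmul ((- 1) ^ i) (frag_of (xs ! i)))"
      using assms sum[OF assms] by auto
    fix x assume "\<exists>xs. T_resolution C d T c xs \<and>
        x = K0_class C T (\<Sum>i\<le>d. frag_cmul ((- 1) ^ i) (frag_of (xs ! i)))"
    then obtain xs where xs: "T_resolution C d T c xs" "x = K0_class C T (alt_frag xs)"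
      using sum by auto
    then show "x = K0_class C T (alt_frag ts)"
      using K0_class_eq_iff[OF keys[OF xs(1)] keys[OF assms]] resolution_unique[OF xs(1) assms] by simp
  qed
qed

lemma free_eval_Ind:
  assumes "additive_on C T \<mu>"
    "\<And>x. Poly_Mapping.keys x \<subseteq> add_closure C T \<Longrightarrow> \<chi> (K0_class C T x) = free_eval \<mu> x"
  shows "\<chi> (Ind C d T c) = index_fun T \<mu> c"
proof -
  obtain ts where ts: "T_resolution C d T c ts" using resolution_exists .
  then have "Poly_Mapping.keys (alt_frag ts) \<subseteq> add_closure C T"
    using keys_alt_frag[of ts] unfolding T_resolution_def by blast
  then show ?thesis using Ind_eq[OF ts] index_fun_eq[OF assms(1) ts] assms(2) by simp
qed

text \<open>Trades the definite description over homomorphisms on \<open>K0_split\<close> for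
  existence and uniqueness of an additive function. A homomorphism is determined by its values on
  classes of objects of add(T), so agreement there is enough.\<close>

lemma c_vector_eqI:
  assumes \<nu>: "additive_on C T \<nu>"
    and val: "\<And>v. v \<in> Indec C U \<Longrightarrow> index_fun T \<nu> v = (if isomorphic C u v then 1 else 0)"
    and unique: "\<And>\<mu> t. \<lbrakk>additive_on C T \<mu>;
      \<And>v. v \<in> Indec C U \<Longrightarrow> index_fun T \<mu> v = (if isomorphic C u v then 1 else 0);
      t \<in> add_closure C T\<rbrakk> \<Longrightarrow> \<mu> t = \<nu> t"
    and t: "t \<in> add_closure C T"
  shows "c_vector C d T U u (K0_class C T (frag_of t)) = \<nu> t"
proof -
  obtain \<chi> where \<chi>: "\<chi> \<in> dual_group (K0_split C T)"
    "\<And>x. Poly_Mapping.keys x \<subseteq> add_closure C T \<Longrightarrow> \<chi> (K0_class C T x) = free_eval \<nu> x"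
    using additive_dual_group[OF \<nu>] by blast
  have "c_vector C d T U u = \<chi>"
    unfolding c_vector_def
  proof (rule the_equality)
    show "\<chi> \<in> dual_group (K0_split C T) \<and>
        (\<forall>v\<in>Indec C U. \<chi> (Ind C d T v) = (if isomorphic C u v then 1 else 0))"
      using \<chi>(1) free_eval_Ind[OF \<nu> \<chi>(2)] val by simp
    fix \<psi> assume \<psi>: "\<psi> \<in> dual_group (K0_split C T) \<and>
        (\<forall>v\<in>Indec C U. \<psi> (Ind C d T v) = (if isomorphic C u v then 1 else 0))"
    then have \<psi>d: "\<psi> \<in> dual_group (K0_split C T)" by blast
    let ?\<mu> = "\<lambda>X. \<psi> (K0_class C T (frag_of X))"
    note \<mu> = dual_group_additive[OF \<psi>d]
    have "index_fun T ?\<mu> v = (if isomorphic C u v then 1 else 0)" if "v \<in> Indec C U" for v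
      using free_eval_Ind[where \<chi> = \<psi> and \<mu> = ?\<mu>, OF \<mu>] \<psi> that by simp
    then have eq: "?\<mu> X = \<nu> X" if "X \<in> add_closure C T" for X
      using unique[OF \<mu>(1) _ that] by simp
    show "\<psi> = \<chi>"
    proof (rule extensionalityI)
      show "\<psi> \<in> extensional (carrier (K0_split C T))" "\<chi> \<in> extensional (carrier (K0_split C T))"
        using \<psi>d \<chi>(1) unfolding dual_group_def by auto
      fix c assume "c \<in> carrier (K0_split C T)"
      then obtain x where x: "Poly_Mapping.keys x \<subseteq> add_closure C T" "c = K0_class C T x"
        using K0_split_carrierE by blast
      have "free_eval ?\<mu> x = free_eval \<nu> x"
        unfolding free_eval_def using eq x(1) by (intro sum.cong) auto
      then show "\<psi> c = \<chi> c" using \<mu>(2)[OF x(1)] \<chi>(2)[OF x(1)] x(2) by simp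
    qed
  qed
  then show ?thesis using \<chi>(2)[of "frag_of t"] t by (simp add: keys_frag_of)
qed

end

section \<open>The homological \<open>c\<close>-vector of an exchange pair\<close>

context ks_angulated_category
begin

text \<open>The function \<open>t \<mapsto> - index_fun U H (\<Sigma>O C t)\<close> is the coefficient of \<open>u\<close> in the coindex of
  \<open>t\<close> with respect to \<open>U\<close>, and index and coindex are mutually inverse.\<close>

lemma c_vector_coindex:
  assumes T: "cluster_tilting C d T" and U: "cluster_tilting C d U" and "odd d"
    and H: "additive_on C U H" "\<And>v. v \<in> Indec C U \<Longrightarrow> H v = (if isomorphic C u v then 1 else 0)"
    and t: "t \<in> add_closure C T"
  shows "c_vector C d T U u (K0_class C T (frag_of t)) = - index_fun U H (\<Sigma>O C t)"
proof -
  interpret T: cluster_tilting_category C d T by unfold_locales (rule T)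
  interpret U: cluster_tilting_category C d U by unfold_locales (rule U)
  let ?\<nu> = "\<lambda>t. - index_fun U H (\<Sigma>O C t)"
  have \<nu>: "additive_on C T ?\<nu>"
    unfolding additive_on_def using U.index_fun_dsum[OF H(1)] \<Sigma>_is_dsum by force
  show ?thesis
  proof (rule T.c_vector_eqI[OF \<nu> _ _ t])
    fix v assume v: "v \<in> Indec C U"
    then have vU: "v \<in> add_closure C U" unfolding Indec_def by blast
    \<comment> \<open>Existence: rotated, this resolution starts at \<open>v\<close>, an object of
      add(U), so the index with respect to U is additive along it. Since \<open>d\<close> is odd,
      reversing its \<open>d + 1\<close> terms changes the sign.\<close>
    obtain ts where ts: "T_resolution C d T v ts" using T.resolution_exists .
    then have len: "length ts = d + 1" and "angle_objects (rev ts @ [v])" unfolding T_resolution_iff by auto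
    then have "angle_objects (v # map (\<Sigma>O C) (rev ts))"
      using angle_objects_rotate[of "rev ts" "[v]"] by simp
    then have "alt_sum (index_fun U H) (v # map (\<Sigma>O C) (rev ts)) = 0"
      by (rule U.index_fun_angle[OF H(1)]) (simp add: vU)
    then have "H v = - alt_sum (\<lambda>t. index_fun U H (\<Sigma>O C t)) ts"
      using U.index_fun_self[OF H(1) vU] len \<open>odd d\<close>
      by (simp add: alt_sum_map alt_sum_rev rev_map[symmetric])
    moreover have "alt_sum ?\<nu> ts = - alt_sum (\<lambda>t. index_fun U H (\<Sigma>O C t)) ts"
      using alt_sum_diff_fun[of "\<lambda>_. 0" "\<lambda>t. index_fun U H (\<Sigma>O C t)" ts] alt_sum_diff_fun[of "\<lambda>_. 0" "\<lambda>_. 0" ts]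
      by simp
    ultimately show "index_fun T ?\<nu> v = (if isomorphic C u v then 1 else 0)"
      using T.index_fun_eq[OF \<nu> ts] H(2)[OF v] by simp
  next
    fix \<mu> s assume \<mu>: "additive_on C T \<mu>"
      "\<And>v. v \<in> Indec C U \<Longrightarrow> index_fun T \<mu> v = (if isomorphic C u v then 1 else 0)"
      and s: "s \<in> add_closure C T"
    have "additive_on C U (index_fun T \<mu>)"
      unfolding additive_on_def using T.index_fun_dsum[OF \<mu>(1)] by blast
    then have eq: "index_fun T \<mu> X = H X" if "X \<in> add_closure C U" for X
      by (rule additive_on_eqI[OF Krull_Schmidt _ H(1) _ that]) (use \<mu>(2) H(2) in simp)
    \<comment> \<open>Uniqueness: rotated, this resolution starts at \<open>s\<close>, an object of
      add(T), so the index with respect to T expresses \<open>\<mu> s\<close> by values on add(U),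
      where it agrees with \<open>H\<close>.\<close>
    obtain us where us: "T_resolution C d U (\<Sigma>O C s) us" using U.resolution_exists .
    then have len: "length us = d + 1" and sub: "set us \<subseteq> add_closure C U"
      and "angle_objects (rev us @ [\<Sigma>O C s])" unfolding T_resolution_iff by auto
    then have "angle_objects (s # rev us)" using angle_objects_rotate1[of "rev us" s] by simp
    then have "alt_sum (index_fun T \<mu>) (s # rev us) = 0"
      by (rule T.index_fun_angle[OF \<mu>(1)]) (simp add: s)
    moreover have "alt_sum (index_fun T \<mu>) (rev us) = alt_sum H (rev us)"
      using eq sub by (intro alt_sum_cong) auto
    ultimately have "\<mu> s = alt_sum H (rev us)" using T.index_fun_self[OF \<mu>(1) s] by simp
    then show "\<mu> s = - index_fun U H (\<Sigma>O C s)"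
      using U.index_fun_eq[OF H(1) us] len \<open>odd d\<close> by (simp add: alt_sum_rev)
  qed
qed

lemma kdim_1_multiple:
  assumes "kdim C (Hom C X Y) = 1" "f \<in> Hom C X Y" "f \<noteq> 0" "g \<in> Hom C X Y"
  obtains a where "g = scl C a f"
proof -
  obtain B where B: "B \<subseteq> Hom C X Y" "Hom C X Y \<subseteq> vs.span B" "card B = kdim C (Hom C X Y)"
    by (rule vs.basis_exists[of "Hom C X Y"])
  then obtain b where b: "B = {b}" using assms(1) card_1_singletonE[of B] by auto
  obtain x y where x: "f = scl C x b" and y: "g = scl C y b"
    using B(2) assms(2,4) unfolding b vs.span_singleton by blast
  have "x \<noteq> 0" using x assms(3) by auto
  then have "g = scl C (y / x) f" using x y by simp
  then show ?thesis using that by blast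
qed

text \<open>Keeps the end of an exchange angle only: \<open>g\<close> is a weak kernel of
  \<open>\<delta>\<close>, and its source is a sum of indecomposables of add(U) other than
  \<open>u\<close>.\<close>

lemma exchange_angleE:
  assumes "exchange_angle C d U u a b \<delta>"
  obtains e g ws where "\<delta> \<in> Hom C b (\<Sigma>O C a)" "g \<in> Hom C e b"
    "\<And>X f. f \<in> Hom C X b \<Longrightarrow> \<delta> \<cdot> f = 0 \<Longrightarrow> \<exists>h\<in>Hom C X e. f = g \<cdot> h"
    "is_dsum C e ws" "\<And>w. w \<in> set ws \<Longrightarrow> w \<in> Indec C U \<and> \<not> isomorphic C w u"
proof -
  obtain es \<gamma> where E: "length es = d" "(a # es @ [b], \<gamma> @ [\<delta>]) \<in> angles C"
    and D: "\<forall>e\<in>set es. \<exists>vs. is_dsum C e vs \<and> (\<forall>v\<in>set vs. v \<in> Indec C U \<and> \<not> isomorphic C v u)"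
    using assms unfolding exchange_angle_def by blast
  have len: "length \<gamma> = d + 1" using angle_length[OF E(2)] by simp
  \<comment> \<open>The list runs from e_d down to e_1, so this is e_1, the object next to
    \<open>b\<close>.\<close>
  let ?e = "es ! (d - 1)"
  have nth: "(a # es @ [b]) ! d = ?e" "(a # es @ [b]) ! Suc d = b" "(\<gamma> @ [\<delta>]) ! Suc d = \<delta>"
    using E(1) len d_pos by (auto simp: nth_Cons' nth_append)
  have "?e \<in> set es" using E(1) d_pos by simp
  then obtain ws where ws: "is_dsum C ?e ws" "\<forall>w\<in>set ws. w \<in> Indec C U \<and> \<not> isomorphic C w u"
    using D by blast
  show ?thesis
  proof (rule that)
    show "\<delta> \<in> Hom C b (\<Sigma>O C a)" using angle_Hom_start(2)[OF E(2)] nth by simp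
    show "(\<gamma> @ [\<delta>]) ! d \<in> Hom C ?e b"
      using angle_Hom[OF E(2), of d] nth E(1) by (simp add: nth_append)
    show "\<exists>h\<in>Hom C X ?e. f = (\<gamma> @ [\<delta>]) ! d \<cdot> h" if f: "f \<in> Hom C X b" "\<delta> \<cdot> f = 0" for X f
      using angle_exact[OF E(2) order_refl, of f X] f unfolding nth by blast
    show "w \<in> Indec C U \<and> \<not> isomorphic C w u" if "w \<in> set ws" for w
      using ws(2) that by blast
    show "is_dsum C ?e ws" using ws(1) .
  qed
qed

lemma linear_functional_nonzero:
  assumes "f \<in> Hom C X Y" "f \<noteq> 0"
  obtains \<xi> where "\<xi> \<in> dual_space (scl C) (Hom C X Y)" "\<xi> f \<noteq> 0"
proof -
  have "vs.independent {f}" using assms(2) by simp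
  then obtain B where B: "{f} \<subseteq> B" "vs.independent B" "UNIV \<subseteq> vs.span B"
    using vs.maximal_independent_subset_extend[of "{f}" UNIV] by auto
  have span: "x \<in> vs.span B" for x using B(3) by blast
  define \<xi> where "\<xi> = restrict (\<lambda>x. vs.representation B x f) (Hom C X Y)"
  have "\<xi> \<in> dual_space (scl C) (Hom C X Y)"
    using vs.representation_add[OF B(2) span span] vs.representation_scale[OF B(2) span]
    unfolding dual_space_def \<xi>_def by (simp add: add_Hom scl_Hom)
  moreover have "\<xi> f \<noteq> 0"
    using vs.representation_basis[OF B(2), of f] B(1) assms(1) unfolding \<xi>_def by simp
  ultimately show ?thesis using that by blast
qed

text \<open>A functional on Hom(t, \<Sigma> v) that is nonzero at \<open>\<delta> \<cdot> a\<close>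
  corresponds under Serre duality to a map from \<Sigma> v to the Serre functor at t. Naturality in
  both arguments rewrites its value at \<open>\<delta> \<cdot> a\<close> as a pairing with the
  identity of \<open>u\<close>, so the composite with the image of \<open>a\<close> cannot be
  zero.\<close>

lemma Calabi_Yau_nondegenerate:
  assumes CY: "Calabi_Yau_2d C" and a: "a \<in> Hom C t u" and \<delta>: "\<delta> \<in> Hom C u (\<Sigma>O C v)"
    and nz: "\<delta> \<cdot> a \<noteq> 0"
  obtains w where "w \<in> Hom C v (\<Sigma>O C t)" "\<Sigma>M C a \<cdot> w \<noteq> 0"
proof -
  obtain SvO SvM where S: "Serre_functor C SvO SvM"
    and nat: "naturally_isomorphic C SvO SvM (\<Sigma>O C \<circ> \<Sigma>O C) (\<Sigma>M C \<circ> \<Sigma>M C)"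
    using CY unfolding Calabi_Yau_2d_def by blast
  have "is_functor C SvO SvM" using S unfolding Serre_functor_def auto_equivalence_def by simp
  then have SvM: "SvM f \<in> Hom C (SvO X) (SvO Y)" if "f \<in> Hom C X Y" for f X Y
    using that unfolding is_functor_def by simp
  obtain \<eta> where bij: "\<forall>X Y. bij_betw (\<eta> X Y) (Hom C Y (SvO X)) (dual_space (scl C) (Hom C X Y))"
    and \<eta>add: "\<forall>X Y. \<forall>f\<in>Hom C Y (SvO X). \<forall>g\<in>Hom C Y (SvO X). \<forall>h\<in>Hom C X Y.
            \<eta> X Y (f + g) h = \<eta> X Y f h + \<eta> X Y g h"
    and natY: "\<forall>X Y Y'. \<forall>g\<in>Hom C Y Y'. \<forall>f\<in>Hom C Y' (SvO X). \<forall>h\<in>Hom C X Y.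
            \<eta> X Y (f \<cdot> g) h = \<eta> X Y' f (g \<cdot> h)"
    and natX: "\<forall>X X' Y. \<forall>a\<in>Hom C X X'. \<forall>f\<in>Hom C Y (SvO X). \<forall>h\<in>Hom C X' Y.
            \<eta> X' Y (SvM a \<cdot> f) h = \<eta> X Y f (h \<cdot> a)"
    using S unfolding Serre_functor_def by (elim conjE exE) (rule that; assumption)
  obtain \<theta> where \<theta>: "\<forall>X. is_iso C (SvO X) (\<Sigma>O C (\<Sigma>O C X)) (\<theta> X)"
    and \<theta>nat: "\<forall>X Y. \<forall>f\<in>Hom C X Y. \<theta> Y \<cdot> SvM f = \<Sigma>M C (\<Sigma>M C f) \<cdot> \<theta> X"
    using nat unfolding naturally_isomorphic_def o_def by (elim conjE exE) (rule that; assumption)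
  have \<theta>H: "\<theta> X \<in> Hom C (SvO X) (\<Sigma>O C (\<Sigma>O C X))" for X using \<theta> unfolding is_iso_def by blast
  have \<eta>0: "\<eta> X Y 0 h = 0" if "h \<in> Hom C X Y" for X Y h
  proof -
    have "\<eta> X Y (0 + 0) h = \<eta> X Y 0 h + \<eta> X Y 0 h" using \<eta>add zero_Hom that by blast
    then show ?thesis by (metis add.right_neutral add_cancel_right_right)
  qed
  obtain \<xi> where \<xi>: "\<xi> \<in> dual_space (scl C) (Hom C t (\<Sigma>O C v))" "\<xi> (\<delta> \<cdot> a) \<noteq> 0"
    using linear_functional_nonzero[OF Comp_closed[OF a \<delta>] nz] .
  then have "\<xi> \<in> \<eta> t (\<Sigma>O C v) ` Hom C (\<Sigma>O C v) (SvO t)" using bij_betw_imp_surj_on[OF bij[rule_format]] by simp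
  then obtain w where w: "w \<in> Hom C (\<Sigma>O C v) (SvO t)" "\<eta> t (\<Sigma>O C v) w = \<xi>" by auto
  note w\<delta> = Comp_closed[OF \<delta> w(1)] and Sa = SvM[OF a]
  have "\<eta> u u (SvM a \<cdot> (w \<cdot> \<delta>)) (idm C u) = \<xi> (\<delta> \<cdot> a)"
    using natX[rule_format, OF a w\<delta> idm_closed] natY[rule_format, OF \<delta> w(1) a] w(2) idm_left[OF a] by simp
  then have "SvM a \<cdot> (w \<cdot> \<delta>) \<noteq> 0" using \<xi>(2) \<eta>0[OF idm_closed] by metis
  then have Sw: "SvM a \<cdot> w \<noteq> 0" using Comp_assoc[OF \<delta> w(1) Sa] \<delta> by auto
  obtain \<theta>' where \<theta>': "\<theta>' \<in> Hom C (\<Sigma>O C (\<Sigma>O C u)) (SvO u)" "\<theta>' \<cdot> \<theta> u = idm C (SvO u)"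
    using \<theta>[rule_format, of u] unfolding is_iso_def by blast
  \<comment> \<open>The Serre functor is replaced by the double shift along \<open>\<theta>\<close>;
    afterwards one shift is cancelled from source and target.\<close>
  have "\<theta> u \<cdot> (SvM a \<cdot> w) \<noteq> 0"
  proof
    assume "\<theta> u \<cdot> (SvM a \<cdot> w) = 0"
    then have "SvM a \<cdot> w = 0"
      using Comp_assoc[OF Comp_closed[OF w(1) Sa] \<theta>H \<theta>'(1)] \<theta>'(2) idm_left[OF Comp_closed[OF w(1) Sa]] \<theta>'(1)
      by simp
    then show False using Sw by blast
  qed
  moreover have "\<theta> u \<cdot> (SvM a \<cdot> w) = \<Sigma>M C (\<Sigma>M C a) \<cdot> (\<theta> t \<cdot> w)"
    using Comp_assoc[OF w(1) Sa \<theta>H] Comp_assoc[OF w(1) \<theta>H \<Sigma>_Hom[OF \<Sigma>_Hom[OF a]]] \<theta>nat[rule_format, OF a] by simp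
  moreover obtain w' where w': "w' \<in> Hom C v (\<Sigma>O C t)" "\<Sigma>M C w' = \<theta> t \<cdot> w"
    using \<Sigma>_preimage[OF Comp_closed[OF w(1) \<theta>H]] .
  ultimately have "\<Sigma>M C (\<Sigma>M C a \<cdot> w') \<noteq> 0" using \<Sigma>_Comp[OF w'(1) \<Sigma>_Hom[OF a]] by simp
  then have "\<Sigma>M C a \<cdot> w' \<noteq> 0" by auto
  then show ?thesis using that w'(1) by blast
qed

end

section \<open>Dimension formula for a fixed exchange pair\<close>

locale exchange_situation = ks_angulated_category C d
  for C :: "('o, 'm::ab_group_add, 'k::field, 'z) angcat_scheme" (structure) and d :: nat +
  fixes U u u' :: 'o and \<delta> \<epsilon> :: 'm
  assumes U: "cluster_tilting C d U"
    and mutable: "mutable_at C d U u u'"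
    and pair: "exchange_pair C d U u u'"
    and \<delta>: "exchange_angle C d U u u' u \<delta>"
    and \<epsilon>: "exchange_angle C d U u u u' \<epsilon>"
begin

sublocale U: cluster_tilting_category C d U
  by unfold_locales (rule U)

lemma kdim_pair: "kdim C (Hom C u (\<Sigma>O C u')) = 1" "kdim C (Hom C u' (\<Sigma>O C u)) = 1"
  using pair unfolding exchange_pair_def by auto

text \<open>The remaining summands and \<open>u'\<close> lie together in add(U'), so rigidity of the
  mutated object excludes maps from the former to the shift of the latter. On add(U), the functor
  Hom(-, \<Sigma> u') therefore sees only copies of \<open>u\<close>.\<close>

lemma summands:
  obtains vs where "is_dsum C U (u # vs)" "\<And>w. w \<in> set (u # vs) \<Longrightarrow> local_End C w"
    "\<And>w. w \<in> set (u # vs) \<Longrightarrow> w \<in> add_closure C U"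
    "\<And>w x. \<lbrakk>w \<in> set vs; isomorphic C w x\<rbrakk> \<Longrightarrow> Hom C x (\<Sigma>O C u') = {0}"
proof -
  obtain vs U' where V: "indec_decomposition C U (u # vs)" "is_dsum C U' (u' # vs)" "cluster_tilting C d U'"
    using mutable unfolding mutable_at_def by blast
  interpret U': cluster_tilting_category C d U' by unfold_locales (rule V(3))
  have D: "is_dsum C U (u # vs)" using V(1) unfolding indec_decomposition_def by blast
  show ?thesis
  proof (rule that[OF D])
    show "local_End C w" if "w \<in> set (u # vs)" for w
      using indecomposable_local_End[OF Krull_Schmidt] V(1) that unfolding indec_decomposition_def by blast
    show "w \<in> add_closure C U" if "w \<in> set (u # vs)" for w
      using add_closure_summands[OF add_closure_self D] that by blast
    have sub: "set (u' # vs) \<subseteq> add_closure C U'" by (rule add_closure_summands[OF add_closure_self V(2)])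
    show "Hom C x (\<Sigma>O C u') = {0}" if "w \<in> set vs" "isomorphic C w x" for w x
      by (rule U'.rigid[OF add_closure_iso[OF _ that(2)]]) (use sub that(1) in auto)
  qed
qed

lemma u_local: "local_End C u" and u_add: "u \<in> add_closure C U"
  using summands by (metis list.set_intros(1))+

lemma \<delta>_Hom: "\<delta> \<in> Hom C u (\<Sigma>O C u')" and \<epsilon>_Hom: "\<epsilon> \<in> Hom C u' (\<Sigma>O C u)"
  using exchange_angleE[OF \<delta>] exchange_angleE[OF \<epsilon>] by blast+

text \<open>If \<delta> were zero, the identity of \<open>u\<close> would factor through e_1.
  Locality would then make \<open>u\<close> isomorphic to one of the indecomposable summands of e_1,
  which exclude \<open>u\<close>.\<close>

lemma \<delta>_nonzero: "\<delta> \<noteq> 0"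
proof
  assume z: "\<delta> = 0"
  obtain e \<gamma> ws where \<gamma>: "\<gamma> \<in> Hom C e u"
    and ex: "\<And>X f. f \<in> Hom C X u \<Longrightarrow> \<delta> \<cdot> f = 0 \<Longrightarrow> \<exists>h\<in>Hom C X e. f = \<gamma> \<cdot> h"
    and W: "is_dsum C e ws" "\<And>w. w \<in> set ws \<Longrightarrow> w \<in> Indec C U \<and> \<not> isomorphic C w u"
    by (rule exchange_angleE[OF \<delta>]) (rule that)
  obtain \<iota> \<pi> where "dsum_data C e ws \<iota> \<pi>" using W(1) unfolding is_dsum_def by blast
  note D = dsum_dataD[OF this]
  obtain g where g: "g \<in> Hom C u e" "idm C u = \<gamma> \<cdot> g"
    using ex[OF idm_closed] z Comp_zero_left[OF idm_closed[of u]] by auto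
  have jg: "(\<iota> j \<cdot> \<pi> j) \<cdot> g \<in> Hom C u e" if "j < length ws" for j
    using Comp_closed[OF g(1) Comp_closed[OF D(2) D(1)]] that by blast
  have "idm C u = \<gamma> \<cdot> ((\<Sum>j<length ws. \<iota> j \<cdot> \<pi> j) \<cdot> g)" using g D(5) idm_left[OF g(1)] by simp
  also have "(\<Sum>j<length ws. \<iota> j \<cdot> \<pi> j) \<cdot> g = (\<Sum>j<length ws. (\<iota> j \<cdot> \<pi> j) \<cdot> g)"
    using Comp_closed[OF D(2) D(1)] by (intro Comp_sum_left[OF g(1), where Z = e]) auto
  also have "\<gamma> \<cdot> (\<Sum>j<length ws. (\<iota> j \<cdot> \<pi> j) \<cdot> g) = (\<Sum>j<length ws. \<gamma> \<cdot> ((\<iota> j \<cdot> \<pi> j) \<cdot> g))"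
    using jg by (intro Comp_sum_right[OF \<gamma>, where X = u]) auto
  also have "\<dots> = (\<Sum>j<length ws. (\<gamma> \<cdot> \<iota> j) \<cdot> (\<pi> j \<cdot> g))"
    using Comp4[OF g(1) D(2) D(1) \<gamma>] by (intro sum.cong) auto
  finally have sum: "idm C u = (\<Sum>j<length ws. (\<gamma> \<cdot> \<iota> j) \<cdot> (\<pi> j \<cdot> g))" .
  have "is_iso C u u (idm C u)" unfolding is_iso_def using idm_closed[of u] idm_left[OF idm_closed[of u]] by blast
  moreover have H: "\<gamma> \<cdot> \<iota> j \<in> Hom C (ws ! j) u" "\<pi> j \<cdot> g \<in> Hom C u (ws ! j)" if "j < length ws" for j
    using Comp_closed[OF D(1) \<gamma>] Comp_closed[OF g(1) D(2)] that by auto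
  ultimately obtain j where j: "j < length ws" "is_iso C u u ((\<gamma> \<cdot> \<iota> j) \<cdot> (\<pi> j \<cdot> g))"
    using local_End_sum[OF u_local, of "{..<length ws}" "\<lambda>j. (\<gamma> \<cdot> \<iota> j) \<cdot> (\<pi> j \<cdot> g)"] sum
      Comp_closed[OF H(2) H(1)] by auto
  have v: "ws ! j \<in> Indec C U" "\<not> isomorphic C (ws ! j) u" using W(2)[OF nth_mem[OF j(1)]] by auto
  then have "local_End C (ws ! j)" using indecomposable_local_End[OF Krull_Schmidt] unfolding Indec_def by blast
  then have "isomorphic C u (ws ! j)" using local_End_retract[OF u_local _ H(2) H(1)] j by blast
  then show False using v(2) isomorphic_sym by blast
qed

text \<open>The identity of \<open>x\<close> is expanded over the summands of \<open>U\<close>. On a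
  summand equal to \<open>u\<close> the map is a multiple of \<delta>, by dimension one; on every
  other summand it is zero.\<close>

lemma Hom_factor_\<delta>:
  assumes x: "x \<in> add_closure C U" and f: "f \<in> Hom C x (\<Sigma>O C u')"
  obtains k where "k \<in> Hom C x u" "f = \<delta> \<cdot> k"
proof -
  obtain vs where V: "is_dsum C U (u # vs)"
    "\<And>w x. \<lbrakk>w \<in> set vs; isomorphic C w x\<rbrakk> \<Longrightarrow> Hom C x (\<Sigma>O C u') = {0}" using summands by metis
  obtain ws p q where W: "set ws \<subseteq> set (u # vs)"
    "\<And>j. j < length ws \<Longrightarrow> p j \<in> Hom C x (ws ! j)" "\<And>j. j < length ws \<Longrightarrow> q j \<in> Hom C (ws ! j) x"
    "(\<Sum>j<length ws. q j \<cdot> p j) = idm C x"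
    by (rule add_closure_expand[OF x V(1)]) (rule that)
  have "\<exists>k\<in>Hom C x u. f \<cdot> (q j \<cdot> p j) = \<delta> \<cdot> k" if j: "j < length ws" for j
  proof (cases "ws ! j = u")
    case True
    then have fq: "f \<cdot> q j \<in> Hom C u (\<Sigma>O C u')" and pj: "p j \<in> Hom C x u"
      using Comp_closed[OF W(3)[OF j] f] W(2)[OF j] by auto
    obtain c where "f \<cdot> q j = scl C c \<delta>" using kdim_1_multiple[OF kdim_pair(1) \<delta>_Hom \<delta>_nonzero fq] .
    then have "f \<cdot> (q j \<cdot> p j) = \<delta> \<cdot> scl C c (p j)"
      using Comp_assoc[OF W(2)[OF j] W(3)[OF j] f] Comp_scl_left[OF pj \<delta>_Hom] Comp_scl_right[OF pj \<delta>_Hom] by simp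
    then show ?thesis using scl_Hom[OF pj] by blast
  next
    case False
    then have "ws ! j \<in> set vs" using W(1) nth_mem[OF j] by auto
    then have "f \<cdot> q j = 0" using V(2)[OF _ isomorphic_refl] Comp_closed[OF W(3)[OF j] f] by auto
    then have "f \<cdot> (q j \<cdot> p j) = \<delta> \<cdot> 0"
      using Comp_assoc[OF W(2)[OF j] W(3)[OF j] f] W(2)[OF j] \<delta>_Hom by simp
    then show ?thesis using zero_Hom by blast
  qed
  then obtain k where k: "\<And>j. j < length ws \<Longrightarrow> k j \<in> Hom C x u"
    "\<And>j. j < length ws \<Longrightarrow> f \<cdot> (q j \<cdot> p j) = \<delta> \<cdot> k j" by metis
  have "f = f \<cdot> (\<Sum>j<length ws. q j \<cdot> p j)" using W(4) idm_right[OF f] by simp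
  also have "\<dots> = (\<Sum>j<length ws. f \<cdot> (q j \<cdot> p j))"
    using Comp_closed[OF W(2) W(3)] by (intro Comp_sum_right[OF f, where X = x]) auto
  also have "\<dots> = (\<Sum>j<length ws. \<delta> \<cdot> k j)" using k(2) by simp
  also have "\<dots> = \<delta> \<cdot> (\<Sum>j<length ws. k j)"
    using k(1) by (intro Comp_sum_right[OF \<delta>_Hom, where X = x, symmetric]) auto
  finally show ?thesis using that sum_Hom[of "{..<length ws}" k x u] k(1) by blast
qed

lemma additive_on_Hom: "additive_on C U (\<lambda>x. int (kdim C (Hom C x (\<Sigma>O C u'))))"
  unfolding additive_on_def using kdim_contravariant_dsum by simp

text \<open>By locality \<open>v\<close> is isomorphic to \<open>u\<close> or to one of the
  remaining summands of \<open>U\<close>; dimension one settles the first case and rigidity of the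
  mutated object the second.\<close>

lemma kdim_Hom_Indec:
  assumes v: "v \<in> Indec C U"
  shows "int (kdim C (Hom C v (\<Sigma>O C u'))) = (if isomorphic C u v then 1 else 0)"
proof (cases "isomorphic C u v")
  case True
  then show ?thesis using additive_on_iso[OF additive_on_Hom u_add True] kdim_pair(1) by simp
next
  case False
  obtain vs where V: "is_dsum C U (u # vs)" "\<And>w. w \<in> set (u # vs) \<Longrightarrow> local_End C w"
    "\<And>w x. \<lbrakk>w \<in> set vs; isomorphic C w x\<rbrakk> \<Longrightarrow> Hom C x (\<Sigma>O C u') = {0}" using summands by metis
  have "v \<in> add_closure C U" "local_End C v"
    using v indecomposable_local_End[OF Krull_Schmidt] unfolding Indec_def by auto
  then obtain w where w: "w \<in> set (u # vs)" "isomorphic C v w"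
    using local_End_in_add_closure[OF _ _ V(1,2)] by blast
  then have "w \<in> set vs" using False isomorphic_sym by auto
  then have "Hom C v (\<Sigma>O C u') = {0}" using V(3) isomorphic_sym[OF w(2)] by blast
  then show ?thesis using False by simp
qed

text \<open>Identifies the two ranks left over in the long exact sequence of Hom(-, \<Sigma> u').
  The image of precomposition with the first morphism equals that of \<delta>; the connecting
  morphism and \<epsilon> give maps on Hom(t,u') with the same kernel, hence of the same
  rank.\<close>

lemma kdim_difference:
  assumes A: "(t # us, \<gamma>) \<in> angles C" and us: "set us \<subseteq> add_closure C U"
  shows "alt_sum (\<lambda>x. int (kdim C (Hom C x (\<Sigma>O C u')))) us =
    int (kdim C ((\<lambda>f. \<delta> \<cdot> f) ` Hom C t u)) + (- 1) ^ d * int (kdim C ((\<lambda>f. \<epsilon> \<cdot> f) ` Hom C t u'))"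
proof -
  let ?cs = "t # us"
  have len: "length us = d + 1" using angle_length[OF A] by simp
  have x1: "?cs ! 1 \<in> add_closure C U" and xd: "?cs ! (d + 1) \<in> add_closure C U"
    using us len by (auto simp: subset_iff)
  have g0: "\<gamma> ! 0 \<in> Hom C t (?cs ! 1)" and gd: "\<gamma> ! (d + 1) \<in> Hom C (?cs ! (d + 1)) (\<Sigma>O C t)"
    using angle_Hom_start[OF A] by auto
  \<comment> \<open>A map on \<open>t\<close> extends along the first morphism as soon as its shift
    kills the connecting morphism. Exactness provides the extension after a shift, and the shift is
    bijective on Hom spaces.\<close>
  have lift: "\<exists>g\<in>Hom C (?cs ! 1) X. a = g \<cdot> \<gamma> ! 0"
    if a: "a \<in> Hom C t X" and z: "\<Sigma>M C a \<cdot> \<gamma> ! (d + 1) = 0" for a X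
  proof -
    have "\<Sigma>M C a \<in> Hom C (\<Sigma>O C (?cs ! 0)) (\<Sigma>O C X)" using \<Sigma>_Hom[OF a] by simp
    then obtain h where h: "h \<in> Hom C (\<Sigma>O C (?cs ! 1)) (\<Sigma>O C X)" "\<Sigma>M C a = h \<cdot> \<Sigma>M C (\<gamma> ! 0)"
      using angle_coexact_end[OF A _ z] by blast
    obtain g where g: "g \<in> Hom C (?cs ! 1) X" "\<Sigma>M C g = h" using \<Sigma>_preimage[OF h(1)] .
    then have "\<Sigma>M C a = \<Sigma>M C (g \<cdot> \<gamma> ! 0)" using h(2) \<Sigma>_Comp[OF g0 g(1)] by simp
    then show ?thesis using \<Sigma>_inject[OF a Comp_closed[OF g0 g(1)]] g(1) by blast
  qed
  have B: "(\<lambda>f. f \<cdot> \<gamma> ! 0) ` Hom C (?cs ! 1) (\<Sigma>O C u') = (\<lambda>f. \<delta> \<cdot> f) ` Hom C t u"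
  proof
    show "(\<lambda>f. f \<cdot> \<gamma> ! 0) ` Hom C (?cs ! 1) (\<Sigma>O C u') \<subseteq> (\<lambda>f. \<delta> \<cdot> f) ` Hom C t u"
    proof
      fix h assume "h \<in> (\<lambda>f. f \<cdot> \<gamma> ! 0) ` Hom C (?cs ! 1) (\<Sigma>O C u')"
      then obtain f where f: "f \<in> Hom C (?cs ! 1) (\<Sigma>O C u')" "h = f \<cdot> \<gamma> ! 0" by blast
      obtain k where k: "k \<in> Hom C (?cs ! 1) u" "f = \<delta> \<cdot> k" using Hom_factor_\<delta>[OF x1 f(1)] .
      then have "h = \<delta> \<cdot> (k \<cdot> \<gamma> ! 0)" using f(2) Comp_assoc[OF g0 k(1) \<delta>_Hom] by simp
      then show "h \<in> (\<lambda>f. \<delta> \<cdot> f) ` Hom C t u" using Comp_closed[OF g0 k(1)] by blast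
    qed
    show "(\<lambda>f. \<delta> \<cdot> f) ` Hom C t u \<subseteq> (\<lambda>f. f \<cdot> \<gamma> ! 0) ` Hom C (?cs ! 1) (\<Sigma>O C u')"
    proof
      fix h assume "h \<in> (\<lambda>f. \<delta> \<cdot> f) ` Hom C t u"
      then obtain a where a: "a \<in> Hom C t u" "h = \<delta> \<cdot> a" by blast
      \<comment> \<open>This composite goes from an object of add(U) to \<Sigma> u and vanishes by
        rigidity.\<close>
      have "\<Sigma>M C a \<cdot> \<gamma> ! (d + 1) = 0"
        using Comp_closed[OF gd \<Sigma>_Hom[OF a(1)]] U.rigid[OF xd u_add] by blast
      then obtain g where g: "g \<in> Hom C (?cs ! 1) u" "a = g \<cdot> \<gamma> ! 0" using lift[OF a(1)] by blast
      then have "h = (\<delta> \<cdot> g) \<cdot> \<gamma> ! 0" using a(2) Comp_assoc[OF g0 g(1) \<delta>_Hom] by simp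
      then show "h \<in> (\<lambda>f. f \<cdot> \<gamma> ! 0) ` Hom C (?cs ! 1) (\<Sigma>O C u')" using Comp_closed[OF g(1) \<delta>_Hom] by blast
    qed
  qed
  obtain e g' ws where ge: "g' \<in> Hom C e u'"
    and ex: "\<And>X f. f \<in> Hom C X u' \<Longrightarrow> \<epsilon> \<cdot> f = 0 \<Longrightarrow> \<exists>h\<in>Hom C X e. f = g' \<cdot> h"
    and W: "is_dsum C e ws" "\<And>w. w \<in> set ws \<Longrightarrow> w \<in> Indec C U \<and> \<not> isomorphic C w u"
    by (rule exchange_angleE[OF \<epsilon>]) (rule that)
  have e: "e \<in> add_closure C U" using add_closure_dsum[OF W(1)] W(2) unfolding Indec_def by blast
  \<comment> \<open>Each condition makes \<open>a\<close> factor through an object of add(U), the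
    first through \<open>e\<close> and the second through \<open>?cs ! 1\<close>. Rigidity of
    \<open>U\<close> then yields the other condition.\<close>
  have ker: "\<epsilon> \<cdot> a = 0 \<longleftrightarrow> \<Sigma>M C a \<cdot> \<gamma> ! (d + 1) = 0" if a: "a \<in> Hom C t u'" for a
  proof
    assume z: "\<epsilon> \<cdot> a = 0"
    obtain g where g: "g \<in> Hom C t e" "a = g' \<cdot> g" using ex[OF a z] by blast
    have "\<Sigma>M C g \<cdot> \<gamma> ! (d + 1) = 0"
      using Comp_closed[OF gd \<Sigma>_Hom[OF g(1)]] U.rigid[OF xd e] by blast
    then show "\<Sigma>M C a \<cdot> \<gamma> ! (d + 1) = 0"
      using g(2) \<Sigma>_Comp[OF g(1) ge] Comp_assoc'[OF gd \<Sigma>_Hom[OF g(1)] \<Sigma>_Hom[OF ge]] \<Sigma>_Hom[OF ge] by simp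
  next
    assume "\<Sigma>M C a \<cdot> \<gamma> ! (d + 1) = 0"
    then obtain g where g: "g \<in> Hom C (?cs ! 1) u'" "a = g \<cdot> \<gamma> ! 0" using lift[OF a] by blast
    have "\<epsilon> \<cdot> g = 0" using Comp_closed[OF g(1) \<epsilon>_Hom] U.rigid[OF x1 u_add] by blast
    then show "\<epsilon> \<cdot> a = 0" using g(2) Comp_assoc[OF g0 g(1) \<epsilon>_Hom] g0 by simp
  qed
  have "kdim C (Hom C t u') = kdim C {a\<in>Hom C t u'. \<epsilon> \<cdot> a = 0} + kdim C ((\<lambda>f. \<epsilon> \<cdot> f) ` Hom C t u')"
    using kdim_postcomp[OF covariant_subfunctor_Hom \<epsilon>_Hom] .
  moreover have "kdim C (Hom C t u') = kdim C {a\<in>Hom C t u'. \<Sigma>M C a \<cdot> \<gamma> ! (d + 1) = 0} +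
      kdim C ((\<lambda>a. \<Sigma>M C a \<cdot> \<gamma> ! (d + 1)) ` Hom C t u')"
  proof (rule kdim_kernel_image[OF subspace_Hom order_refl])
    show "\<Sigma>M C (x + y) \<cdot> \<gamma> ! (d + 1) = \<Sigma>M C x \<cdot> \<gamma> ! (d + 1) + \<Sigma>M C y \<cdot> \<gamma> ! (d + 1)"
      if "x \<in> Hom C t u'" "y \<in> Hom C t u'" for x y
      using \<Sigma>_add[OF that] Comp_add_left[OF gd \<Sigma>_Hom[OF that(1)] \<Sigma>_Hom[OF that(2)]] by simp
    show "\<Sigma>M C (scl C a x) \<cdot> \<gamma> ! (d + 1) = scl C a (\<Sigma>M C x \<cdot> \<gamma> ! (d + 1))" if "x \<in> Hom C t u'" for a x
      using \<Sigma>_scl[OF that] Comp_scl_left[OF gd \<Sigma>_Hom[OF that]] by simp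
  qed
  moreover have "{a\<in>Hom C t u'. \<epsilon> \<cdot> a = 0} = {a\<in>Hom C t u'. \<Sigma>M C a \<cdot> \<gamma> ! (d + 1) = 0}"
    using ker by blast
  \<comment> \<open>The shift identifies Hom(t,u') with Hom(\<Sigma> t, \<Sigma> u'), the space on
    which the long exact sequence measures the connecting morphism.\<close>
  moreover have "(\<lambda>a. \<Sigma>M C a \<cdot> \<gamma> ! (d + 1)) ` Hom C t u' =
      (\<lambda>f. f \<cdot> \<gamma> ! (d + 1)) ` Hom C (\<Sigma>O C (?cs ! 0)) (\<Sigma>O C u')"
  proof -
    have surj: "\<Sigma>M C ` Hom C t u' = Hom C (\<Sigma>O C (?cs ! 0)) (\<Sigma>O C u')"
      using bij_betw_imp_surj_on[OF \<Sigma>M_bij, of t u'] by simp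
    show ?thesis unfolding surj[symmetric] image_image ..
  qed
  ultimately have "kdim C ((\<lambda>f. f \<cdot> \<gamma> ! (d + 1)) ` Hom C (\<Sigma>O C (?cs ! 0)) (\<Sigma>O C u')) =
      kdim C ((\<lambda>f. \<epsilon> \<cdot> f) ` Hom C t u')" by simp
  then show ?thesis
    using angle_kdim_contravariant[OF A, of "\<Sigma>O C u'"] B by simp
qed

lemma c_vector_difference:
  assumes T: "cluster_tilting C d T" and "odd d" and t: "t \<in> add_closure C T"
  shows "c_vector C d T U u (K0_class C T (frag_of t)) =
    int (kdim C ((\<lambda>f. \<delta> \<cdot> f) ` Hom C t u)) - int (kdim C ((\<lambda>f. \<epsilon> \<cdot> f) ` Hom C t u'))"
proof -
  let ?H = "\<lambda>x. int (kdim C (Hom C x (\<Sigma>O C u')))"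
  obtain us where us: "T_resolution C d U (\<Sigma>O C t) us" using U.resolution_exists .
  then have len: "length us = d + 1" and sub: "set us \<subseteq> add_closure C U"
    and "angle_objects (rev us @ [\<Sigma>O C t])" unfolding T_resolution_iff by auto
  then have "angle_objects (t # rev us)" using angle_objects_rotate1[of "rev us" t] by simp
  then obtain \<gamma> where \<gamma>: "(t # rev us, \<gamma>) \<in> angles C" unfolding angle_objects_def by blast
  have "c_vector C d T U u (K0_class C T (frag_of t)) = - index_fun U ?H (\<Sigma>O C t)"
    by (rule c_vector_coindex[OF T U \<open>odd d\<close> additive_on_Hom kdim_Hom_Indec t])
  also have "\<dots> = alt_sum ?H (rev us)"
    using U.index_fun_eq[OF additive_on_Hom us] len \<open>odd d\<close> by (simp add: alt_sum_rev)
  finally show ?thesis using kdim_difference[OF \<gamma>] sub \<open>odd d\<close> by simp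
qed

lemma image_exclusive:
  assumes "Calabi_Yau_2d C" and T: "cluster_tilting C d T"
    and t: "t \<in> add_closure C T" "a \<in> Hom C t u" "\<delta> \<cdot> a \<noteq> 0"
    and t': "t' \<in> add_closure C T" "a' \<in> Hom C t' u'"
  shows "\<epsilon> \<cdot> a' = 0"
proof -
  interpret T: cluster_tilting_category C d T by unfold_locales (rule T)
  obtain w where w: "w \<in> Hom C u' (\<Sigma>O C t)" "\<Sigma>M C a \<cdot> w \<noteq> 0"
    using Calabi_Yau_nondegenerate[OF assms(1) t(2) \<delta>_Hom t(3)] .
  note Sa = \<Sigma>_Hom[OF t(2)]
  obtain c where c: "\<epsilon> = scl C c (\<Sigma>M C a \<cdot> w)"
    using kdim_1_multiple[OF kdim_pair(2) Comp_closed[OF w(1) Sa] w(2) \<epsilon>_Hom] .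
  \<comment> \<open>A map from add(T) to the shift of add(T).\<close>
  have "w \<cdot> a' = 0" using Comp_closed[OF t'(2) w(1)] T.rigid[OF t'(1) t(1)] by blast
  then have "(\<Sigma>M C a \<cdot> w) \<cdot> a' = 0" using Comp_assoc'[OF t'(2) w(1) Sa] Sa by simp
  then show ?thesis using c Comp_scl_left[OF t'(2) Comp_closed[OF w(1) Sa]] by simp
qed

end

section \<open>Exclusivity of the two images and the sign of the c-vector\<close>

theorem proposition4p7:
  fixes C :: "('o, 'm::ab_group_add, 'k::alg_closed_field, 'z) angcat_scheme"
    and d :: nat and T U u u' :: 'o and \<delta> \<epsilon> :: 'm
  assumes "angulated_category C d"
    and "Hom_finite C"
    and "Krull_Schmidt C"
    and "Calabi_Yau_2d C"
    and "cluster_tilting C d T" and "basic C T"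
    and "cluster_tilting C d U" and "basic C U"
    and "odd d"
    and "mutable_at C d U u u'"
    and "exchange_pair C d U u u'"
    and "exchange_angle C d U u u' u \<delta>"
    and "exchange_angle C d U u u u' \<epsilon>"
  shows "((\<forall>t\<in>add_closure C T. c_vector C d T U u (K0_class C T (frag_of t)) \<ge> 0) \<longrightarrow>
      (\<forall>t\<in>add_closure C T. c_vector C d T U u (K0_class C T (frag_of t)) =
         int (kdim C ((\<lambda>f. Comp C \<delta> f) ` Hom C t u)))) \<and>
    ((\<forall>t\<in>add_closure C T. c_vector C d T U u (K0_class C T (frag_of t)) \<le> 0) \<longrightarrow>
      (\<forall>t\<in>add_closure C T. c_vector C d T U u (K0_class C T (frag_of t)) =
         - int (kdim C ((\<lambda>f. Comp C \<epsilon> f) ` Hom C t u'))))"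
proof -
  interpret exchange_situation C d U u u' \<delta> \<epsilon>
    by (intro exchange_situation.intro exchange_situation_axioms.intro
        ks_angulated_category.intro ks_angulated_category_axioms.intro assms)
  let ?c = "\<lambda>t. c_vector C d T U u (K0_class C T (frag_of t))"
  let ?M = "\<lambda>t. int (kdim C ((\<lambda>f. Comp C \<delta> f) ` Hom C t u))"
  let ?N = "\<lambda>t. int (kdim C ((\<lambda>f. Comp C \<epsilon> f) ` Hom C t u'))"
  have c: "?c t = ?M t - ?N t" if "t \<in> add_closure C T" for t
    using c_vector_difference[OF assms(5,9) that] .
  have zero: "int (kdim C ((\<lambda>f. Comp C g f) ` Hom C t X)) = 0" if "\<forall>f\<in>Hom C t X. Comp C g f = 0" for g t X
  proof -
    have "Comp C g 0 = 0" using that zero_Hom by blast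
    then have "0 \<in> (\<lambda>f. Comp C g f) ` Hom C t X" using zero_Hom[of t X] by (intro image_eqI[of _ _ 0]) simp_all
    then have "(\<lambda>f. Comp C g f) ` Hom C t X = {0}" using that by blast
    then show ?thesis by simp
  qed
  \<comment> \<open>The alternative is uniform in \<open>t\<close>: a single nonzero composite with
    \<delta> makes \<epsilon> vanish on maps from every object of add(T).\<close>
  consider "\<forall>t\<in>add_closure C T. ?M t = 0" | "\<forall>t\<in>add_closure C T. ?N t = 0"
  proof (cases "\<forall>t\<in>add_closure C T. \<forall>a\<in>Hom C t u. Comp C \<delta> a = 0")
    case True
    then show ?thesis by (intro that(1) ballI zero) blast
  next
    case False
    then obtain t a where "t \<in> add_closure C T" "a \<in> Hom C t u" "Comp C \<delta> a \<noteq> 0" by blast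
    note image_exclusive[OF assms(4,5) this]
    then show ?thesis by (intro that(2) ballI zero) blast
  qed
  \<comment> \<open>Only one term survives and it fixes the sign. If the sign hypothesis is the
    opposite one, the c-vector is zero on add(T), both terms vanish, and the formula still
    holds.\<close>
  then show ?thesis
  proof cases
    case 1
    then have "?c t = - ?N t" "?N t \<ge> 0" if "t \<in> add_closure C T" for t using c[OF that] that by auto
    then show ?thesis using 1 by fastforce
  next
    case 2
    then have "?c t = ?M t" "?M t \<ge> 0" if "t \<in> add_closure C T" for t using c[OF that] that by auto
    then show ?thesis using 2 by fastforce
  qed
qed

end
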